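(* Let $G$ be a finite group. There exists a polynomial-time algorithm for the problem GENERATE: given a prefilter $\pi:\mathbb{N}^d\to 2^G$ such that for every $1\neq H\in\operatorname{im}(\pi)$ the set $\{s\in\mathbb{N}^d : \pi_s=H\}$ has a maximum, return its closure $\overline{\pi}:\mathbb{N}^d\to 2^G$.
   Context: $\mathbb{N}$ is the set of nonnegative integers, $\mathbb{N}^d$ is ordered by the lexicographical order $\preceq$, and $2^G$ is the set of all subsets of $G$. For subgroups $A,B$ of $G$, $[A,B]=\langle a^{-1}b^{-1}ab : a\in A, b\in B\rangle$, and $[A_1,\dots,A_k]=[[A_1,\dots,A_{k-1}],A_k]$ (with $[A_1]=A_1$). A prefilter $\pi:\mathbb{N}^d\to 2^G$ is a function such that each $\pi_x$ is a normal subgroup of $G$ and $x\preceq y$ implies $\pi_x\ge\pi_y$. A filter is a function $\phi:\mathbb{N}^d\to 2^G$ into the normal subgroups of $G$ such that for all $s,t$: $[\phi_s,\phi_t]\le\phi_{s+t}$, and $s\preceq t$ implies $\phi_t\le\phi_s$. A partition of $s\in\mathbb{N}^d$ is a finite sequence $P=(s_1,\dots,s_k)$ of elements of $\mathbb{N}^d$ with $s=\sum_{i=1}^k s_i$; $\mathcal{P}(s)$ is the set of partitions of $s$, and $[\pi_P]=[\pi_{s_1},\dots,\pi_{s_k}]$. The closure of $\pi$ is the function $\overline{\pi}:\mathbb{N}^d\to 2^G$, $\overline{\pi}_s=\prod_{P\in\mathcal{P}(s)}[\pi_P]$ (it is a known fact that $\overline{\pi}$ is a filter). Data structure: for a filter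 or prefilter $\phi:\mathbb{N}^d\to 2^G$ and $H\in\operatorname{im}(\phi)$ let $I_H=\{s\in\mathbb{N}^d : \phi_s=H\}$. $\phi$ is stored as a sign together with the set of pairs $(m,H)$, one for each $1\neq H\in\operatorname{im}(\phi)$. If every $I_H$ with $1\ne H\in\operatorname{im}(\phi)$ has a maximum, then $\operatorname{sign}(\phi)=1$ and $m=\max(I_H)$; otherwise $\operatorname{sign}(\phi)=-1$ and $m=\min(I_H)$. Subgroups are given by generators. Complexity: an algorithm runs in polynomial time if the number of operations it uses is bounded by a polynomial in the input length (which can be as small as $\log|G|$). Groups are given in a standard model of computation (permutation groups, matrix groups, or finite, e.g. power-conjugate, presentations), and operations in $\mathbb{N}^d$, applications of $\preceq$, and computing orders of subgroups and normal closures (hence commutator subgroups and products of normal subgroups) are assumed available efficiently. *)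

theory Defs
  imports
    "HOL-Algebra.Algebra"
    "HOL-Computational_Algebra.Polynomial"
    "HOL-Library.List_Lexorder"
    "HOL-Library.Log_Nat"
begin

section \<open>Prefilters and closures\<close>

text \<open>
  The dimension \<open>d\<close> is part of the input of the algorithm, so \<open>\<nat>\<^sup>d\<close> is represented by the lists of
  length \<open>d\<close>. On lists of equal length the order of \<open>List_Lexorder\<close> is the lexicographical order,
  with the first coordinate most significant. A function \<open>\<phi> :: nat list \<Rightarrow> 'g set\<close> stands for its
  restriction to \<open>vecs d\<close>; its values elsewhere are never used.
\<close>

definition vecs :: "nat \<Rightarrow> nat list set" where
  "vecs d = {s. length s = d}"

definition vec_sum :: "nat \<Rightarrow> nat list list \<Rightarrow> nat list" where
  "vec_sum d P = foldr (map2 (+)) P (replicate d 0)"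

definition prefilter :: "('g, 'b) monoid_scheme \<Rightarrow> nat \<Rightarrow> (nat list \<Rightarrow> 'g set) \<Rightarrow> bool" where
  "prefilter G d \<pi> \<longleftrightarrow>
     (\<forall>s\<in>vecs d. \<pi> s \<lhd> G) \<and>
     (\<forall>s\<in>vecs d. \<forall>t\<in>vecs d. s \<le> t \<longrightarrow> \<pi> t \<subseteq> \<pi> s)"

definition commutator :: "('g, 'b) monoid_scheme \<Rightarrow> 'g set \<Rightarrow> 'g set \<Rightarrow> 'g set" where
  "commutator G A B =
     generate G {inv\<^bsub>G\<^esub> a \<otimes>\<^bsub>G\<^esub> inv\<^bsub>G\<^esub> b \<otimes>\<^bsub>G\<^esub> a \<otimes>\<^bsub>G\<^esub> b | a b. a \<in> A \<and> b \<in> B}"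

text \<open>Left-normed: \<open>[A\<^sub>1, \<dots>, A\<^sub>k] = [[A\<^sub>1, \<dots>, A\<^sub>k\<^sub>-\<^sub>1], A\<^sub>k]\<close>; only used for \<open>k \<ge> 1\<close>.\<close>

definition iter_commutator :: "('g, 'b) monoid_scheme \<Rightarrow> 'g set list \<Rightarrow> 'g set" where
  "iter_commutator G As = foldl (commutator G) (hd As) (tl As)"

text \<open>Partitions are nonempty sequences; zero vectors are allowed as parts.\<close>

definition partitions :: "nat \<Rightarrow> nat list \<Rightarrow> nat list list set" where
  "partitions d s = {P. P \<noteq> [] \<and> set P \<subseteq> vecs d \<and> vec_sum d P = s}"

text \<open>
  A vector has infinitely many partitions. The product of a possibly infinite family of normal
  subgroups is the set of all finite products of their elements, i.e. the subgroup generated by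
  their union.
\<close>

definition filter_closure ::
    "('g, 'b) monoid_scheme \<Rightarrow> nat \<Rightarrow> (nat list \<Rightarrow> 'g set) \<Rightarrow> nat list \<Rightarrow> 'g set" where
  "filter_closure G d \<pi> s = generate G (\<Union>P\<in>partitions d s. iter_commutator G (map \<pi> P))"


section \<open>The data structure\<close>

definition level_set :: "nat \<Rightarrow> (nat list \<Rightarrow> 'g set) \<Rightarrow> 'g set \<Rightarrow> nat list set" where
  "level_set d \<phi> H = {s \<in> vecs d. \<phi> s = H}"

definition is_max :: "'a::order set \<Rightarrow> 'a \<Rightarrow> bool" where
  "is_max I m \<longleftrightarrow> m \<in> I \<and> (\<forall>s\<in>I. s \<le> m)"

definition is_min :: "'a::order set \<Rightarrow> 'a \<Rightarrow> bool" where
  "is_min I m \<longleftrightarrow> m \<in> I \<and> (\<forall>s\<in>I. m \<le> s)"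

definition has_maxima :: "('g, 'b) monoid_scheme \<Rightarrow> nat \<Rightarrow> (nat list \<Rightarrow> 'g set) \<Rightarrow> bool" where
  "has_maxima G d \<phi> \<longleftrightarrow>
     (\<forall>H \<in> \<phi> ` vecs d. H \<noteq> {\<one>\<^bsub>G\<^esub>} \<longrightarrow> (\<exists>m. is_max (level_set d \<phi> H) m))"

text \<open>
  A stored function is a sign and an enumeration, in any order and without repetition, of the pairs
  \<open>(m, H)\<close>, where \<open>H\<close> is given by a list of generators.
\<close>

type_synonym 'g stored = "int \<times> (nat list \<times> 'g list) list"

definition stores ::
    "('g, 'b) monoid_scheme \<Rightarrow> nat \<Rightarrow> (nat list \<Rightarrow> 'g set) \<Rightarrow> 'g stored \<Rightarrow> bool" where
  "stores G d \<phi> D \<longleftrightarrow>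
     (let sgn_\<phi> = fst D;
          pairs = map (\<lambda>(m, S). (m, generate G (set S))) (snd D)
      in sgn_\<phi> = (if has_maxima G d \<phi> then 1 else -1) \<and>
         (\<forall>(m, S) \<in> set (snd D). set S \<subseteq> carrier G) \<and>
         distinct pairs \<and>
         set pairs = {(m, H). H \<in> \<phi> ` vecs d \<and> H \<noteq> {\<one>\<^bsub>G\<^esub>} \<and>
           (if sgn_\<phi> = 1 then is_max (level_set d \<phi> H) m else is_min (level_set d \<phi> H) m)})"


section \<open>Models of computation for groups\<close>

text \<open>
  Permutation groups, matrix groups and finite (e.g. power-conjugate) presentations enter only
  through the following interface. Elements are unique codes of \<open>elem_len\<close> bits. Every group
  operation acts on a list of elements and takes a number of steps prescribed by the model.
  The normal closure in the whole group is returned by generators, which the model may choose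
  freely. Commutators and products of normal subgroups are not provided; a program has to compute
  them from these operations.
\<close>

datatype group_op = Mult | Inverse | Equal | Order | Normal_Closure

record 'g group_model =
  grp :: "'g monoid"
  elem_len :: nat
  closure_gens :: "'g list \<Rightarrow> 'g list"
  op_time :: "group_op \<Rightarrow> 'g list \<Rightarrow> nat"

definition normal_closure :: "('g, 'b) monoid_scheme \<Rightarrow> 'g set \<Rightarrow> 'g set" where
  "normal_closure G S = \<Inter>{N. N \<lhd> G \<and> S \<subseteq> N}"

text \<open>
  The polynomial \<open>q\<close> bounds the time of the group operations in terms of the bit length of their
  arguments (the extra summand \<open>elem_len\<close> covers the empty list). Writing down the generators of a
  normal closure takes at least as many steps as there are generators.
\<close>

definition efficient_model :: "nat poly \<Rightarrow> 'g group_model \<Rightarrow> bool" where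
  "efficient_model q M \<longleftrightarrow>
     group (grp M) \<and> finite (carrier (grp M)) \<and>
     card (carrier (grp M)) \<le> 2 ^ elem_len M \<and>
     (\<forall>xs. set xs \<subseteq> carrier (grp M) \<longrightarrow>
        set (closure_gens M xs) \<subseteq> carrier (grp M) \<and>
        generate (grp M) (set (closure_gens M xs)) = normal_closure (grp M) (set xs) \<and>
        length (closure_gens M xs) \<le> op_time M Normal_Closure xs \<and>
        (\<forall>f. op_time M f xs \<le> poly q (elem_len M * Suc (length xs))))"


section \<open>Programs\<close>

text \<open>
  While-programs over registers that hold binary trees whose leaves are integers, group elements or
  \<open>VNil\<close>. Lists are trees in the usual way, \<open>VNil\<close> is falsity and every other value is truth. The
  syntax does not mention the type of group elements and contains no group elements, so a program
  has access to a group only through the operations of the model.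
\<close>

datatype 'g val = VNil | VInt int | VElem 'g | VPair "'g val" "'g val"

datatype expr =
    Reg nat
  | NilE
  | Const int
  | PairE expr expr
  | Fst expr
  | Snd expr
  | Add expr expr
  | Sub expr expr
  | Less expr expr
  | Group_Op group_op expr

datatype prog =
    Assign nat expr
  | Seq prog prog
  | Cond expr prog prog
  | While expr prog

fun list_val :: "'g val list \<Rightarrow> 'g val" where
  "list_val [] = VNil"
| "list_val (v # vs) = VPair v (list_val vs)"

definition bool_val :: "bool \<Rightarrow> 'g val" where
  "bool_val b = (if b then VInt 1 else VNil)"

fun val_elems :: "'g val \<Rightarrow> 'g list" where
  "val_elems (VPair (VElem x) v) = x # val_elems v"
| "val_elems _ = []"

fun val_fst :: "'g val \<Rightarrow> 'g val" where
  "val_fst (VPair v w) = v"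
| "val_fst _ = VNil"

fun val_snd :: "'g val \<Rightarrow> 'g val" where
  "val_snd (VPair v w) = w"
| "val_snd _ = VNil"

fun val_int :: "'g val \<Rightarrow> int" where
  "val_int (VInt i) = i"
| "val_int _ = 0"

fun apply_op :: "'g group_model \<Rightarrow> group_op \<Rightarrow> 'g list \<Rightarrow> 'g val" where
  "apply_op M Mult [x, y] = VElem (x \<otimes>\<^bsub>grp M\<^esub> y)"
| "apply_op M Inverse [x] = VElem (inv\<^bsub>grp M\<^esub> x)"
| "apply_op M Equal [x, y] = bool_val (x = y)"
| "apply_op M Order xs = VInt (int (card (generate (grp M) (set xs))))"
| "apply_op M Normal_Closure xs = list_val (map VElem (closure_gens M xs))"
| "apply_op M _ _ = VNil"

type_synonym 'g regs = "nat \<Rightarrow> 'g val"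

fun eval :: "'g group_model \<Rightarrow> expr \<Rightarrow> 'g regs \<Rightarrow> 'g val" where
  "eval M (Reg i) r = r i"
| "eval M NilE r = VNil"
| "eval M (Const c) r = VInt c"
| "eval M (PairE a b) r = VPair (eval M a r) (eval M b r)"
| "eval M (Fst a) r = val_fst (eval M a r)"
| "eval M (Snd a) r = val_snd (eval M a r)"
| "eval M (Add a b) r = VInt (val_int (eval M a r) + val_int (eval M b r))"
| "eval M (Sub a b) r = VInt (val_int (eval M a r) - val_int (eval M b r))"
| "eval M (Less a b) r = bool_val (val_int (eval M a r) < val_int (eval M b r))"
| "eval M (Group_Op f a) r = apply_op M f (val_elems (eval M a r))"

text \<open>
  One step for every operation, plus the time the model takes for a group operation. Unit cost is
  harmless for trees (\<open>PairE\<close>, \<open>Fst\<close>, \<open>Snd\<close> handle pointers) and for integers: without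
  multiplication, each operation exceeds the largest bit length so far by at most one. The result
  of \<open>Order\<close> has at most \<open>elem_len + 1\<close> bits.
\<close>

fun eval_time :: "'g group_model \<Rightarrow> expr \<Rightarrow> 'g regs \<Rightarrow> nat" where
  "eval_time M (Reg i) r = 1"
| "eval_time M NilE r = 1"
| "eval_time M (Const c) r = 1"
| "eval_time M (PairE a b) r = 1 + eval_time M a r + eval_time M b r"
| "eval_time M (Fst a) r = 1 + eval_time M a r"
| "eval_time M (Snd a) r = 1 + eval_time M a r"
| "eval_time M (Add a b) r = 1 + eval_time M a r + eval_time M b r"
| "eval_time M (Sub a b) r = 1 + eval_time M a r + eval_time M b r"
| "eval_time M (Less a b) r = 1 + eval_time M a r + eval_time M b r"
| "eval_time M (Group_Op f a) r =
     1 + eval_time M a r + op_time M f (val_elems (eval M a r))"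

text \<open>\<open>exec M c r t r'\<close>: started in \<open>r\<close>, program \<open>c\<close> terminates in \<open>r'\<close> after \<open>t\<close> steps.\<close>

inductive exec :: "'g group_model \<Rightarrow> prog \<Rightarrow> 'g regs \<Rightarrow> nat \<Rightarrow> 'g regs \<Rightarrow> bool"
  for M :: "'g group_model" where
  Assign: "exec M (Assign i a) r (1 + eval_time M a r) (r(i := eval M a r))"
| Seq: "exec M c1 r t1 r' \<Longrightarrow> exec M c2 r' t2 r'' \<Longrightarrow>
    exec M (Seq c1 c2) r (t1 + t2) r''"
| Cond_True: "eval M b r \<noteq> VNil \<Longrightarrow> exec M c1 r t r' \<Longrightarrow>
    exec M (Cond b c1 c2) r (1 + eval_time M b r + t) r'"
| Cond_False: "eval M b r = VNil \<Longrightarrow> exec M c2 r t r' \<Longrightarrow>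
    exec M (Cond b c1 c2) r (1 + eval_time M b r + t) r'"
| While_True: "eval M b r \<noteq> VNil \<Longrightarrow> exec M c r t1 r' \<Longrightarrow>
    exec M (While b c) r' t2 r'' \<Longrightarrow>
    exec M (While b c) r (1 + eval_time M b r + t1 + t2) r''"
| While_False: "eval M b r = VNil \<Longrightarrow>
    exec M (While b c) r (1 + eval_time M b r) r"


section \<open>Input, output and input length\<close>

definition encode :: "'g stored \<Rightarrow> 'g val" where
  "encode D = VPair (VInt (fst D))
     (list_val (map (\<lambda>(m, S). VPair (list_val (map (\<lambda>k. VInt (int k)) m))
                                    (list_val (map VElem S))) (snd D)))"

definition runs :: "'g group_model \<Rightarrow> prog \<Rightarrow> 'g stored \<Rightarrow> nat \<Rightarrow> 'g stored \<Rightarrow> bool" where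
  "runs M c D t D' \<longleftrightarrow>
     (\<exists>r'. exec M c ((\<lambda>_. VNil)(0 := encode D)) t r' \<and> r' 0 = encode D')"

text \<open>
  The number of bits of the sign, the coordinates and the generators. One additional bit per
  coordinate accounts for the coordinate 0, since \<open>floorlog 2 0 = 0\<close>.
\<close>

definition input_length :: "'g group_model \<Rightarrow> 'g stored \<Rightarrow> nat" where
  "input_length M D =
     1 + (\<Sum>(m, S) \<leftarrow> snd D. (\<Sum>k\<leftarrow>m. Suc (floorlog 2 k)) + elem_len M * length S)"

end

theory Submission
  imports Defs
begin

text \<open>
  Let \<open>m\<^sub>1, \<dots>, m\<^sub>k\<close> be the stored maxima of the prefilter and \<open>H\<^sub>1, \<dots>, H\<^sub>k\<close> the subgroups that belong to
  them. Every part of a partition can be raised to the maximum of its level without changing its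
  subgroup, and the closure is decreasing. Hence the closure at \<open>s\<close> is generated by the iterated commutators
  \<open>[H\<^sub>j | j \<in> J]\<close> over all finite sequences \<open>J\<close> of indices with \<open>s \<le> \<Sum>j\<in>J. m\<^sub>j\<close>
  (\<open>partition_covered\<close>).

  There are infinitely many such \<open>J\<close>, and the coordinates of \<open>m\<^sub>j\<close> are written in binary, so the
  sums that matter cannot be listed one step at a time. Along \<open>J\<close> the groups
  \<open>[H\<^sub>j | j \<in> initial segment]\<close> decrease. They decrease strictly at most \<open>log |H\<^sub>1|\<close> times. Between
  two strict steps the group \<open>A\<close> satisfies \<open>[A, H\<^sub>j] = A\<close>, and then \<open>H\<^sub>j\<close> can be appended
  arbitrarily often. So \<open>A\<close> occurs at the limit of the weights \<open>w + n m\<^sub>j\<close>, which is infinite in the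
  first nonzero coordinate of \<open>m\<^sub>j\<close>. Such limits are called weights; they are represented by
  the finite coordinates that precede the first infinite one. One limit step replaces a whole
  plateau, because the remaining summands of the plateau either change only coordinates behind the
  infinite one or have a still earlier leading coordinate, which may be taken instead.
  Therefore \<open>2 log |H\<^sub>1| + 1\<close> rounds of ``append one \<open>H\<^sub>j\<close> once or infinitely often''
  reach every \<open>J\<close> (\<open>all_reached\<close>, \<open>covers_all\<close>), and nothing is found that does not lie in the
  closure (\<open>sound_expand\<close>).

  After each round the state is brought into a canonical form (\<open>canonical\<close>): subgroups are
  accumulated from the large weights to the small ones, so that they form a strictly
  decreasing chain of at most logarithmic length, and generating lists are thinned out to at most
  \<open>log |G|\<close> elements. This keeps the state small in spite of the polynomial growth that every normal
  closure may cause. The limit group of a pump is \<open>[K, H\<^sub>j, \<dots>, H\<^sub>j]\<close> with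
  \<open>log |H\<^sub>1|\<close> factors \<open>H\<^sub>j\<close>, since the chain of these commutators is then stationary.
  In the final chain the weight of a subgroup is the maximum of its level if it is a vector,
  and the level has no maximum if the weight is infinite; the minimum of a level is the
  successor of the preceding weight (\<open>stored_levels_correct\<close>).

  For the running time, functions on encoded data that are computed by a program in polynomial
  time are shown to be closed under composition, pairing, case distinction and list iteration with
  results of polynomial size. The algorithm is a composition of such functions.
\<close>

section \<open>Vectors with infinite coordinates\<close>

text \<open>
  A weight is a list of length at most \<open>d\<close>. A weight of length \<open>d\<close> is a vector; a shorter one is
  continued by an infinite coordinate, so it is larger than each of its extensions, and \<open>[]\<close> is the
  largest weight.
\<close>

fun below :: "nat list \<Rightarrow> nat list \<Rightarrow> bool" where
  "below xs [] \<longleftrightarrow> True"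
| "below [] (y # ys) \<longleftrightarrow> False"
| "below (x # xs) (y # ys) \<longleftrightarrow> x < y \<or> x = y \<and> below xs ys"

text \<open>
  The truncation of \<open>map2\<close> to the shorter list is what the sum of weights needs: a coordinate is
  infinite as soon as it is infinite in one summand.
\<close>

abbreviation plus_vec :: "nat list \<Rightarrow> nat list \<Rightarrow> nat list" (infixl "+\<^sub>v" 65) where
  "u +\<^sub>v v \<equiv> map2 (+) u v"

text \<open>
  The supremum of \<open>w + n m\<close> over all \<open>n\<close>: the first nonzero coordinate of \<open>m\<close> becomes infinite.
\<close>

definition trunc :: "nat list \<Rightarrow> nat list \<Rightarrow> nat list" where
  "trunc m w = take (length (takeWhile ((=) 0) m)) w"

lemma below_refl [simp]: "below w w"
  by (induction w) auto

lemma below_trans: "below u v \<Longrightarrow> below v w \<Longrightarrow> below u w"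
proof (induction u v arbitrary: w rule: below.induct)
  case (1 xs)
  then show ?case by (cases w) auto
next
  case (3 x xs y ys)
  then show ?case by (cases w) auto
qed auto

lemma below_total: "below u v \<or> below v u"
  by (induction u v rule: below.induct) auto

lemma below_eq_le: "length s = length t \<Longrightarrow> below s t \<longleftrightarrow> s \<le> t"
  by (induction s t rule: list_induct2) auto

lemma below_add_mono: "below s w \<Longrightarrow> below t v \<Longrightarrow> below (s +\<^sub>v t) (w +\<^sub>v v)"
proof (induction s w arbitrary: t v rule: below.induct)
  case (3 x xs y ys)
  then show ?case by (cases t; cases v) auto
qed auto

lemma below_take_both: "below s w \<Longrightarrow> below (take l s) (take l w)"
proof (induction s w arbitrary: l rule: below.induct)
  case (3 x xs y ys)
  then show ?case by (cases l) auto
qed auto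

lemma below_of_take: "below (take l s) w \<Longrightarrow> length w \<le> l \<Longrightarrow> below s w"
proof (induction s w arbitrary: l rule: below.induct)
  case (3 x xs y ys)
  then show ?case by (cases l) auto
qed auto

lemma below_zeros: "length w \<le> n \<Longrightarrow> below (replicate n 0) w"
proof (induction w arbitrary: n)
  case (Cons a w)
  then show ?case by (cases n) auto
qed auto

lemma le_add_vec: "length s = length m \<Longrightarrow> s \<le> s +\<^sub>v m"
  by (induction s m rule: list_induct2) auto

text \<open>
  A bound by a sum with an infinite weight is already witnessed by a vector below that weight, so
  that facts about vectors carry over to weights. If \<open>s\<close> is strictly smaller at some coordinate, the
  rest of the witness may be zero; in an infinite coordinate \<open>s\<close> itself serves.
\<close>

lemma le_add_vec_split_extended:
  assumes "below s (w +\<^sub>v m)" "length s = length m" "length w \<le> length m"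
  shows "\<exists>t. length t = length m \<and> below t w \<and> s \<le> t +\<^sub>v m"
  using assms(2,1,3)
proof (induction s m arbitrary: w rule: list_induct2)
  case Nil
  then show ?case by auto
next
  case (Cons x s k m)
  show ?case
  proof (cases w)
    case Nil
    then show ?thesis using Cons.hyps le_add_vec[of "x # s" "k # m"] by (intro exI[of _ "x # s"]) auto
  next
    case w: (Cons y w')
    show ?thesis
    proof (cases "x < y + k")
      case True
      then show ?thesis using w Cons.prems below_zeros[of w' "length m"]
        by (intro exI[of _ "y # replicate (length m) 0"]) auto
    next
      case False
      then have "x = y + k" "below s (w' +\<^sub>v m)" using Cons.prems w by auto
      moreover obtain t where "length t = length m" "below t w'" "s \<le> t +\<^sub>v m"
        using Cons.IH[of w'] calculation Cons.prems w by auto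
      ultimately show ?thesis using w by (intro exI[of _ "y # t"]) auto
    qed
  qed
qed

text \<open>
  Either \<open>s\<close> is below \<open>w\<close> anyway, or it agrees with \<open>w\<close> up to the leading coordinate of \<open>m\<close>, and
  then sufficiently many summands \<open>m\<close> exceed it there.
\<close>

lemma below_trunc_pump:
  assumes "below s (trunc m w)" "length s = length m" "length w \<le> length m"
  shows "\<exists>t n. length t = length m \<and> below t w \<and> s \<le> ((\<lambda>t. t +\<^sub>v m) ^^ n) t"
  using assms(2,1,3)
proof (induction s m arbitrary: w rule: list_induct2)
  case Nil
  then show ?case by (auto intro!: exI[of _ 0])
next
  case (Cons x s k m)
  have sameI: ?case if "below (x # s) w"
    using that Cons.hyps by (intro exI[of _ "x # s"] exI[of _ 0]) auto
  show ?case
  proof (cases w)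
    case Nil
    then show ?thesis by (intro sameI) auto
  next
    case w: (Cons y w')
    have it: "\<exists>u. ((\<lambda>t. t +\<^sub>v (k # m)) ^^ n) (y # t) = (y + n * k) # u \<and> u = ((\<lambda>t. t +\<^sub>v m) ^^ n) t" for n t
      by (induction n) auto
    show ?thesis
    proof (cases "k = 0")
      case True
      then have tr: "trunc (k # m) w = y # trunc m w'" using w by (simp add: trunc_def)
      show ?thesis
      proof (cases "x < y")
        case True
        then show ?thesis using w by (intro sameI) auto
      next
        case False
        then have "x = y" "below s (trunc m w')" using Cons.prems tr by auto
        then obtain t n where t: "length t = length m" "below t w'" "s \<le> ((\<lambda>t. t +\<^sub>v m) ^^ n) t"
          using Cons.IH[of w'] Cons.prems w by auto
        then show ?thesis using w it[of n t] \<open>x = y\<close> \<open>k = 0\<close>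
          by (intro exI[of _ "y # t"] exI[of _ n]) auto
      qed
    next
      case False
      let ?t = "replicate (length m) 0"
      have "x < y + Suc x * k" using False by (cases k) auto
      then show ?thesis using w it[of "Suc x" ?t] Cons.prems below_zeros[of w' "length m"]
        by (intro exI[of _ "y # ?t"] exI[of _ "Suc x"]) auto
    qed
  qed
qed

text \<open>
  At the first coordinate where \<open>s\<close> is smaller than the sum, one summand can be made strictly
  smaller and take over all later coordinates of \<open>s\<close>; the other one continues with zeros.
\<close>

lemma le_add_vec_split:
  assumes "s \<le> a +\<^sub>v b" "length s = length a" "length a = length b"
  shows "\<exists>a' b'. length a' = length a \<and> length b' = length a \<and> a' \<le> a \<and> b' \<le> b \<and> s = a' +\<^sub>v b'"
  using assms(2,3,1)
proof (induction s a b rule: list_induct3)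
  case Nil
  then show ?case by auto
next
  case (Cons x s y a z b)
  let ?z = "replicate (length a) (0::nat)"
  have add0: "s = s +\<^sub>v ?z" "s = ?z +\<^sub>v s"
    using Cons.hyps(1) by (induction s a rule: list_induct2) auto
  have z: "?z \<le> a" "?z \<le> b"
    using below_zeros[of a "length a"] below_zeros[of b "length a"] Cons.hyps by (auto simp: below_eq_le)
  consider "x = y + z" "s \<le> a +\<^sub>v b" | "x < y + z" "x < y" | "x < y + z" "y \<le> x"
    using Cons.prems by (cases "x < y") auto
  then show ?case
  proof cases
    case 1
    then obtain a' b' where "length a' = length a" "length b' = length a" "a' \<le> a" "b' \<le> b" "s = a' +\<^sub>v b'"
      using Cons.IH by auto
    then show ?thesis using 1 by (intro exI[of _ "y # a'"] exI[of _ "z # b'"]) auto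
  next
    case 2
    then show ?thesis using Cons.hyps z add0 by (intro exI[of _ "x # s"] exI[of _ "0 # ?z"]) auto
  next
    case 3
    then show ?thesis using Cons.hyps z add0 by (intro exI[of _ "y # ?z"] exI[of _ "(x - y) # s"]) auto
  qed
qed

lemma vec_sum_Cons: "vec_sum d (p # P) = p +\<^sub>v vec_sum d P"
  by (simp add: vec_sum_def)

lemma length_vec_sum: "set P \<subseteq> vecs d \<Longrightarrow> length (vec_sum d P) = d"
  by (induction P) (auto simp: vec_sum_def vecs_def)

lemma add_zeros [simp]: "length p = d \<Longrightarrow> p +\<^sub>v replicate d 0 = p" "length p = d \<Longrightarrow> replicate d 0 +\<^sub>v p = p"
  by (induction p arbitrary: d) auto

lemma add_vec_assoc: "(u +\<^sub>v v) +\<^sub>v w = u +\<^sub>v (v +\<^sub>v w)"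
proof (induction u arbitrary: v w)
  case (Cons a u)
  then show ?case by (cases v; cases w) auto
qed simp

lemma vec_sum_snoc:
  assumes "set P \<subseteq> vecs d" "p \<in> vecs d"
  shows "vec_sum d (P @ [p]) = vec_sum d P +\<^sub>v p"
  using assms
proof (induction P)
  case Nil
  then show ?case by (simp add: vec_sum_def vecs_def)
next
  case (Cons q P)
  then show ?case by (simp add: vec_sum_Cons add_vec_assoc)
qed

text \<open>
  The reason why the closure is decreasing: lowering the parts only enlarges the subgroups.
\<close>

lemma lower_partition:
  assumes "P \<in> partitions d t" "s \<in> vecs d" "s \<le> t"
  shows "\<exists>P' \<in> partitions d s. list_all2 (\<le>) P' P"
proof -
  have "\<exists>P'. P' \<noteq> [] \<and> set P' \<subseteq> vecs d \<and> vec_sum d P' = s \<and> list_all2 (\<le>) P' P"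
    if "P \<noteq> []" "set P \<subseteq> vecs d" "s \<in> vecs d" "s \<le> vec_sum d P"
    using that
  proof (induction P arbitrary: s)
    case (Cons p P)
    show ?case
    proof (cases "P = []")
      case True
      then show ?thesis using Cons.prems by (intro exI[of _ "[s]"]) (auto simp: vec_sum_def vecs_def)
    next
      case False
      have "s \<le> p +\<^sub>v vec_sum d P" using Cons.prems by (simp add: vec_sum_Cons)
      moreover have "length s = length p" "length p = length (vec_sum d P)"
        using Cons.prems length_vec_sum[of P d] by (auto simp: vecs_def)
      ultimately obtain a b where ab: "length a = length p" "length b = length p" "a \<le> p" "b \<le> vec_sum d P" "s = a +\<^sub>v b"
        using le_add_vec_split by blast
      have "b \<in> vecs d" "a \<in> vecs d" using ab Cons.prems by (auto simp: vecs_def)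
      then obtain P' where "P' \<noteq> []" "set P' \<subseteq> vecs d" "vec_sum d P' = b" "list_all2 (\<le>) P' P"
        using Cons.IH[of b] False Cons.prems ab(4) by auto
      then show ?thesis using ab \<open>a \<in> vecs d\<close> by (intro exI[of _ "a # P'"]) (auto simp: vec_sum_Cons)
    qed
  qed simp
  then show ?thesis using assms by (auto simp: partitions_def)
qed

section \<open>Commutators of normal subgroups\<close>

definition (in group) comm :: "'a \<Rightarrow> 'a \<Rightarrow> 'a" where
  "comm x y = inv x \<otimes> inv y \<otimes> x \<otimes> y"

context group
begin

lemma inv_cancel [simp]:
  assumes "x \<in> carrier G" "z \<in> carrier G"
  shows "inv x \<otimes> (x \<otimes> z) = z" "x \<otimes> (inv x \<otimes> z) = z"
  using assms by (simp_all add: m_assoc[symmetric])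

lemma comm_closed [simp]: "x \<in> carrier G \<Longrightarrow> y \<in> carrier G \<Longrightarrow> comm x y \<in> carrier G"
  by (simp add: comm_def)

lemma comm_set_closed:
  assumes "A \<subseteq> carrier G" "B \<subseteq> carrier G"
  shows "{comm a b | a b. a \<in> A \<and> b \<in> B} \<subseteq> carrier G"
proof
  fix x assume "x \<in> {comm a b | a b. a \<in> A \<and> b \<in> B}"
  then obtain a b where "x = comm a b" "a \<in> A" "b \<in> B" by auto
  moreover from this have "a \<in> carrier G" "b \<in> carrier G" using assms by auto
  ultimately show "x \<in> carrier G" by simp
qed

lemma inv_comm: "x \<in> carrier G \<Longrightarrow> y \<in> carrier G \<Longrightarrow> inv (comm x y) = comm y x"
  by (simp add: comm_def inv_mult_group m_assoc inv_closed m_closed del: comm_closed)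

lemma commutator_eq: "commutator G A B = generate G {comm a b | a b. a \<in> A \<and> b \<in> B}"
  by (simp add: commutator_def comm_def)

lemma normal_conj: "N \<lhd> G \<Longrightarrow> x \<in> carrier G \<Longrightarrow> h \<in> N \<Longrightarrow> x \<otimes> h \<otimes> inv x \<in> N"
  using normal_inv_iff by blast

lemma normal_conj': "N \<lhd> G \<Longrightarrow> x \<in> carrier G \<Longrightarrow> h \<in> N \<Longrightarrow> inv x \<otimes> h \<otimes> x \<in> N"
  using normal_conj[of N "inv x" h] by simp

lemma normal_subset: "N \<lhd> G \<Longrightarrow> N \<subseteq> carrier G"
  by (meson normal_imp_subgroup subgroup.subset)

text \<open>
  By \<open>[x y, b] = y\<inverse> [x, b] y [y, b]\<close>.
\<close>

lemma subgroup_commuting_mod: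
  assumes N: "N \<lhd> G" and B: "B \<subseteq> carrier G"
  shows "subgroup {x \<in> carrier G. \<forall>b\<in>B. comm x b \<in> N} G"
proof
  interpret N: subgroup N G using N by (rule normal_imp_subgroup)
  show "{x \<in> carrier G. \<forall>b\<in>B. comm x b \<in> N} \<subseteq> carrier G" by auto
  show "\<one> \<in> {x \<in> carrier G. \<forall>b\<in>B. comm x b \<in> N}" using B by (auto simp: comm_def)
  fix x assume x: "x \<in> {x \<in> carrier G. \<forall>b\<in>B. comm x b \<in> N}"
  show "inv x \<in> {x \<in> carrier G. \<forall>b\<in>B. comm x b \<in> N}"
  proof (intro CollectI conjI ballI)
    fix b assume b: "b \<in> B"
    have "x \<otimes> inv (comm x b) \<otimes> inv x \<in> N" using x b by (intro normal_conj N) auto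
    also have "x \<otimes> inv (comm x b) \<otimes> inv x = comm (inv x) b"
      using x b B by (auto simp: comm_def inv_mult_group m_assoc)
    finally show "comm (inv x) b \<in> N" .
  qed (use x in auto)
  fix y assume y: "y \<in> {x \<in> carrier G. \<forall>b\<in>B. comm x b \<in> N}"
  show "x \<otimes> y \<in> {x \<in> carrier G. \<forall>b\<in>B. comm x b \<in> N}"
  proof (intro CollectI conjI ballI)
    fix b assume b: "b \<in> B"
    have c: "x \<in> carrier G" "y \<in> carrier G" "b \<in> carrier G" using x y b B by auto
    have "(inv y \<otimes> comm x b \<otimes> y) \<otimes> comm y b \<in> N" using x y b by (intro N.m_closed normal_conj' N) auto
    also have "(inv y \<otimes> comm x b \<otimes> y) \<otimes> comm y b = comm (x \<otimes> y) b"
      using c by (simp add: comm_def inv_mult_group m_assoc)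
    finally show "comm (x \<otimes> y) b \<in> N" .
  qed (use x y in auto)
qed

text \<open>
  Commutators of subgroups may be tested on generators modulo a normal subgroup.
\<close>

lemma commutator_generate_subset:
  assumes N: "N \<lhd> G" and A: "A \<subseteq> carrier G" and B: "B \<subseteq> carrier G"
    and AB: "\<And>a b. a \<in> A \<Longrightarrow> b \<in> B \<Longrightarrow> comm a b \<in> N"
  shows "commutator G (generate G A) (generate G B) \<subseteq> N"
proof -
  interpret N: subgroup N G using N by (rule normal_imp_subgroup)
  have sub: "generate G C \<subseteq> {x \<in> carrier G. \<forall>b\<in>D. comm x b \<in> N}"
    if "C \<subseteq> carrier G" "D \<subseteq> carrier G" "\<And>a b. a \<in> C \<Longrightarrow> b \<in> D \<Longrightarrow> comm a b \<in> N" for C D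
    using that by (intro generate_subgroup_incl subgroup_commuting_mod N) auto
  have 1: "comm a b \<in> N" if "a \<in> generate G A" "b \<in> B" for a b
    using sub[OF A B AB] that by blast
  have gA: "generate G A \<subseteq> carrier G" using generate_incl[OF A] .
  have 2: "comm b a \<in> N" if "a \<in> generate G A" "b \<in> B" for a b
    using N.m_inv_closed[OF 1[OF that]] that gA B by (subst (asm) inv_comm) auto
  have 3: "comm a b \<in> N" if "a \<in> generate G A" "b \<in> generate G B" for a b
  proof -
    have "comm b a \<in> N" using sub[OF B gA 2] that by blast
    from N.m_inv_closed[OF this] show ?thesis
      using that gA generate_incl[OF B] by (subst (asm) inv_comm) auto
  qed
  show ?thesis unfolding commutator_eq
    by (rule generate_subgroup_incl[OF _ normal_imp_subgroup[OF N]]) (auto intro: 3)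
qed

lemma generate_normal:
  assumes "N \<lhd> G" shows "generate G N = N"
proof
  show "generate G N \<subseteq> N" using assms by (intro generate_subgroup_incl normal_imp_subgroup) auto
  show "N \<subseteq> generate G N" by (rule subsetI) (rule generate.incl)
qed

lemma commutator_subset:
  assumes "N \<lhd> G" "A \<lhd> G" "B \<lhd> G" "\<And>a b. a \<in> A \<Longrightarrow> b \<in> B \<Longrightarrow> comm a b \<in> N"
  shows "commutator G A B \<subseteq> N"
  using commutator_generate_subset[OF assms(1) normal_subset[OF assms(2)] normal_subset[OF assms(3)] assms(4)]
  unfolding generate_normal[OF assms(2)] generate_normal[OF assms(3)] .

lemma commutator_mono: "A \<subseteq> A' \<Longrightarrow> B \<subseteq> B' \<Longrightarrow> commutator G A B \<subseteq> commutator G A' B'"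
  unfolding commutator_eq by (rule mono_generate) auto

lemma comm_in_left:
  assumes "A \<lhd> G" "a \<in> A" "b \<in> carrier G" shows "comm a b \<in> A"
proof -
  interpret A: subgroup A G using assms(1) by (rule normal_imp_subgroup)
  have "inv a \<otimes> (inv b \<otimes> a \<otimes> b) \<in> A" using assms by (intro A.m_closed A.m_inv_closed normal_conj') auto
  then show ?thesis using assms A.subset by (auto simp: comm_def m_assoc subset_eq)
qed

lemma comm_in_right:
  assumes "B \<lhd> G" "b \<in> B" "a \<in> carrier G" shows "comm a b \<in> B"
proof -
  interpret B: subgroup B G using assms(1) by (rule normal_imp_subgroup)
  have "(inv a \<otimes> inv b \<otimes> a) \<otimes> b \<in> B" using assms by (intro B.m_closed B.m_inv_closed normal_conj') auto
  then show ?thesis by (simp add: comm_def)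
qed

lemma commutator_subset_left: "A \<lhd> G \<Longrightarrow> B \<lhd> G \<Longrightarrow> commutator G A B \<subseteq> A"
  using normal_subset by (intro commutator_subset comm_in_left) auto

lemma commutator_subset_right: "A \<lhd> G \<Longrightarrow> B \<lhd> G \<Longrightarrow> commutator G A B \<subseteq> B"
  using normal_subset by (intro commutator_subset comm_in_right) auto

lemma commutator_normal:
  assumes A: "A \<lhd> G" and B: "B \<lhd> G" shows "commutator G A B \<lhd> G"
  unfolding commutator_eq
proof (rule normal_generateI)
  show "{comm a b |a b. a \<in> A \<and> b \<in> B} \<subseteq> carrier G"
    by (rule comm_set_closed[OF normal_subset[OF A] normal_subset[OF B]])
  fix h g assume h: "h \<in> {comm a b |a b. a \<in> A \<and> b \<in> B}" and g: "g \<in> carrier G"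
  then obtain a b where ab: "h = comm a b" "a \<in> A" "b \<in> B" by auto
  have c: "a \<in> carrier G" "b \<in> carrier G" using ab normal_subset[OF A] normal_subset[OF B] by auto
  have "g \<otimes> h \<otimes> inv g = comm (g \<otimes> a \<otimes> inv g) (g \<otimes> b \<otimes> inv g)"
    using c g by (simp add: ab(1) comm_def inv_mult_group m_assoc)
  then show "g \<otimes> h \<otimes> inv g \<in> {comm a b |a b. a \<in> A \<and> b \<in> B}"
    using normal_conj[OF A g ab(2)] normal_conj[OF B g ab(3)] by blast
qed

lemma normal_closure_normal:
  assumes "S \<subseteq> carrier G" shows "normal_closure G S \<lhd> G"
proof -
  have ne: "carrier G \<in> {N. N \<lhd> G \<and> S \<subseteq> N}" using assms normal_self by auto
  have "subgroup (normal_closure G S) G"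
    unfolding normal_closure_def using ne by (intro subgroups_Inter) (auto dest: normal_imp_subgroup)
  moreover have "\<forall>x\<in>carrier G. \<forall>h\<in>normal_closure G S. x \<otimes> h \<otimes> inv x \<in> normal_closure G S"
    unfolding normal_closure_def by (auto intro: normal_conj)
  ultimately show ?thesis using normal_inv_iff by blast
qed

lemma normal_closure_incl: "S \<subseteq> normal_closure G S"
  unfolding normal_closure_def by auto

lemma normal_closure_least: "N \<lhd> G \<Longrightarrow> S \<subseteq> N \<Longrightarrow> normal_closure G S \<subseteq> N"
  unfolding normal_closure_def by auto

text \<open>
  This is how a commutator subgroup is computed from generators and a normal closure.
\<close>

lemma commutator_generate_eq:
  assumes A: "A \<subseteq> carrier G" "generate G A \<lhd> G" and B: "B \<subseteq> carrier G" "generate G B \<lhd> G"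
  shows "commutator G (generate G A) (generate G B) = normal_closure G {comm a b | a b. a \<in> A \<and> b \<in> B}"
proof
  have sub: "{comm a b | a b. a \<in> A \<and> b \<in> B} \<subseteq> carrier G" by (rule comm_set_closed[OF A(1) B(1)])
  show "commutator G (generate G A) (generate G B) \<subseteq> normal_closure G {comm a b | a b. a \<in> A \<and> b \<in> B}"
  proof (rule commutator_generate_subset[OF normal_closure_normal[OF sub] A(1) B(1)])
    fix a b assume "a \<in> A" "b \<in> B"
    then have "comm a b \<in> {comm a b | a b. a \<in> A \<and> b \<in> B}" by blast
    then show "comm a b \<in> normal_closure G {comm a b | a b. a \<in> A \<and> b \<in> B}"
      by (rule subsetD[OF normal_closure_incl])
  qed
  show "normal_closure G {comm a b | a b. a \<in> A \<and> b \<in> B} \<subseteq> commutator G (generate G A) (generate G B)"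
  proof (rule normal_closure_least[OF commutator_normal[OF A(2) B(2)]], rule subsetI)
    fix x assume "x \<in> {comm a b | a b. a \<in> A \<and> b \<in> B}"
    then obtain a b where ab: "x = comm a b" "a \<in> A" "b \<in> B" by auto
    have "a \<in> generate G A" "b \<in> generate G B" using ab(2,3) by (simp_all add: generate.incl)
    then show "x \<in> commutator G (generate G A) (generate G B)"
      unfolding commutator_eq ab(1) by (intro generate.incl) blast
  qed
qed

lemma iter_commutator_snoc:
  "As \<noteq> [] \<Longrightarrow> iter_commutator G (As @ [A]) = commutator G (iter_commutator G As) A"
  by (cases As) (auto simp: iter_commutator_def)

lemma iter_commutator_normal:
  "As \<noteq> [] \<Longrightarrow> \<forall>A\<in>set As. A \<lhd> G \<Longrightarrow> iter_commutator G As \<lhd> G"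
proof (induction As rule: rev_induct)
  case (snoc A As)
  then show ?case
    by (cases "As = []") (simp_all add: iter_commutator_snoc iter_commutator_def[of _ "[A]"] commutator_normal)
qed simp

lemma iter_commutator_mono:
  assumes "list_all2 (\<subseteq>) As Bs" shows "iter_commutator G As \<subseteq> iter_commutator G Bs"
proof -
  have "foldl (commutator G) C As \<subseteq> foldl (commutator G) D Bs"
    if "list_all2 (\<subseteq>) As Bs" "C \<subseteq> D" for C D As Bs
    using that
  proof (induction As Bs arbitrary: C D rule: list_all2_induct)
    case (Cons A As B Bs)
    then show ?case using Cons.IH[OF commutator_mono[OF Cons.prems Cons.hyps(1)]] by simp
  qed simp
  with assms show ?thesis by (cases As; cases Bs) (auto simp: iter_commutator_def)
qed

lemma iter_commutator_subset_elem:
  "\<forall>A\<in>set As. A \<lhd> G \<Longrightarrow> A \<in> set As \<Longrightarrow> iter_commutator G As \<subseteq> A"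
proof (induction As rule: rev_induct)
  case (snoc B As)
  show ?case
  proof (cases "As = []")
    case True
    then show ?thesis using snoc.prems by (simp add: iter_commutator_def)
  next
    case False
    have n: "iter_commutator G As \<lhd> G" using snoc.prems False by (intro iter_commutator_normal) auto
    have "commutator G (iter_commutator G As) B \<subseteq> A"
    proof (cases "A = B")
      case True
      then show ?thesis using commutator_subset_right[OF n] snoc.prems by auto
    next
      case False
      then have "iter_commutator G As \<subseteq> A" using snoc by auto
      then show ?thesis using commutator_subset_left[OF n] snoc.prems by (meson dual_order.trans in_set_conv_decomp)
    qed
    then show ?thesis using False by (simp add: iter_commutator_snoc)
  qed
qed simp

lemma trivial_normal: "{\<one>} \<lhd> G"
  by (rule one_is_normal)

lemma commutator_trivial: "B \<lhd> G \<Longrightarrow> commutator G {\<one>} B = {\<one>}"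
  using commutator_subset_left[OF trivial_normal] subgroup.one_closed[OF normal_imp_subgroup[OF commutator_normal[OF trivial_normal]]]
  by blast

end

section \<open>The closure of a prefilter\<close>

locale finite_prefilter = group G for G :: "('g, 'b) monoid_scheme" (structure) +
  fixes d :: nat and \<pi> :: "nat list \<Rightarrow> 'g set"
  assumes fin: "finite (carrier G)" and pre: "prefilter G d \<pi>"
begin

abbreviation clo :: "nat list \<Rightarrow> 'g set" where "clo \<equiv> filter_closure G d \<pi>"

lemma pi_normal: "s \<in> vecs d \<Longrightarrow> \<pi> s \<lhd> G"
  using pre by (simp add: prefilter_def)

lemma pi_antimono: "s \<in> vecs d \<Longrightarrow> t \<in> vecs d \<Longrightarrow> s \<le> t \<Longrightarrow> \<pi> t \<subseteq> \<pi> s"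
  using pre by (simp add: prefilter_def)

lemma partition_normal:
  assumes "P \<in> partitions d s" shows "iter_commutator G (map \<pi> P) \<lhd> G"
  using assms pi_normal by (intro iter_commutator_normal) (auto simp: partitions_def)

lemma clo_normal: "clo s \<lhd> G"
  unfolding filter_closure_def
proof (rule normal_generateI)
  show "(\<Union>P\<in>partitions d s. iter_commutator G (map \<pi> P)) \<subseteq> carrier G"
    using partition_normal normal_subset by blast
  show "g \<otimes> h \<otimes> inv g \<in> (\<Union>P\<in>partitions d s. iter_commutator G (map \<pi> P))"
    if "h \<in> (\<Union>P\<in>partitions d s. iter_commutator G (map \<pi> P))" "g \<in> carrier G" for h g
    using that partition_normal normal_conj by blast
qed

lemma partition_subset_clo: "P \<in> partitions d s \<Longrightarrow> iter_commutator G (map \<pi> P) \<subseteq> clo s"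
  unfolding filter_closure_def by (auto intro: generate.incl)

lemma clo_least:
  assumes "N \<lhd> G" "\<And>P. P \<in> partitions d s \<Longrightarrow> iter_commutator G (map \<pi> P) \<subseteq> N"
  shows "clo s \<subseteq> N"
  unfolding filter_closure_def using assms by (intro generate_subgroup_incl normal_imp_subgroup) auto

text \<open>
  Every partition of \<open>t\<close> is lowered to a partition of \<open>s\<close>.
\<close>

lemma clo_antimono:
  assumes "s \<in> vecs d" "s \<le> t" shows "clo t \<subseteq> clo s"
proof (rule clo_least[OF clo_normal])
  fix P assume P: "P \<in> partitions d t"
  then obtain P' where P': "P' \<in> partitions d s" "list_all2 (\<le>) P' P" using lower_partition assms by blast
  have "list_all2 (\<subseteq>) (map \<pi> P) (map \<pi> P')"
    unfolding list_all2_conv_all_nth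
  proof (intro conjI allI impI)
    show "length (map \<pi> P) = length (map \<pi> P')" using P'(2) by (simp add: list_all2_lengthD)
    fix i assume i: "i < length (map \<pi> P)"
    then have "i < length P'" "P' ! i \<le> P ! i" using P'(2) by (auto simp: list_all2_conv_all_nth)
    moreover have "P' ! i \<in> vecs d" "P ! i \<in> vecs d"
      using nth_mem[OF \<open>i < length P'\<close>] nth_mem[of i P] i P P'(1) by (auto simp: partitions_def)
    ultimately show "map \<pi> P ! i \<subseteq> map \<pi> P' ! i" using i pi_antimono by simp
  qed
  from iter_commutator_mono[OF this] partition_subset_clo[OF P'(1)]
  show "iter_commutator G (map \<pi> P) \<subseteq> clo s" by blast
qed

lemma pi_subset_clo: "s \<in> vecs d \<Longrightarrow> \<pi> s \<subseteq> clo s"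
  using partition_subset_clo[of "[s]" s] by (simp add: partitions_def vec_sum_def vecs_def iter_commutator_def)

text \<open>
  It suffices to append the part \<open>u\<close> to each partition of \<open>t\<close>, since the subgroups attached to the
  partitions generate the closure.
\<close>

lemma clo_commutator:
  assumes "t \<in> vecs d" "u \<in> vecs d"
  shows "commutator G (clo t) (\<pi> u) \<subseteq> clo (t +\<^sub>v u)"
proof -
  have "commutator G (generate G (\<Union>P\<in>partitions d t. iter_commutator G (map \<pi> P))) (generate G (\<pi> u)) \<subseteq> clo (t +\<^sub>v u)"
  proof (rule commutator_generate_subset[OF clo_normal])
    show "(\<Union>P\<in>partitions d t. iter_commutator G (map \<pi> P)) \<subseteq> carrier G"
      using partition_normal normal_subset by blast
    show "\<pi> u \<subseteq> carrier G" using pi_normal normal_subset assms by blast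
    fix a b assume a: "a \<in> (\<Union>P\<in>partitions d t. iter_commutator G (map \<pi> P))" and b: "b \<in> \<pi> u"
    then obtain P where P: "P \<in> partitions d t" "a \<in> iter_commutator G (map \<pi> P)" by blast
    have "P @ [u] \<in> partitions d (t +\<^sub>v u)"
      using P assms by (auto simp: partitions_def vec_sum_snoc)
    from partition_subset_clo[OF this]
    have "commutator G (iter_commutator G (map \<pi> P)) (\<pi> u) \<subseteq> clo (t +\<^sub>v u)"
      using P(1) by (simp add: iter_commutator_snoc partitions_def)
    moreover have "comm a b \<in> commutator G (iter_commutator G (map \<pi> P)) (\<pi> u)"
      unfolding commutator_eq using P b by (auto intro: generate.incl)
    ultimately show "comm a b \<in> clo (t +\<^sub>v u)" by blast
  qed
  then show ?thesis using generate_normal[OF pi_normal[OF assms(2)]] by (simp add: filter_closure_def)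
qed

end

section \<open>The algorithm\<close>

abbreviation gen_order :: "'g group_model \<Rightarrow> 'g list \<Rightarrow> nat" where
  "gen_order M xs \<equiv> card (generate (grp M) (set xs))"

lemma efficient_group: "efficient_model q M \<Longrightarrow> group (grp M)"
  by (simp add: efficient_model_def)

definition log_order :: "'g group_model \<Rightarrow> 'g list \<Rightarrow> nat" where
  "log_order M xs = (LEAST l. card (generate (grp M) (set xs)) \<le> 2 ^ l)"

lemma card_le_log_order: "card (generate (grp M) (set xs)) \<le> 2 ^ log_order M xs"
  unfolding log_order_def by (rule LeastI_ex) (metis less_exp less_imp_le_nat)

lemma card_generate_le:
  assumes "efficient_model q M" "set xs \<subseteq> carrier (grp M)"
  shows "card (generate (grp M) (set xs)) \<le> 2 ^ elem_len M"
proof -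
  have "generate (grp M) (set xs) \<subseteq> carrier (grp M)"
    using group.generate_incl[OF efficient_group[OF assms(1)] assms(2)] .
  then show ?thesis using assms(1) unfolding efficient_model_def by (meson card_mono order_trans)
qed

lemma log_order_le:
  assumes "efficient_model q M" "set xs \<subseteq> carrier (grp M)"
  shows "log_order M xs \<le> elem_len M"
  unfolding log_order_def by (rule Least_le) (rule card_generate_le[OF assms])

text \<open>
  A generator is kept if it enlarges the subgroup generated so far. The order then at least doubles,
  so that logarithmically many generators remain.
\<close>

definition trim :: "'g group_model \<Rightarrow> 'g list \<Rightarrow> 'g list" where
  "trim M xs = foldr (\<lambda>x ys. if gen_order M ys < gen_order M (x # ys) then x # ys else ys) xs []"

definition normal_closure_gens :: "'g group_model \<Rightarrow> 'g list \<Rightarrow> 'g list" where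
  "normal_closure_gens M xs = trim M (closure_gens M xs)"

definition commutator_gens :: "'g group_model \<Rightarrow> 'g list \<Rightarrow> 'g list \<Rightarrow> 'g list" where
  "commutator_gens M xs ys = normal_closure_gens M (concat (map (\<lambda>x. map (\<lambda>y.
     inv\<^bsub>grp M\<^esub> x \<otimes>\<^bsub>grp M\<^esub> inv\<^bsub>grp M\<^esub> y \<otimes>\<^bsub>grp M\<^esub> x \<otimes>\<^bsub>grp M\<^esub> y) ys) xs))"

text \<open>
  A pair \<open>(w, X)\<close> records that the subgroup generated by \<open>X\<close> is contained in the closure at all
  vectors below \<open>w\<close>.
\<close>

type_synonym 'g levels = "(nat list \<times> 'g list) list"

definition cumulate :: "'g group_model \<Rightarrow> 'g levels \<Rightarrow> 'g levels" where
  "cumulate M F = map (\<lambda>p. (fst p, normal_closure_gens M (concat (map snd (filter (\<lambda>p'. below (fst p) (fst p')) F))))) F"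

definition dominated :: "'g group_model \<Rightarrow> 'g levels \<Rightarrow> nat list \<times> 'g list \<Rightarrow> bool" where
  "dominated M T p \<longleftrightarrow> (\<exists>p'\<in>set T. \<not> below (fst p') (fst p) \<and> gen_order M (snd p') = gen_order M (snd p))"

text \<open>
  A pair is redundant if its subgroup is trivial or also occurs at a larger weight. The cumulated
  subgroups form a chain, hence equality of orders is equality of subgroups.
\<close>

definition canonical :: "'g group_model \<Rightarrow> 'g levels \<Rightarrow> 'g levels" where
  "canonical M F = foldr (\<lambda>p r. if (1 < gen_order M (snd p) \<and> \<not> dominated M (cumulate M F) p) \<and>
       \<not> (\<exists>p'\<in>set r. gen_order M (snd p') = gen_order M (snd p)) then p # r else r) (cumulate M F) []"

definition iter_commutator_gens :: "'g group_model \<Rightarrow> unit list \<Rightarrow> 'g list \<Rightarrow> 'g list \<Rightarrow> 'g list" where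
  "iter_commutator_gens M us xs ys = foldr (\<lambda>_ zs. commutator_gens M zs ys) us xs"

text \<open>
  Each subgroup found so far is combined with each \<open>H\<^sub>j\<close>, once, and infinitely often. In the second
  case the length of \<open>us\<close> is the number of commutators that are needed to reach a stationary group.
\<close>

definition expand :: "'g group_model \<Rightarrow> unit list \<Rightarrow> 'g levels \<Rightarrow> 'g levels \<Rightarrow> 'g levels" where
  "expand M us D F = F @ concat (map (\<lambda>p. concat (map (\<lambda>p'.
     [(fst p +\<^sub>v fst p', commutator_gens M (snd p) (snd p')),
      (trunc (fst p') (fst p), iter_commutator_gens M us (snd p) (snd p'))]) D)) F)"

text \<open>
  The logarithm in unary, as a list that controls the iterations.
\<close>

definition fuel :: "'g group_model \<Rightarrow> 'g levels \<Rightarrow> unit list" where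
  "fuel M D = replicate (log_order M (concat (map snd D))) ()"

definition rounds :: "'g group_model \<Rightarrow> unit list \<Rightarrow> 'g levels \<Rightarrow> unit list \<Rightarrow> 'g levels" where
  "rounds M us D vs = foldr (\<lambda>_ F. canonical M (expand M us D F)) vs D"

text \<open>
  Each strict step of the commutators of a sequence costs one round, each plateau between two of
  them at most one further round.
\<close>

definition closure_levels :: "'g group_model \<Rightarrow> 'g levels \<Rightarrow> 'g levels" where
  "closure_levels M D = rounds M (fuel M D) D (() # fuel M D @ fuel M D)"

text \<open>
  The dimension is known to the program only through the stored vectors.
\<close>

definition zero_vec :: "'g levels \<Rightarrow> nat list" where
  "zero_vec D = (case D of [] \<Rightarrow> [] | p # ps \<Rightarrow> map (\<lambda>_. 0) (fst p))"

text \<open>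
  The least vector that is not below \<open>w\<close>, where \<open>z\<close> is the zero vector: \<open>1\<close> is added to the last
  finite coordinate of \<open>w\<close>, and zeros follow.
\<close>

definition succ_vec :: "nat list \<Rightarrow> nat list \<Rightarrow> nat list" where
  "succ_vec z w = foldr (\<lambda>x r. if r = [] then [x + 1] else x # r) w [] @ foldr (\<lambda>_ r. tl r) w z"

text \<open>
  The largest successor of a weight strictly below \<open>w\<close>, or the zero vector if there is none.
\<close>

definition level_min :: "nat list \<Rightarrow> 'g levels \<Rightarrow> nat list \<Rightarrow> nat list" where
  "level_min z F w = foldr (\<lambda>p r. if below w (fst p) \<or> below (succ_vec z (fst p)) r then r else succ_vec z (fst p)) F z"

definition stored_levels :: "'g group_model \<Rightarrow> 'g levels \<Rightarrow> 'g levels \<Rightarrow> int \<times> 'g levels" where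
  "stored_levels M D F = (if \<forall>p\<in>set F. length (fst p) = length (zero_vec D) then (1, F)
     else (-1, map (\<lambda>p. (level_min (zero_vec D) F (fst p), snd p)) F))"

lemma rounds_Nil: "rounds M us [] vs = []"
proof -
  have "canonical M (expand M us [] []) = []" by (simp add: canonical_def cumulate_def expand_def)
  then show ?thesis unfolding rounds_def by (induction vs) auto
qed

section \<open>Correctness of the subroutines\<close>

context group
begin

lemma card_subgroup_dvd:
  assumes "subgroup H G" "subgroup K G" "H \<subseteq> K" shows "card H dvd card K"
proof -
  have "subgroup H (G\<lparr>carrier := K\<rparr>)" using subgroup_incl assms by blast
  from group.lagrange[OF subgroup.subgroup_is_group[OF assms(2) group_axioms] this]
  have "card K = card (rcosets\<^bsub>G\<lparr>carrier := K\<rparr>\<^esub> H) * card H" by (simp add: Coset.order_def)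
  then show ?thesis by (rule dvdI[OF trans[OF _ mult.commute]])
qed

lemma card_proper_subgroup:
  assumes "subgroup H G" "subgroup K G" "H \<subset> K" "finite K" shows "2 * card H \<le> card K"
proof -
  obtain k where k: "card K = card H * k" using card_subgroup_dvd[of H K] assms by (auto elim: dvdE)
  have "card H < card K" using assms(3,4) by (rule psubset_card_mono[rotated])
  then have "2 \<le> k" using k by (cases "k = 0 \<or> k = 1") auto
  then show ?thesis using k by simp
qed

lemma generate_insert_cong:
  assumes "A \<subseteq> carrier G" "B \<subseteq> carrier G" "x \<in> carrier G" "generate G A = generate G B"
  shows "generate G (insert x A) = generate G (insert x B)"
proof -
  have *: "generate G (insert x A) \<subseteq> generate G (insert x B)"
    if "A \<subseteq> carrier G" "B \<subseteq> carrier G" "generate G A = generate G B" for A B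
  proof (rule generate_subgroup_incl)
    show "subgroup (generate G (insert x B)) G" using that assms(3) by (intro generate_is_subgroup) auto
    have "A \<subseteq> generate G A" by (rule subsetI) (rule generate.incl)
    also have "\<dots> \<subseteq> generate G (insert x B)" unfolding that(3) by (rule mono_generate) auto
    finally show "insert x A \<subseteq> generate G (insert x B)" by (simp add: generate.incl)
  qed
  show ?thesis using *[OF assms(1,2,4)] *[OF assms(2,1) assms(4)[symmetric]] by (rule equalityI)
qed

end

locale model =
  fixes M :: "'g group_model" and q :: "nat poly"
  assumes eff: "efficient_model q M"

sublocale model \<subseteq> group "grp M"
  using eff by (rule efficient_group)

context model
begin

abbreviation "G \<equiv> grp M"
abbreviation gen :: "'g list \<Rightarrow> 'g set" where "gen xs \<equiv> generate (grp M) (set xs)"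
abbreviation ok :: "'g list \<Rightarrow> bool" where "ok xs \<equiv> set xs \<subseteq> carrier (grp M)"

lemma finite_carrier: "finite (carrier G)"
  using eff by (simp add: efficient_model_def)

lemma finite_gen: "ok xs \<Longrightarrow> finite (gen xs)"
  using finite_subset[OF generate_incl finite_carrier] .

lemma gen_subgroup: "ok xs \<Longrightarrow> subgroup (gen xs) G"
  by (rule generate_is_subgroup)

lemma card_gen_pos: "ok xs \<Longrightarrow> 0 < gen_order M xs"
  using finite_gen[of xs] generate.one[of G "set xs"] by (auto simp: card_gt_0_iff)

lemma gen_trivial_iff: "ok xs \<Longrightarrow> gen_order M xs \<le> 1 \<longleftrightarrow> gen xs \<subseteq> {\<one>\<^bsub>G\<^esub>}"
proof
  assume xs: "ok xs" and "gen_order M xs \<le> 1"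
  then have "card (gen xs) = 1" using card_gen_pos[OF xs] by linarith
  then obtain a where "gen xs = {a}" by (rule card_1_singletonE)
  then show "gen xs \<subseteq> {\<one>\<^bsub>G\<^esub>}" using generate.one[of G "set xs"] by simp
next
  assume "gen xs \<subseteq> {\<one>\<^bsub>G\<^esub>}"
  then show "gen_order M xs \<le> 1" using card_mono[of "{\<one>\<^bsub>G\<^esub>}" "gen xs"] by simp
qed

text \<open>
  A discarded generator leaves the subgroup unchanged; a kept one enlarges it, hence at least
  doubles its order.
\<close>

lemma trim:
  assumes "ok xs"
  shows "set (trim M xs) \<subseteq> set xs \<and> gen (trim M xs) = gen xs \<and> 2 ^ length (trim M xs) \<le> gen_order M (trim M xs)"
  using assms
proof (induction xs)
  case Nil
  then show ?case using card_gen_pos[of "[]"] by (simp add: trim_def)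
next
  case (Cons x xs)
  let ?ys = "trim M xs"
  have IH: "set ?ys \<subseteq> set xs" "gen ?ys = gen xs" "2 ^ length ?ys \<le> gen_order M ?ys" using Cons by auto
  have ok: "ok xs" "ok ?ys" "ok (x # ?ys)" using Cons.prems IH(1) by auto
  have e: "gen (x # ?ys) = gen (x # xs)"
    using generate_insert_cong[of "set ?ys" "set xs" x] ok IH(2) Cons.prems by simp
  have sub: "gen ?ys \<subseteq> gen (x # ?ys)" by (rule mono_generate) auto
  have t: "trim M (x # xs) = (if gen_order M ?ys < gen_order M (x # ?ys) then x # ?ys else ?ys)"
    by (simp add: trim_def)
  show ?case
  proof (cases "gen_order M ?ys < gen_order M (x # ?ys)")
    case True
    then have "gen ?ys \<subset> gen (x # ?ys)" using sub by auto
    from card_proper_subgroup[OF gen_subgroup[OF ok(2)] gen_subgroup[OF ok(3)] this finite_gen[OF ok(3)]]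
    have "2 ^ length (x # ?ys) \<le> gen_order M (x # ?ys)" using IH(3) by simp
    then show ?thesis using True t e IH(1) by auto
  next
    case False
    then have "gen_order M ?ys = gen_order M (x # ?ys)" using card_mono[OF finite_gen[OF ok(3)] sub] by simp
    then have "gen ?ys = gen (x # ?ys)"
      using card_subset_eq[OF finite_gen[OF ok(3)] sub] by simp
    then show ?thesis using False t e IH by auto
  qed
qed

lemma length_trim: "ok xs \<Longrightarrow> length (trim M xs) \<le> elem_len M"
proof -
  assume xs: "ok xs"
  then have "ok (trim M xs)" using trim by blast
  then have "2 ^ length (trim M xs) \<le> (2::nat) ^ elem_len M"
    using trim[OF xs] card_generate_le[OF eff] order_trans by blast
  then show ?thesis by simp
qed

lemma normal_closure_gens:
  assumes "ok xs"
  shows "ok (normal_closure_gens M xs)" "gen (normal_closure_gens M xs) = normal_closure G (set xs)" "length (normal_closure_gens M xs) \<le> elem_len M"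
proof -
  have c: "ok (closure_gens M xs)" "gen (closure_gens M xs) = normal_closure G (set xs)"
    using eff assms by (auto simp: efficient_model_def)
  show "ok (normal_closure_gens M xs)" "gen (normal_closure_gens M xs) = normal_closure G (set xs)" "length (normal_closure_gens M xs) \<le> elem_len M"
    unfolding normal_closure_gens_def using c trim[OF c(1)] length_trim[OF c(1)] by auto
qed

lemma normal_closure_gens_normal: "ok xs \<Longrightarrow> gen (normal_closure_gens M xs) \<lhd> G"
  using normal_closure_normal by (simp add: normal_closure_gens)

lemma commutator_gens_set:
  "set (concat (map (\<lambda>x. map (\<lambda>y. inv\<^bsub>G\<^esub> x \<otimes>\<^bsub>G\<^esub> inv\<^bsub>G\<^esub> y \<otimes>\<^bsub>G\<^esub> x \<otimes>\<^bsub>G\<^esub> y) ys) xs)) =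
    {comm a b | a b. a \<in> set xs \<and> b \<in> set ys}"
  unfolding comm_def by auto

lemma commutator_gens:
  assumes "ok xs" "ok ys"
  shows "ok (commutator_gens M xs ys)" "length (commutator_gens M xs ys) \<le> elem_len M"
    "gen xs \<lhd> G \<Longrightarrow> gen ys \<lhd> G \<Longrightarrow> gen (commutator_gens M xs ys) = commutator G (gen xs) (gen ys)"
proof -
  have *: "ok (concat (map (\<lambda>x. map (\<lambda>y. inv\<^bsub>G\<^esub> x \<otimes>\<^bsub>G\<^esub> inv\<^bsub>G\<^esub> y \<otimes>\<^bsub>G\<^esub> x \<otimes>\<^bsub>G\<^esub> y) ys) xs))"
    unfolding commutator_gens_set by (rule comm_set_closed[OF assms])
  show "ok (commutator_gens M xs ys)" "length (commutator_gens M xs ys) \<le> elem_len M"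
    unfolding commutator_gens_def using normal_closure_gens[OF *] by auto
  show "gen (commutator_gens M xs ys) = commutator G (gen xs) (gen ys)" if "gen xs \<lhd> G" "gen ys \<lhd> G"
    unfolding commutator_gens_def normal_closure_gens(2)[OF *] commutator_gens_set
    using commutator_generate_eq[OF assms(1) that(1) assms(2) that(2)] by simp
qed

lemma iter_commutator_gens:
  assumes "ok xs" "ok ys"
  shows "ok (iter_commutator_gens M us xs ys)"
    "length (iter_commutator_gens M us xs ys) \<le> elem_len M + length xs"
    "gen xs \<lhd> G \<Longrightarrow> gen ys \<lhd> G \<Longrightarrow> gen (iter_commutator_gens M us xs ys) \<lhd> G \<and>
       gen (iter_commutator_gens M us xs ys) = ((\<lambda>K. commutator G K (gen ys)) ^^ length us) (gen xs)"
proof -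
  have "ok (iter_commutator_gens M us xs ys) \<and> length (iter_commutator_gens M us xs ys) \<le> elem_len M + length xs \<and>
    (gen xs \<lhd> G \<longrightarrow> gen ys \<lhd> G \<longrightarrow> gen (iter_commutator_gens M us xs ys) \<lhd> G \<and>
       gen (iter_commutator_gens M us xs ys) = ((\<lambda>K. commutator G K (gen ys)) ^^ length us) (gen xs))"
  proof (induction us)
    case Nil
    then show ?case using assms by (simp add: iter_commutator_gens_def)
  next
    case (Cons u us)
    then show ?case using commutator_gens[of "iter_commutator_gens M us xs ys" ys] assms commutator_normal
      by (auto simp: iter_commutator_gens_def)
  qed
  then show "ok (iter_commutator_gens M us xs ys)"
    "length (iter_commutator_gens M us xs ys) \<le> elem_len M + length xs"
    "gen xs \<lhd> G \<Longrightarrow> gen ys \<lhd> G \<Longrightarrow> gen (iter_commutator_gens M us xs ys) \<lhd> G \<and>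
       gen (iter_commutator_gens M us xs ys) = ((\<lambda>K. commutator G K (gen ys)) ^^ length us) (gen xs)"
    by auto
qed

abbreviation ok_levels :: "'g levels \<Rightarrow> bool" where
  "ok_levels F \<equiv> \<forall>p\<in>set F. ok (snd p)"

lemma cumulate_ok:
  assumes "ok_levels F" "p \<in> set (cumulate M F)"
  shows "ok (snd p)" "length (snd p) \<le> elem_len M" "gen (snd p) \<lhd> G"
    "gen (snd p) = normal_closure G (\<Union>p'\<in>{p'\<in>set F. below (fst p) (fst p')}. set (snd p'))"
    "\<exists>p'\<in>set F. fst p' = fst p"
proof -
  from assms(2) obtain p0 where p0: "p0 \<in> set F"
    "p = (fst p0, normal_closure_gens M (concat (map snd (filter (\<lambda>p'. below (fst p0) (fst p')) F))))"
    by (auto simp: cumulate_def)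
  have o: "ok (concat (map snd (filter (\<lambda>p'. below (fst p0) (fst p')) F)))" using assms(1) by auto
  show "ok (snd p)" "length (snd p) \<le> elem_len M" "gen (snd p) \<lhd> G"
    using normal_closure_gens[OF o] normal_closure_gens_normal[OF o] p0(2) by auto
  have "set (concat (map snd (filter (\<lambda>p'. below (fst p0) (fst p')) F))) =
      (\<Union>p'\<in>{p'\<in>set F. below (fst p0) (fst p')}. set (snd p'))" by auto
  then show "gen (snd p) = normal_closure G (\<Union>p'\<in>{p'\<in>set F. below (fst p) (fst p')}. set (snd p'))"
    using normal_closure_gens(2)[OF o] p0(2) by simp
  show "\<exists>p'\<in>set F. fst p' = fst p" using p0 by auto
qed

lemma normal_closure_mono: "A \<subseteq> B \<Longrightarrow> normal_closure G A \<subseteq> normal_closure G B"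
  unfolding normal_closure_def by blast

lemma cumulate_antimono:
  assumes "ok_levels F" "p \<in> set (cumulate M F)" "p' \<in> set (cumulate M F)" "below (fst p) (fst p')"
  shows "gen (snd p') \<subseteq> gen (snd p)"
  unfolding cumulate_ok(4)[OF assms(1,2)] cumulate_ok(4)[OF assms(1,3)]
  using below_trans[OF assms(4)] by (intro normal_closure_mono) auto

text \<open>
  The recursion of \<open>canonical\<close> in general: among the elements with property \<open>Q\<close>, each key is kept
  exactly once.
\<close>

lemma select_by_key:
  fixes Q :: "'a \<Rightarrow> bool" and key :: "'a \<Rightarrow> nat" and T :: "'a list"
  defines "r \<equiv> foldr (\<lambda>p r. if Q p \<and> \<not> (\<exists>p'\<in>set r. key p' = key p) then p # r else r) T []"
  shows "set r \<subseteq> {p \<in> set T. Q p}" "\<forall>p\<in>set T. Q p \<longrightarrow> (\<exists>p'\<in>set r. key p' = key p)" "distinct (map key r)"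
  unfolding r_def by (induction T) auto

lemma canonical:
  assumes "ok_levels F"
  shows "set (canonical M F) \<subseteq> {p \<in> set (cumulate M F). 1 < gen_order M (snd p) \<and> \<not> dominated M (cumulate M F) p}"
    "\<And>p. p \<in> set (cumulate M F) \<Longrightarrow> 1 < gen_order M (snd p) \<Longrightarrow> \<not> dominated M (cumulate M F) p \<Longrightarrow>
       \<exists>p'\<in>set (canonical M F). gen_order M (snd p') = gen_order M (snd p)"
    "distinct (map (\<lambda>p. gen_order M (snd p)) (canonical M F))"
  unfolding canonical_def
  using select_by_key[where T = "cumulate M F" and Q = "\<lambda>p. 1 < gen_order M (snd p) \<and> \<not> dominated M (cumulate M F) p"
      and key = "\<lambda>p. gen_order M (snd p)"]
  by blast+

lemma canonical_proper:
  assumes F: "ok_levels F" and p: "p \<in> set (canonical M F)" and p': "p' \<in> set (canonical M F)"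
    and le: "below (fst p) (fst p')"
  shows "p = p' \<or> gen (snd p') \<subset> gen (snd p)"
proof -
  have T: "p \<in> set (cumulate M F)" "p' \<in> set (cumulate M F)" using canonical(1)[OF F] p p' by auto
  have "gen (snd p') \<subseteq> gen (snd p)" by (rule cumulate_antimono[OF F T le])
  moreover have "p = p'" if "gen (snd p') = gen (snd p)"
    using canonical(3)[OF F] p p' that by (auto simp: distinct_map inj_on_def)
  ultimately show ?thesis by blast
qed

text \<open>
  The subgroups form a strictly decreasing chain, so the bit lengths of their orders are distinct.
\<close>

lemma length_canonical:
  assumes F: "ok_levels F" shows "length (canonical M F) \<le> elem_len M + 2"
proof -
  let ?k = "\<lambda>p. gen_order M (snd p)"
  have ok: "ok (snd p)" if "p \<in> set (canonical M F)" for p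
    using that canonical(1)[OF F] cumulate_ok(1)[OF F] by blast
  have inj: "inj_on (\<lambda>p. floorlog 2 (?k p)) (set (canonical M F))"
  proof (rule inj_onI)
    fix p p' assume p: "p \<in> set (canonical M F)" "p' \<in> set (canonical M F)" and e: "floorlog 2 (?k p) = floorlog 2 (?k p')"
    have "\<not> gen (snd p) \<subset> gen (snd p')" if "p \<in> set (canonical M F)" "p' \<in> set (canonical M F)"
      "floorlog 2 (?k p) = floorlog 2 (?k p')" for p p'
    proof
      assume "gen (snd p) \<subset> gen (snd p')"
      from card_proper_subgroup[OF gen_subgroup[OF ok[OF that(1)]] gen_subgroup[OF ok[OF that(2)]] this finite_gen[OF ok[OF that(2)]]]
      have d: "2 * ?k p \<le> ?k p'" .
      have pos: "0 < ?k p" "0 < ?k p'" using card_gen_pos ok that by auto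
      have "2 ^ (floorlog 2 (?k p) - 1) \<le> ?k p" "?k p' < 2 ^ floorlog 2 (?k p')"
        using floorlog_bounds[of "?k p" 2] floorlog_bounds[of "?k p'" 2] pos by auto
      moreover have "0 < floorlog 2 (?k p)" using pos by (simp add: floorlog_def)
      then have "(2::nat) ^ floorlog 2 (?k p) = 2 * 2 ^ (floorlog 2 (?k p) - 1)"
        by (cases "floorlog 2 (?k p)") auto
      moreover have "(2::nat) ^ floorlog 2 (?k p') = 2 ^ floorlog 2 (?k p)" using that(3) by simp
      ultimately show False using d by linarith
    qed
    then show "p = p'" using canonical_proper[OF F] p e below_total[of "fst p" "fst p'"] by metis
  qed
  have "floorlog 2 (?k p) \<le> elem_len M + 1" if "p \<in> set (canonical M F)" for p
  proof -
    have pos: "0 < ?k p" using card_gen_pos ok that by auto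
    have "2 ^ (floorlog 2 (?k p) - 1) \<le> ?k p" using floorlog_bounds[of "?k p" 2] pos by auto
    also have "\<dots> \<le> 2 ^ elem_len M" using card_generate_le[OF eff ok[OF that]] .
    finally show ?thesis by simp
  qed
  then have "(\<lambda>p. floorlog 2 (?k p)) ` set (canonical M F) \<subseteq> {..elem_len M + 1}" by auto
  from card_mono[OF _ this] have "card (set (canonical M F)) \<le> elem_len M + 2"
    using card_image[OF inj] by simp
  moreover have "distinct (canonical M F)" using canonical(3)[OF F] by (simp add: distinct_map)
  ultimately show ?thesis using distinct_card by fastforce
qed

text \<open>
  Trivial subgroups are not stored, whence the first alternative.
\<close>

definition covers :: "'g levels \<Rightarrow> nat list \<Rightarrow> 'g set \<Rightarrow> bool" where
  "covers F v A \<longleftrightarrow> A \<subseteq> {\<one>\<^bsub>G\<^esub>} \<or> (\<exists>p\<in>set F. below v (fst p) \<and> A \<subseteq> gen (snd p))"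

lemma covers_below: "covers F v A \<Longrightarrow> below u v \<Longrightarrow> covers F u A"
  unfolding covers_def using below_trans by blast

lemma exists_extremal:
  assumes "finite A" "A \<noteq> {}" and R: "\<And>a b. R a b \<or> R b a" "\<And>a b c. R a b \<Longrightarrow> R b c \<Longrightarrow> R a c"
  shows "\<exists>m\<in>A. \<forall>a\<in>A. R a m"
  using assms(1,2)
proof (induction rule: finite_ne_induct)
  case (singleton x)
  then show ?case using R(1) by auto
next
  case (insert x A)
  then obtain m where m: "m \<in> A" "\<forall>a\<in>A. R a m" by blast
  show ?case
  proof (cases "R x m")
    case True
    then show ?thesis using m by auto
  next
    case False
    then show ?thesis using m R(1)[of x m] R(1)[of x x] by (intro bexI[of _ x]) (auto intro: R(2))
  qed
qed

lemma exists_below_max: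
  assumes "finite A" "A \<noteq> {}" shows "\<exists>m\<in>A. \<forall>a\<in>A. below (f a) (f m)"
  by (rule exists_extremal[OF assms]) (use below_total below_trans in blast)+

lemma exists_below_min:
  assumes "finite A" "A \<noteq> {}" shows "\<exists>m\<in>A. \<forall>a\<in>A. below (f m) (f a)"
  by (rule exists_extremal[OF assms]) (use below_total below_trans in blast)+

text \<open>
  Among the cumulated pairs with the same subgroup the one of largest weight is not dominated, and
  a pair with this subgroup and at least this weight is kept.
\<close>

lemma canonical_covers_pair:
  assumes F: "ok_levels F" and p: "p \<in> set F"
  shows "covers (canonical M F) (fst p) (gen (snd p))"
proof -
  let ?T = "cumulate M F"
  obtain t where t: "t \<in> set ?T" "fst t = fst p" using p by (force simp: cumulate_def)
  have ok: "ok (snd s)" if "s \<in> set ?T" for s using cumulate_ok(1)[OF F that] .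
  have "set (snd p) \<subseteq> (\<Union>p'\<in>{p'\<in>set F. below (fst t) (fst p')}. set (snd p'))" using p t(2) by auto
  also have "\<dots> \<subseteq> gen (snd t)" unfolding cumulate_ok(4)[OF F t(1)] by (rule normal_closure_incl)
  finally have pt: "gen (snd p) \<subseteq> gen (snd t)" by (rule generate_subgroup_incl[OF _ gen_subgroup[OF ok[OF t(1)]]])
  show ?thesis
  proof (cases "gen_order M (snd t) \<le> 1")
    case True
    then show ?thesis using pt gen_trivial_iff[OF ok[OF t(1)]] by (auto simp: covers_def)
  next
    case False
    let ?A = "{s \<in> set ?T. gen_order M (snd s) = gen_order M (snd t)}"
    obtain m where m: "m \<in> ?A" "\<forall>a\<in>?A. below (fst a) (fst m)"
    proof -
      have "t \<in> ?A" using t(1) by simp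
      then have "finite ?A" "?A \<noteq> {}" by (simp, blast)
      from exists_below_max[OF this, of fst] that show ?thesis by blast
    qed
    have "\<not> dominated M ?T m"
    proof
      assume "dominated M ?T m"
      then obtain p' where p': "p' \<in> set ?T" "\<not> below (fst p') (fst m)" "gen_order M (snd p') = gen_order M (snd m)"
        unfolding dominated_def by blast
      then have "p' \<in> ?A" using m(1) by simp
      then show False using m(2) p'(2) by blast
    qed
    then obtain c where c: "c \<in> set (canonical M F)" "gen_order M (snd c) = gen_order M (snd t)"
      using canonical(2)[OF F, of m] m(1) False by auto
    then have cT: "c \<in> set ?T" "\<not> dominated M ?T c" using canonical(1)[OF F] by auto
    have "below (fst m) (fst c)" using cT(2) m(1) c(2) unfolding dominated_def by auto
    then have tc: "below (fst t) (fst c)" using m(2) t(1) below_trans by blast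
    have "gen (snd c) \<subseteq> gen (snd t)" by (rule cumulate_antimono[OF F t(1) cT(1) tc])
    then have "gen (snd c) = gen (snd t)"
      using card_subset_eq[OF finite_gen[OF ok[OF t(1)]]] c(2) by blast
    then have "gen (snd p) \<subseteq> gen (snd c)" using pt by simp
    then show ?thesis using c(1) tc t(2) unfolding covers_def by auto
  qed
qed

lemma canonical_covers:
  assumes F: "ok_levels F" and "covers F v A" shows "covers (canonical M F) v A"
proof (cases "A \<subseteq> {\<one>\<^bsub>G\<^esub>}")
  case False
  then obtain p where p: "p \<in> set F" "below v (fst p)" "A \<subseteq> gen (snd p)" using assms by (auto simp: covers_def)
  have "covers (canonical M F) v (gen (snd p))" by (rule covers_below[OF canonical_covers_pair[OF F p(1)] p(2)])
  then show ?thesis using p(3) by (auto simp: covers_def)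
qed (simp add: covers_def)

lemma canonical_ok: "ok_levels F \<Longrightarrow> ok_levels (canonical M F)"
  using canonical(1) cumulate_ok(1) by blast

lemma in_expandE:
  assumes "p \<in> set (expand M us D F)"
  obtains "p \<in> set F"
  | x y where "x \<in> set F" "y \<in> set D" "p = (fst x +\<^sub>v fst y, commutator_gens M (snd x) (snd y))"
  | x y where "x \<in> set F" "y \<in> set D" "p = (trunc (fst y) (fst x), iter_commutator_gens M us (snd x) (snd y))"
  using assms unfolding expand_def by auto

lemma expand_ok:
  assumes "ok_levels D" "ok_levels F" shows "ok_levels (expand M us D F)"
proof
  fix p assume "p \<in> set (expand M us D F)"
  then show "ok (snd p)"
  proof (cases rule: in_expandE)
    case 1
    then show ?thesis using assms(2) by blast
  next
    case (2 x y)
    then have "ok (snd x)" "ok (snd y)" using assms by blast+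
    from commutator_gens(1)[OF this] show ?thesis using 2(3) by simp
  next
    case (3 x y)
    then have "ok (snd x)" "ok (snd y)" using assms by blast+
    from iter_commutator_gens(1)[OF this] show ?thesis using 3(3) by simp
  qed
qed

text \<open>
  If the commutator with \<open>H\<close> is not stationary from the start, its first step at least halves the
  order.
\<close>

lemma stable_commutator:
  assumes "finite K" "K \<lhd> G" "H \<lhd> G" "card K \<le> 2 ^ l"
  shows "commutator G (((\<lambda>K. commutator G K H) ^^ l) K) H = ((\<lambda>K. commutator G K H) ^^ l) K"
  using assms
proof (induction l arbitrary: K)
  case 0
  have "\<one>\<^bsub>G\<^esub> \<in> K" using 0 by (intro subgroup.one_closed normal_imp_subgroup)
  then have "K = {\<one>\<^bsub>G\<^esub>}" using 0 card_seteq[of K "{\<one>\<^bsub>G\<^esub>}"] by auto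
  then show ?case using commutator_trivial[OF 0(3)] by simp
next
  case (Suc l)
  let ?K = "commutator G K H"
  have n: "?K \<lhd> G" by (rule commutator_normal[OF Suc.prems(2,3)])
  have sub: "?K \<subseteq> K" by (rule commutator_subset_left[OF Suc.prems(2,3)])
  show ?case
  proof (cases "?K = K")
    case True
    have "((\<lambda>K. commutator G K H) ^^ n) K = K" for n using True by (induction n) auto
    then show ?thesis using True by simp
  next
    case False
    then have "2 * card ?K \<le> card K"
      using sub Suc.prems by (intro card_proper_subgroup normal_imp_subgroup n) auto
    then have "card ?K \<le> 2 ^ l" using Suc.prems(4) by simp
    from Suc.IH[OF finite_subset[OF sub Suc.prems(1)] n Suc.prems(3) this]
    show ?thesis by (simp only: funpow_Suc_right comp_apply)
  qed
qed

end

section \<open>Vectors in the output\<close>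

lemma succ_vec_simps:
  "succ_vec z [] = z"
  "succ_vec z (x # w) = (if w = [] then (x + 1) # tl z else x # succ_vec (tl z) w)"
proof -
  have tl: "foldr (\<lambda>_ r. tl r) w (tl z) = tl (foldr (\<lambda>_ r. tl r) w z)" for w :: "nat list" and z :: "nat list"
    by (induction w) auto
  have ne: "foldr (\<lambda>x r. if r = [] then [x + 1] else x # r) w [] = [] \<longleftrightarrow> w = []" for w :: "nat list"
    by (induction w) auto
  show "succ_vec z [] = z" by (simp add: succ_vec_def)
  show "succ_vec z (x # w) = (if w = [] then (x + 1) # tl z else x # succ_vec (tl z) w)"
    using ne[of w] by (auto simp: succ_vec_def tl)
qed

lemma succ_vec:
  fixes s w w' :: "nat list"
  assumes "w \<noteq> []" "length w \<le> n"
  shows "length (succ_vec (replicate n 0) w) = n"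
    "length s = n \<Longrightarrow> succ_vec (replicate n 0) w \<le> s \<longleftrightarrow> \<not> below s w"
    "length w' \<le> n \<Longrightarrow> \<not> below w' w \<Longrightarrow> below (succ_vec (replicate n 0) w) w'"
proof -
  have "length (succ_vec (replicate n 0) w) = n \<and>
    (\<forall>s. length s = n \<longrightarrow> (succ_vec (replicate n 0) w \<le> s \<longleftrightarrow> \<not> below s w)) \<and>
    (\<forall>w'. length w' \<le> n \<longrightarrow> \<not> below w' w \<longrightarrow> below (succ_vec (replicate n 0) w) w')"
    using assms
  proof (induction w arbitrary: n)
    case (Cons x w)
    obtain k where n: "n = Suc k" "length w \<le> k" using Cons.prems by (cases n) auto
    have z: "replicate k 0 \<le> s" if "length s = k" for s :: "nat list"
      using below_zeros[of s k] that by (simp add: below_eq_le)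
    show ?case
    proof (cases "w = []")
      case True
      have 1: "succ_vec (replicate n 0) (x # w) = Suc x # replicate k 0"
        using True n by (simp add: succ_vec_simps)
      show ?thesis unfolding 1
      proof (intro conjI allI impI)
        show "length (Suc x # replicate k 0) = n" using n by simp
        show "Suc x # replicate k 0 \<le> s \<longleftrightarrow> \<not> below s (x # w)" if "length s = n" for s
          using that n True z by (cases s) auto
        show "below (Suc x # replicate k 0) w'" if "length w' \<le> n" "\<not> below w' (x # w)" for w'
          using that n True below_zeros by (cases w') auto
      qed
    next
      case False
      have 1: "succ_vec (replicate n 0) (x # w) = x # succ_vec (replicate k 0) w"
        using False n by (simp add: succ_vec_simps)
      note IH = Cons.IH[OF False n(2)]
      show ?thesis unfolding 1
      proof (intro conjI allI impI)
        show "length (x # succ_vec (replicate k 0) w) = n" using n IH by simp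
        show "x # succ_vec (replicate k 0) w \<le> s \<longleftrightarrow> \<not> below s (x # w)" if "length s = n" for s
          using that n IH by (cases s) auto
        show "below (x # succ_vec (replicate k 0) w) w'" if "length w' \<le> n" "\<not> below w' (x # w)" for w'
          using that n IH by (cases w') auto
      qed
    qed
  qed simp
  then show "length (succ_vec (replicate n 0) w) = n"
    "length s = n \<Longrightarrow> succ_vec (replicate n 0) w \<le> s \<longleftrightarrow> \<not> below s w"
    "length w' \<le> n \<Longrightarrow> \<not> below w' w \<Longrightarrow> below (succ_vec (replicate n 0) w) w'"
    by auto
qed

text \<open>
  Thus \<open>level_min\<close> is the least vector that is not below any smaller weight of \<open>F\<close>, and it lies
  below \<open>w\<close> itself, so no level is empty.
\<close>

lemma level_min:
  fixes s w :: "nat list" and F :: "'g levels"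
  assumes "\<forall>p\<in>set F. length (fst p) \<le> n" "length w \<le> n"
  shows "length (level_min (replicate n 0) F w) = n"
    "below (level_min (replicate n 0) F w) w"
    "length s = n \<Longrightarrow> level_min (replicate n 0) F w \<le> s \<longleftrightarrow> (\<forall>p\<in>set F. \<not> below w (fst p) \<longrightarrow> \<not> below s (fst p))"
proof -
  let ?z = "replicate n 0"
  have "length (level_min ?z F w) = n \<and> below (level_min ?z F w) w \<and>
    (\<forall>s. length s = n \<longrightarrow> (level_min ?z F w \<le> s \<longleftrightarrow> (\<forall>p\<in>set F. \<not> below w (fst p) \<longrightarrow> \<not> below s (fst p))))"
    using assms(1)
  proof (induction F)
    case Nil
    have "?z \<le> s" if "length s = n" for s :: "nat list"
      using below_zeros[of s n] that by (simp add: below_eq_le)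
    then show ?case using assms(2) below_zeros by (simp add: level_min_def)
  next
    case (Cons p F)
    let ?r = "level_min ?z F w"
    have IH: "length ?r = n" "below ?r w"
      "\<And>s. length s = n \<Longrightarrow> ?r \<le> s \<longleftrightarrow> (\<forall>p\<in>set F. \<not> below w (fst p) \<longrightarrow> \<not> below s (fst p))"
      using Cons by auto
    have e: "level_min ?z (p # F) w = (if below w (fst p) \<or> below (succ_vec ?z (fst p)) ?r then ?r else succ_vec ?z (fst p))"
      by (simp add: level_min_def)
    show ?case
    proof (cases "below w (fst p)")
      case True
      then show ?thesis using IH e by simp
    next
      case False
      then have ne: "fst p \<noteq> []" by auto
      have len: "length (fst p) \<le> n" using Cons.prems by simp
      note S = succ_vec[OF ne len]
      have b: "below (succ_vec ?z (fst p)) w" by (rule S(3)[OF assms(2) False])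
      have bl: "below (succ_vec ?z (fst p)) ?r \<longleftrightarrow> succ_vec ?z (fst p) \<le> ?r"
        using S(1) IH(1) by (simp add: below_eq_le)
      show ?thesis
      proof (cases "succ_vec ?z (fst p) \<le> ?r")
        case True
        have "succ_vec ?z (fst p) \<le> s" if "?r \<le> s" for s using True that by (rule order_trans)
        then show ?thesis using e bl IH S(2) False True by auto
      next
        case F2: False
        then have "?r \<le> succ_vec ?z (fst p)" by simp
        then have "?r \<le> s" if "succ_vec ?z (fst p) \<le> s" for s using that by (rule order_trans)
        then show ?thesis using e bl IH S(1,2) False b F2 by auto
      qed
    qed
  qed
  then show "length (level_min (replicate n 0) F w) = n"
    "below (level_min (replicate n 0) F w) w"
    "length s = n \<Longrightarrow> level_min (replicate n 0) F w \<le> s \<longleftrightarrow> (\<forall>p\<in>set F. \<not> below w (fst p) \<longrightarrow> \<not> below s (fst p))"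
    by auto
qed

text \<open>
  Below an infinite weight there is no largest vector, as the infinite coordinate can be raised.
\<close>

lemma below_short_unbounded:
  "below s w \<Longrightarrow> length w < length s \<Longrightarrow> \<exists>t. length t = length s \<and> s < t \<and> below t w"
proof (induction s w rule: below.induct)
  case (1 xs)
  then show ?case by (cases xs) (auto intro!: exI[of _ "Suc (hd xs) # tl xs"])
next
  case (3 x xs y ys)
  show ?case
  proof (cases "x < y")
    case True
    obtain a as where xs: "xs = a # as" using 3 by (cases xs) auto
    then show ?thesis using True by (intro exI[of _ "x # Suc a # as"]) auto
  next
    case False
    then obtain t where "length t = length xs" "xs < t" "below t ys" using 3 by auto
    then show ?thesis using False 3(2) by (intro exI[of _ "x # t"]) auto
  qed
qed auto

section \<open>Correctness of the algorithm\<close>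

text \<open>
  The assumptions on \<open>D\<close> are those properties of a stored prefilter with maxima that the algorithm
  relies on.
\<close>

locale generate_input = model M q + finite_prefilter "grp M" d \<pi>
  for M :: "'g group_model" and q d \<pi> +
  fixes D :: "'g levels"
  assumes input: "\<And>p. p \<in> set D \<Longrightarrow> length (fst p) = d \<and> set (snd p) \<subseteq> carrier (grp M) \<and>
      generate (grp M) (set (snd p)) = \<pi> (fst p)"
    and input_max: "\<And>s. s \<in> vecs d \<Longrightarrow> \<pi> s \<noteq> {\<one>\<^bsub>grp M\<^esub>} \<Longrightarrow>
      \<exists>p\<in>set D. s \<le> fst p \<and> generate (grp M) (set (snd p)) = \<pi> s"
begin

definition sound :: "'g levels \<Rightarrow> bool" where
  "sound F \<longleftrightarrow> (\<forall>p\<in>set F. length (fst p) \<le> d \<and> ok (snd p) \<and> gen (snd p) \<lhd> G \<and>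
     (\<forall>s\<in>vecs d. below s (fst p) \<longrightarrow> gen (snd p) \<subseteq> clo s))"

lemma input_normal: "p \<in> set D \<Longrightarrow> gen (snd p) \<lhd> G"
  using input[of p] pi_normal[of "fst p"] by (simp add: vecs_def)

lemma input_vecs: "p \<in> set D \<Longrightarrow> fst p \<in> vecs d"
  using input by (simp add: vecs_def)

lemma sound_input: "sound D"
  unfolding sound_def
proof (intro ballI conjI impI)
  fix p assume p: "p \<in> set D"
  show "length (fst p) \<le> d" "ok (snd p)" "gen (snd p) \<lhd> G" using input[OF p] input_normal[OF p] by auto
  fix s assume s: "s \<in> vecs d" "below s (fst p)"
  then have "s \<le> fst p" using input_vecs[OF p] by (simp add: vecs_def below_eq_le)
  then show "gen (snd p) \<subseteq> clo s"
    using pi_subset_clo[OF input_vecs[OF p]] clo_antimono[OF s(1)] input[OF p] by blast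
qed

lemma sound_ok: "sound F \<Longrightarrow> ok_levels F"
  by (simp add: sound_def)

text \<open>
  All subgroups lie in the closure at \<open>0\<close>, which is contained in the largest subgroup of the prefilter.
\<close>

lemma card_levels:
  assumes "sound F" "p \<in> set F"
  shows "card (gen (snd p)) \<le> 2 ^ length (fuel M D)"
proof -
  let ?z = "replicate d (0::nat)" and ?H = "generate G (set (concat (map snd D)))"
  have ok_all: "set (concat (map snd D)) \<subseteq> carrier G" using sound_ok[OF sound_input] by auto
  have z: "?z \<in> vecs d" by (simp add: vecs_def)
  have zle: "?z \<le> s" if "s \<in> vecs d" for s
    using below_zeros[of s d] that by (simp add: below_eq_le vecs_def)
  have clo: "clo ?z \<subseteq> \<pi> ?z"
  proof (rule clo_least[OF pi_normal[OF z]])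
    fix P assume P: "P \<in> partitions d ?z"
    then obtain p where p: "p \<in> set P" "p \<in> vecs d" by (cases P) (auto simp: partitions_def)
    have "iter_commutator G (map \<pi> P) \<subseteq> \<pi> p"
      using P p pi_normal by (intro iter_commutator_subset_elem) (auto simp: partitions_def)
    also have "\<dots> \<subseteq> \<pi> ?z" by (rule pi_antimono[OF z p(2) zle[OF p(2)]])
    finally show "iter_commutator G (map \<pi> P) \<subseteq> \<pi> ?z" .
  qed
  have pi: "\<pi> ?z \<subseteq> ?H"
  proof (cases "\<pi> ?z = {\<one>\<^bsub>G\<^esub>}")
    case True
    then show ?thesis by (auto intro: generate.one)
  next
    case False
    then obtain p where "p \<in> set D" "gen (snd p) = \<pi> ?z" using input_max[OF z] by blast
    moreover have "gen (snd p) \<subseteq> ?H" using calculation(1) by (intro mono_generate) auto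
    ultimately show ?thesis by simp
  qed
  have "gen (snd p) \<subseteq> clo ?z" using assms z below_zeros unfolding sound_def by blast
  then have "gen (snd p) \<subseteq> ?H" using clo pi by blast
  then have "card (gen (snd p)) \<le> card ?H"
    by (rule card_mono[OF finite_subset[OF generate_incl[OF ok_all] finite_carrier]])
  then show ?thesis using card_le_log_order[of M "concat (map snd D)"] by (simp add: fuel_def)
qed

text \<open>
  Each cumulated subgroup is the product of the subgroups that are recorded at this weight or
  at larger ones.
\<close>

lemma sound_canonical:
  assumes F: "sound F" shows "sound (canonical M F)"
  unfolding sound_def
proof (intro ballI conjI impI)
  fix p assume "p \<in> set (canonical M F)"
  then have p: "p \<in> set (cumulate M F)" using canonical(1)[OF sound_ok[OF F]] by auto
  note c = cumulate_ok[OF sound_ok[OF F] p]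
  show "ok (snd p)" "gen (snd p) \<lhd> G" using c by auto
  show "length (fst p) \<le> d" using c(5) F unfolding sound_def by metis
  fix s assume s: "s \<in> vecs d" "below s (fst p)"
  show "gen (snd p) \<subseteq> clo s"
    unfolding c(4)
  proof (rule normal_closure_least[OF clo_normal], rule UN_least)
    fix p' assume p': "p' \<in> {p' \<in> set F. below (fst p) (fst p')}"
    then have "below s (fst p')" using s(2) below_trans by blast
    then have "gen (snd p') \<subseteq> clo s" using p' F s(1) unfolding sound_def by blast
    moreover have "set (snd p') \<subseteq> gen (snd p')" by (rule subsetI) (rule generate.incl)
    ultimately show "set (snd p') \<subseteq> clo s" by blast
  qed
qed

text \<open>
  Appending one subgroup is \<open>clo_commutator\<close>. For the limit step, the group \<open>K\<close> with \<open>[K, H] = K\<close>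
  is contained in the closure at \<open>t\<close>, and by induction at \<open>t + n m\<close> for all \<open>n\<close>.
\<close>

lemma sound_expand:
  assumes F: "sound F" shows "sound (expand M (fuel M D) D F)"
  unfolding sound_def
proof
  fix p assume "p \<in> set (expand M (fuel M D) D F)"
  then show "length (fst p) \<le> d \<and> ok (snd p) \<and> gen (snd p) \<lhd> G \<and>
     (\<forall>s\<in>vecs d. below s (fst p) \<longrightarrow> gen (snd p) \<subseteq> clo s)"
  proof (cases rule: in_expandE)
    case 1
    then show ?thesis using F by (simp add: sound_def)
  next
    case (2 x y)
    have x: "length (fst x) \<le> d" "ok (snd x)" "gen (snd x) \<lhd> G"
      "\<And>s. s \<in> vecs d \<Longrightarrow> below s (fst x) \<Longrightarrow> gen (snd x) \<subseteq> clo s"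
      using F 2(1) unfolding sound_def by auto
    have y: "length (fst y) = d" "ok (snd y)" "gen (snd y) \<lhd> G" "gen (snd y) = \<pi> (fst y)" "fst y \<in> vecs d"
      using input[OF 2(2)] input_normal[OF 2(2)] input_vecs[OF 2(2)] by auto
    have e: "gen (snd p) = commutator G (gen (snd x)) (gen (snd y))"
      using 2(3) commutator_gens(3)[OF x(2) y(2) x(3) y(3)] by simp
    have "gen (snd p) \<subseteq> clo s" if s: "s \<in> vecs d" "below s (fst p)" for s
    proof -
      have "below s (fst x +\<^sub>v fst y)" using s(2) 2(3) by simp
      then obtain t where t: "length t = d" "below t (fst x)" "s \<le> t +\<^sub>v fst y"
        using le_add_vec_split_extended[of s "fst x" "fst y"] s(1) x(1) y(1) by (auto simp: vecs_def)
      have tv: "t \<in> vecs d" using t(1) by (simp add: vecs_def)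
      have "gen (snd p) \<subseteq> commutator G (clo t) (\<pi> (fst y))"
        unfolding e using x(4)[OF tv t(2)] y(4) by (intro commutator_mono) auto
      also have "\<dots> \<subseteq> clo (t +\<^sub>v fst y)" by (rule clo_commutator[OF tv y(5)])
      also have "\<dots> \<subseteq> clo s" by (rule clo_antimono[OF s(1) t(3)])
      finally show ?thesis .
    qed
    then show ?thesis using 2(3) x(1) y(1) commutator_gens(1)[OF x(2) y(2)] e commutator_normal[OF x(3) y(3)] by simp
  next
    case (3 x y)
    have x: "length (fst x) \<le> d" "ok (snd x)" "gen (snd x) \<lhd> G"
      "\<And>s. s \<in> vecs d \<Longrightarrow> below s (fst x) \<Longrightarrow> gen (snd x) \<subseteq> clo s"
      using F 3(1) unfolding sound_def by auto
    have y: "length (fst y) = d" "ok (snd y)" "gen (snd y) \<lhd> G" "gen (snd y) = \<pi> (fst y)" "fst y \<in> vecs d"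
      using input[OF 3(2)] input_normal[OF 3(2)] input_vecs[OF 3(2)] by auto
    let ?c = "\<lambda>K. commutator G K (gen (snd y))"
    have e: "gen (snd p) \<lhd> G" "gen (snd p) = (?c ^^ length (fuel M D)) (gen (snd x))"
    proof -
      have g: "snd p = iter_commutator_gens M (fuel M D) (snd x) (snd y)" using 3(3) by simp
      show "gen (snd p) \<lhd> G" "gen (snd p) = (?c ^^ length (fuel M D)) (gen (snd x))"
        unfolding g using iter_commutator_gens(3)[OF x(2) y(2) x(3) y(3), of "fuel M D"] by blast+
    qed
    have stable: "?c (gen (snd p)) = gen (snd p)"
      unfolding e(2)
      by (rule stable_commutator[OF finite_gen[OF x(2)] x(3) y(3) card_levels[OF F 3(1)]])
    have "(?c ^^ n) (gen (snd x)) \<subseteq> gen (snd x) \<and> (?c ^^ n) (gen (snd x)) \<lhd> G" for n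
    proof (induction n)
      case (Suc n)
      then show ?case
        using commutator_subset_left[of "(?c ^^ n) (gen (snd x))" "gen (snd y)"]
          commutator_normal[of "(?c ^^ n) (gen (snd x))" "gen (snd y)"] y(3) by auto
    qed (use x(3) in simp)
    then have sub: "gen (snd p) \<subseteq> gen (snd x)" unfolding e(2) by blast
    have "gen (snd p) \<subseteq> clo s" if s: "s \<in> vecs d" "below s (fst p)" for s
    proof -
      have "below s (trunc (fst y) (fst x))" using s(2) 3(3) by simp
      then obtain t n where t: "length t = d" "below t (fst x)" "s \<le> ((\<lambda>t. t +\<^sub>v fst y) ^^ n) t"
        using below_trunc_pump[of s "fst y" "fst x"] s(1) x(1) y(1) by (auto simp: vecs_def)
      have tv: "t \<in> vecs d" using t(1) by (simp add: vecs_def)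
      have "gen (snd p) \<subseteq> clo (((\<lambda>t. t +\<^sub>v fst y) ^^ n) t) \<and> ((\<lambda>t. t +\<^sub>v fst y) ^^ n) t \<in> vecs d"
      proof (induction n)
        case 0
        then show ?case using sub x(4)[OF tv t(2)] tv by auto
      next
        case (Suc n)
        let ?u = "((\<lambda>t. t +\<^sub>v fst y) ^^ n) t"
        have "gen (snd p) \<subseteq> commutator G (clo ?u) (\<pi> (fst y))"
          using commutator_mono[of "gen (snd p)" "clo ?u" "gen (snd y)" "\<pi> (fst y)"] Suc y(4) stable by simp
        also have "\<dots> \<subseteq> clo (?u +\<^sub>v fst y)" using Suc by (intro clo_commutator y(5)) simp
        finally show ?case using Suc y(1) by (simp add: vecs_def)
      qed
      then show ?thesis using clo_antimono[OF s(1) t(3)] by blast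
    qed
    then show ?thesis using 3(3) x(1) iter_commutator_gens(1)[OF x(2) y(2)] e(1) by (auto simp: trunc_def)
  qed
qed

abbreviation round :: "'g levels \<Rightarrow> 'g levels" where
  "round F \<equiv> canonical M (expand M (fuel M D) D F)"

lemma covers_expand:
  assumes "covers F v A" shows "covers (expand M us D F) v A"
  using assms unfolding covers_def expand_def by auto

lemma covers_round: "sound F \<Longrightarrow> covers F v A \<Longrightarrow> covers (round F) v A"
  by (rule canonical_covers[OF sound_ok[OF sound_expand] covers_expand])

lemma trivial_commutator_subset:
  assumes "A \<subseteq> {\<one>\<^bsub>G\<^esub>}" "H \<lhd> G" shows "commutator G A H \<subseteq> {\<one>\<^bsub>G\<^esub>}"
  using commutator_mono[OF assms(1) order_refl, of H] commutator_trivial[OF assms(2)] by simp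

lemma covers_step:
  assumes F: "sound F" and A: "covers F v A" and y: "y \<in> set D"
  shows "covers (round F) (v +\<^sub>v fst y) (commutator G A (gen (snd y)))"
proof (rule canonical_covers[OF sound_ok[OF sound_expand[OF F]]])
  show "covers (expand M (fuel M D) D F) (v +\<^sub>v fst y) (commutator G A (gen (snd y)))"
  proof (cases "A \<subseteq> {\<one>\<^bsub>G\<^esub>}")
    case True
    then show ?thesis using trivial_commutator_subset[OF True input_normal[OF y]] by (simp add: covers_def)
  next
    case False
    then obtain x where x: "x \<in> set F" "below v (fst x)" "A \<subseteq> gen (snd x)" using A by (auto simp: covers_def)
    let ?p = "(fst x +\<^sub>v fst y, commutator_gens M (snd x) (snd y))"
    have "?p \<in> set (expand M (fuel M D) D F)" unfolding expand_def using x(1) y by fastforce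
    moreover have "below (v +\<^sub>v fst y) (fst ?p)" using below_add_mono[OF x(2) below_refl] by simp
    moreover have "gen (snd ?p) = commutator G (gen (snd x)) (gen (snd y))"
      using commutator_gens(3)[of "snd x" "snd y"] F x(1) input[OF y] input_normal[OF y] by (simp add: sound_def)
    then have "commutator G A (gen (snd y)) \<subseteq> gen (snd ?p)" using commutator_mono[OF x(3) order_refl] by simp
    ultimately show ?thesis unfolding covers_def by blast
  qed
qed

text \<open>
  If \<open>A = [A, H]\<close> and \<open>A \<le> K\<close>, then \<open>A\<close> is contained in each of \<open>[K, H, \<dots>, H]\<close>. It is essential to
  pump \<open>K\<close> itself, because only its subgroup \<open>A\<close> need be stationary.
\<close>

lemma covers_pump:
  assumes F: "sound F" and A: "covers F v A" and y: "y \<in> set D" and stable: "commutator G A (gen (snd y)) = A"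
  shows "covers (round F) (trunc (fst y) v) A"
proof (rule canonical_covers[OF sound_ok[OF sound_expand[OF F]]])
  show "covers (expand M (fuel M D) D F) (trunc (fst y) v) A"
  proof (cases "A \<subseteq> {\<one>\<^bsub>G\<^esub>}")
    case False
    then obtain x where x: "x \<in> set F" "below v (fst x)" "A \<subseteq> gen (snd x)" using A by (auto simp: covers_def)
    let ?p = "(trunc (fst y) (fst x), iter_commutator_gens M (fuel M D) (snd x) (snd y))"
    have "?p \<in> set (expand M (fuel M D) D F)" unfolding expand_def using x(1) y by fastforce
    moreover have "below (trunc (fst y) v) (fst ?p)" using below_take_both[OF x(2)] by (simp add: trunc_def)
    moreover have "A \<subseteq> gen (snd ?p)"
    proof -
      have "gen (snd ?p) = ((\<lambda>K. commutator G K (gen (snd y))) ^^ length (fuel M D)) (gen (snd x))"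
        using iter_commutator_gens(3)[of "snd x" "snd y"] F x(1) input[OF y] input_normal[OF y] by (simp add: sound_def)
      moreover have "A \<subseteq> ((\<lambda>K. commutator G K (gen (snd y))) ^^ n) (gen (snd x))" for n
      proof (induction n)
        case (Suc n)
        from commutator_mono[OF Suc order_refl, of "gen (snd y)"] show ?case using stable by simp
      qed (use x(3) in simp)
      ultimately show ?thesis by simp
    qed
    ultimately show ?thesis unfolding covers_def by blast
  qed (simp add: covers_def)
qed

lemma sound_rounds: "sound ((round ^^ n) D)"
  by (induction n) (auto intro: sound_input sound_canonical sound_expand)

lemma covers_rounds_mono:
  assumes "covers ((round ^^ m) D) v A" "m \<le> n" shows "covers ((round ^^ n) D) v A"
  using assms(2,1) by (induction n rule: dec_induct) (auto intro: covers_round sound_rounds)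

lemma take_add_leading_zeros:
  "length s = length m \<Longrightarrow> l \<le> length (takeWhile ((=) 0) m) \<Longrightarrow> take l (s +\<^sub>v m) = take l s"
proof (induction s m arbitrary: l rule: list_induct2)
  case (Cons x s y m)
  then show ?case by (cases l) (auto split: if_splits)
qed simp

text \<open>
  The invariant of the induction over \<open>J\<close>. Here \<open>k\<close> counts the strict steps so far, and
  \<open>take l v\<close> is the weight after the current plateau: a proper truncation is justified by a summand
  that stabilizes the current group and has its leading coordinate at \<open>l\<close>. The truncation is not
  carried out before the plateau ends, so that a plateau is charged for a single round.
\<close>

definition reached :: "(nat list \<times> 'g list) list \<Rightarrow> bool" where
  "reached J \<longleftrightarrow> (\<exists>k v l. card (iter_commutator G (map (\<lambda>y. gen (snd y)) J)) * 2 ^ k \<le> 2 ^ length (fuel M D) \<and>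
     covers ((round ^^ (2 * k)) D) v (iter_commutator G (map (\<lambda>y. gen (snd y)) J)) \<and>
     (l = length v \<or> (\<exists>y\<in>set D. l = length (takeWhile ((=) 0) (fst y)) \<and>
        commutator G (iter_commutator G (map (\<lambda>y. gen (snd y)) J)) (gen (snd y)) =
        iter_commutator G (map (\<lambda>y. gen (snd y)) J))) \<and>
     below (vec_sum d (map fst J)) (take l v))"

lemma reached_covers:
  assumes "covers F v A" "sound F"
    "l = length v \<or> (\<exists>y\<in>set D. l = length (takeWhile ((=) 0) (fst y)) \<and> commutator G A (gen (snd y)) = A)"
  shows "covers (round F) (take l v) A"
  using assms(3)
proof
  assume "l = length v"
  then show ?thesis using covers_round[OF assms(2,1)] by simp
next
  assume "\<exists>y\<in>set D. l = length (takeWhile ((=) 0) (fst y)) \<and> commutator G A (gen (snd y)) = A"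
  then show ?thesis using covers_pump[OF assms(2,1)] by (auto simp: trunc_def)
qed

text \<open>
  If the next commutator is a strict step, the pending truncation is carried out in one round and
  the commutator is formed in another one; the order is at least halved. On a plateau no round
  is spent, but the truncation is moved to the leading coordinate of the new summand, if that comes
  earlier. Otherwise the new summand does not change the coordinates that remain.
\<close>

lemma all_reached:
  assumes "J \<noteq> []" "set J \<subseteq> set D"
  shows "reached J"
  using assms
proof (induction J rule: rev_induct)
  case Nil
  then show ?case by simp
next
  case (snoc y J)
  have y: "y \<in> set D" using snoc.prems by simp
  show ?case
  proof (cases "J = []")
    case True
    have "covers D (fst y) (gen (snd y))"
      unfolding covers_def using y by (intro disjI2 bexI[of _ y]) auto
    moreover have "card (gen (snd y)) \<le> 2 ^ length (fuel M D)" by (rule card_levels[OF sound_input y])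
    moreover have "vec_sum d [fst y] = fst y" using input[OF y] by (simp add: vec_sum_def)
    ultimately show ?thesis using True unfolding reached_def
      by (intro exI[of _ 0] exI[of _ "fst y"] exI[of _ "length (fst y)"]) (simp add: iter_commutator_def)
  next
    case False
    let ?A = "iter_commutator G (map (\<lambda>y. gen (snd y)) J)" and ?S = "vec_sum d (map fst J)"
    let ?A' = "commutator G ?A (gen (snd y))" and ?S' = "?S +\<^sub>v fst y"
    have J: "set J \<subseteq> set D" using snoc.prems by simp
    have Jv: "set (map fst J) \<subseteq> vecs d" unfolding set_map using J input_vecs by blast
    have lenS: "length ?S = length (fst y)"
      using length_vec_sum[OF Jv] input[OF y] by simp
    have A': "iter_commutator G (map (\<lambda>y. gen (snd y)) (J @ [y])) = ?A'"
      using False by (simp add: iter_commutator_snoc)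
    have S': "vec_sum d (map fst (J @ [y])) = ?S'"
      using vec_sum_snoc[OF Jv input_vecs[OF y]] by simp
    have nA: "?A \<lhd> G" using False J input_normal by (intro iter_commutator_normal) auto
    note ny = input_normal[OF y]
    obtain k v l where r: "card ?A * 2 ^ k \<le> 2 ^ length (fuel M D)" "covers ((round ^^ (2 * k)) D) v ?A"
      "l = length v \<or> (\<exists>y\<in>set D. l = length (takeWhile ((=) 0) (fst y)) \<and> commutator G ?A (gen (snd y)) = ?A)"
      "below ?S (take l v)"
      using snoc.IH[OF False J] unfolding reached_def
      by - (elim exE conjE, rule that, assumption+)
    show ?thesis
    proof (cases "?A' = ?A")
      case True
      let ?j = "length (takeWhile ((=) 0) (fst y))"
      \<comment> \<open>The earlier of the two leading coordinates becomes infinite.\<close>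
      define l' where "l' = min l ?j"
      have w: "l' = length v \<or> (\<exists>y\<in>set D. l' = length (takeWhile ((=) 0) (fst y)) \<and> commutator G ?A (gen (snd y)) = ?A)"
      proof (cases "l \<le> ?j")
        case True
        then have "l' = l" by (simp add: l'_def)
        then show ?thesis using r(3) by simp
      next
        case False
        then have "l' = ?j" by (simp add: l'_def)
        then show ?thesis by (intro disjI2 bexI[OF _ y] conjI True)
      qed
      have "take l' ?S' = take l' ?S" by (rule take_add_leading_zeros[OF lenS]) (simp add: l'_def)
      moreover have "below (take l' ?S) (take l' (take l v))" by (rule below_take_both[OF r(4)])
      moreover have "take l' (take l v) = take l' v" by (simp add: l'_def min_def)
      ultimately have "below (take l' ?S') (take l' v)" by simp
      then have b: "below ?S' (take l' v)" by (rule below_of_take) simp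
      show ?thesis unfolding reached_def A' S' True
        by (rule exI[of _ k], rule exI[of _ v], rule exI[of _ l'], intro conjI r(1,2) w b)
    next
      case False
      have sub: "?A' \<subseteq> ?A" by (rule commutator_subset_left[OF nA ny])
      have "finite ?A" using finite_subset[OF normal_subset[OF nA] finite_carrier] .
      then have "2 * card ?A' \<le> card ?A"
        using sub False by (intro card_proper_subgroup normal_imp_subgroup commutator_normal nA ny) auto
      then have le: "2 * card ?A' * 2 ^ k \<le> card ?A * 2 ^ k" by (rule mult_right_mono) simp
      have dbl: "card ?A' * 2 ^ Suc k = 2 * card ?A' * 2 ^ k" by simp
      have 1: "card ?A' * 2 ^ Suc k \<le> 2 ^ length (fuel M D)"
        unfolding dbl by (rule order_trans[OF le r(1)])
      have "covers (round ((round ^^ (2 * k)) D)) (take l v) ?A"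
        by (rule reached_covers[OF r(2) sound_rounds r(3)])
      then have "covers ((round ^^ Suc (2 * k)) D) (take l v) ?A" by simp
      from covers_step[OF sound_rounds this y]
      have 2: "covers ((round ^^ (2 * Suc k)) D) (take l v +\<^sub>v fst y) ?A'" by simp
      have 3: "below ?S' (take (length (take l v +\<^sub>v fst y)) (take l v +\<^sub>v fst y))"
        using below_add_mono[OF r(4) below_refl[of "fst y"]] by simp
      show ?thesis unfolding reached_def A' S'
        by (rule exI[of _ "Suc k"], rule exI[of _ "take l v +\<^sub>v fst y"],
            rule exI[of _ "length (take l v +\<^sub>v fst y)"], intro conjI 1 2 3 disjI1 refl)
    qed
  qed
qed

lemma closure_levels_eq: "closure_levels M D = (round ^^ Suc (2 * length (fuel M D))) D"
proof -
  have "foldr (\<lambda>_ F. round F) us E = (round ^^ length us) E" for us :: "unit list" and E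
    by (induction us) auto
  then show ?thesis unfolding closure_levels_def rounds_def by (simp add: mult_2)
qed

lemma covers_all:
  assumes "J \<noteq> []" "set J \<subseteq> set D"
  shows "covers (closure_levels M D) (vec_sum d (map fst J)) (iter_commutator G (map (\<lambda>y. gen (snd y)) J))"
proof -
  let ?A = "iter_commutator G (map (\<lambda>y. gen (snd y)) J)"
  obtain k v l where r: "card ?A * 2 ^ k \<le> 2 ^ length (fuel M D)" "covers ((round ^^ (2 * k)) D) v ?A"
      "l = length v \<or> (\<exists>y\<in>set D. l = length (takeWhile ((=) 0) (fst y)) \<and> commutator G ?A (gen (snd y)) = ?A)"
      "below (vec_sum d (map fst J)) (take l v)"
      using all_reached[OF assms] unfolding reached_def
      by - (elim exE conjE, rule that, assumption+)
  have "\<forall>A\<in>set (map (\<lambda>y. gen (snd y)) J). A \<lhd> G" using assms(2) input_normal by auto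
  then have nA: "?A \<lhd> G" using assms(1) by (intro iter_commutator_normal) simp_all
  have "\<one>\<^bsub>G\<^esub> \<in> ?A" by (rule subgroup.one_closed[OF normal_imp_subgroup[OF nA]])
  then have "0 < card ?A"
    using finite_subset[OF normal_subset[OF nA] finite_carrier] card_gt_0_iff by blast
  then have "1 * 2 ^ k \<le> card ?A * 2 ^ k" by (intro mult_right_mono) simp_all
  from order_trans[OF this r(1)] have k: "k \<le> length (fuel M D)" by simp
  have "covers (round ((round ^^ (2 * k)) D)) (take l v) ?A"
    by (rule reached_covers[OF r(2) sound_rounds r(3)])
  then have "covers ((round ^^ Suc (2 * k)) D) (take l v) ?A" by simp
  then have "covers ((round ^^ Suc (2 * length (fuel M D))) D) (take l v) ?A"
    by (rule covers_rounds_mono) (use k in simp)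
  then show ?thesis unfolding closure_levels_eq by (rule covers_below[OF _ r(4)])
qed

text \<open>
  Each part is raised to the maximum of its level.
\<close>

lemma partition_covered:
  assumes "P \<in> partitions d s"
  shows "covers (closure_levels M D) s (iter_commutator G (map \<pi> P))"
proof (cases "\<exists>t\<in>set P. \<pi> t = {\<one>\<^bsub>G\<^esub>}")
  case True
  then obtain t where "t \<in> set P" "\<pi> t = {\<one>\<^bsub>G\<^esub>}" by blast
  moreover have "\<forall>A\<in>set (map \<pi> P). A \<lhd> G"
    using assms pi_normal unfolding partitions_def by auto
  ultimately have "iter_commutator G (map \<pi> P) \<subseteq> {\<one>\<^bsub>G\<^esub>}"
    by (intro iter_commutator_subset_elem) (simp_all add: image_iff, metis)
  then show ?thesis by (simp add: covers_def)
next
  case False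
  have P: "P \<noteq> []" "set P \<subseteq> vecs d" "vec_sum d P = s" using assms by (auto simp: partitions_def)
  have "\<exists>J. set J \<subseteq> set D \<and> map (\<lambda>y. gen (snd y)) J = map \<pi> P \<and> length J = length P \<and>
      below (vec_sum d P) (vec_sum d (map fst J))"
    if "set P \<subseteq> vecs d" "\<not> (\<exists>t\<in>set P. \<pi> t = {\<one>\<^bsub>G\<^esub>})" for P
    using that
  proof (induction P)
    case Nil
    then show ?case by (intro exI[of _ "[]"]) auto
  next
    case (Cons t P)
    then obtain J where J: "set J \<subseteq> set D" "map (\<lambda>y. gen (snd y)) J = map \<pi> P" "length J = length P"
      "below (vec_sum d P) (vec_sum d (map fst J))" by auto
    have t: "t \<in> vecs d" "\<pi> t \<noteq> {\<one>\<^bsub>G\<^esub>}" using Cons.prems by auto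
    obtain y where y: "y \<in> set D" "t \<le> fst y" "gen (snd y) = \<pi> t" using input_max[OF t] by blast
    have "below t (fst y)" using y(2) t(1) input_vecs[OF y(1)] by (simp add: below_eq_le vecs_def)
    from below_add_mono[OF this J(4)] show ?case
      using J y by (intro exI[of _ "y # J"]) (simp add: vec_sum_Cons)
  qed
  from this[OF P(2) False] obtain J where J: "set J \<subseteq> set D" "map (\<lambda>y. gen (snd y)) J = map \<pi> P"
    "length J = length P" "below (vec_sum d P) (vec_sum d (map fst J))" by blast
  have "J \<noteq> []" using J(3) P(1) by auto
  from covers_below[OF covers_all[OF this J(1)] J(4)] show ?thesis using J(2) P(3) by simp
qed

lemma sound_closure_levels: "sound (closure_levels M D)"
  unfolding closure_levels_eq by (rule sound_rounds)

lemma closure_levels_canonical: "\<exists>F. ok_levels F \<and> closure_levels M D = canonical M F"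
proof -
  have "closure_levels M D = round ((round ^^ (2 * length (fuel M D))) D)"
    unfolding closure_levels_eq by simp
  then show ?thesis using sound_ok[OF sound_expand[OF sound_rounds]] by blast
qed

lemma closure_levels_chain:
  assumes "p \<in> set (closure_levels M D)" "p' \<in> set (closure_levels M D)" "below (fst p) (fst p')"
  shows "p = p' \<or> gen (snd p') \<subset> gen (snd p)"
  using closure_levels_canonical canonical_proper assms by metis

lemma closure_levels_nontrivial:
  assumes "p \<in> set (closure_levels M D)" shows "gen (snd p) \<noteq> {\<one>\<^bsub>G\<^esub>}"
proof
  assume "gen (snd p) = {\<one>\<^bsub>G\<^esub>}"
  then have "gen_order M (snd p) = 1" by simp
  moreover have "1 < gen_order M (snd p)" using closure_levels_canonical canonical(1) assms by fastforce
  ultimately show False by simp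
qed

lemma closure_levels_distinct: "distinct (map (\<lambda>p. gen (snd p)) (closure_levels M D))"
proof -
  obtain F where F: "ok_levels F" "closure_levels M D = canonical M F" using closure_levels_canonical by blast
  have "distinct (map card (map (\<lambda>p. gen (snd p)) (canonical M F)))" using canonical(3)[OF F(1)] by (simp add: o_def)
  then show ?thesis unfolding F(2) by (rule conjunct1[OF distinct_map[THEN iffD1]])
qed

text \<open>
  The subgroup recorded at the smallest weight above \<open>s\<close> contains all subgroups recorded above \<open>s\<close>.
\<close>

lemma clo_level:
  assumes s: "s \<in> vecs d" and p: "p \<in> set (closure_levels M D)"
  shows "clo s = gen (snd p) \<longleftrightarrow> below s (fst p) \<and> (\<forall>p'\<in>set (closure_levels M D). below s (fst p') \<longrightarrow> below (fst p) (fst p'))"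
    (is "_ \<longleftrightarrow> ?R p")
    and clo_cases: "clo s \<noteq> {\<one>\<^bsub>G\<^esub>} \<Longrightarrow> \<exists>p\<in>set (closure_levels M D). clo s = gen (snd p)"
proof -
  let ?F = "closure_levels M D"
  have eq: "clo s = gen (snd p)" if p: "p \<in> set ?F" and R: "?R p" for p
  proof
    have p': "gen (snd p) \<lhd> G" "gen (snd p) \<subseteq> clo s"
      using sound_closure_levels p s R unfolding sound_def by blast+
    show "gen (snd p) \<subseteq> clo s" by (rule p'(2))
    show "clo s \<subseteq> gen (snd p)"
    proof (rule clo_least[OF p'(1)])
      fix P assume "P \<in> partitions d s"
      from partition_covered[OF this] consider "iter_commutator G (map \<pi> P) \<subseteq> {\<one>\<^bsub>G\<^esub>}" |
        p2 where "p2 \<in> set ?F" "below s (fst p2)" "iter_commutator G (map \<pi> P) \<subseteq> gen (snd p2)"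
        unfolding covers_def by blast
      then show "iter_commutator G (map \<pi> P) \<subseteq> gen (snd p)"
      proof cases
        case 1
        then show ?thesis using generate.one[of G "set (snd p)"] by blast
      next
        case 2
        then have "below (fst p) (fst p2)" using R by blast
        then show ?thesis using closure_levels_chain[OF p 2(1)] 2(3) by blast
      qed
    qed
  qed
  have ex: "\<exists>p\<in>set ?F. ?R p" if ne: "\<exists>p\<in>set ?F. below s (fst p)"
  proof -
    have "finite {p\<in>set ?F. below s (fst p)}" "{p\<in>set ?F. below s (fst p)} \<noteq> {}" using ne by auto
    from exists_below_min[OF this, of fst] show ?thesis by blast
  qed
  have triv: "clo s = {\<one>\<^bsub>G\<^esub>}" if no: "\<not> (\<exists>p\<in>set ?F. below s (fst p))"
  proof
    show "clo s \<subseteq> {\<one>\<^bsub>G\<^esub>}"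
    proof (rule clo_least[OF trivial_normal])
      fix P assume "P \<in> partitions d s"
      from partition_covered[OF this] show "iter_commutator G (map \<pi> P) \<subseteq> {\<one>\<^bsub>G\<^esub>}"
        using no unfolding covers_def by blast
    qed
    show "{\<one>\<^bsub>G\<^esub>} \<subseteq> clo s" using subgroup.one_closed[OF normal_imp_subgroup[OF clo_normal]] by simp
  qed
  show "\<exists>p\<in>set ?F. clo s = gen (snd p)" if "clo s \<noteq> {\<one>\<^bsub>G\<^esub>}"
    using that triv ex eq by blast
  show "clo s = gen (snd p) \<longleftrightarrow> ?R p"
  proof
    assume e: "clo s = gen (snd p)"
    then obtain p2 where p2: "p2 \<in> set ?F" "?R p2"
      using triv ex closure_levels_nontrivial[OF p] by metis
    then have "gen (snd p2) = gen (snd p)" using eq e by simp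
    then have "p2 = p" using closure_levels_distinct p p2(1) by (auto simp: distinct_map inj_on_def)
    then show "?R p" using p2(2) by simp
  qed (rule eq[OF p])
qed

lemma level_eq:
  assumes p: "p \<in> set (closure_levels M D)"
  defines "L \<equiv> level_min (replicate d 0) (closure_levels M D) (fst p)"
  shows "level_set d clo (gen (snd p)) = {s \<in> vecs d. L \<le> s \<and> below s (fst p)}"
    and "L \<in> vecs d" "below L (fst p)"
proof -
  have len: "\<forall>p\<in>set (closure_levels M D). length (fst p) \<le> d"
    using sound_closure_levels unfolding sound_def by blast
  note m = level_min[OF len, of "fst p"]
  show "L \<in> vecs d" "below L (fst p)" unfolding L_def using m len p by (auto simp: vecs_def)
  show "level_set d clo (gen (snd p)) = {s \<in> vecs d. L \<le> s \<and> below s (fst p)}"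
  proof (rule Set.set_eqI)
    fix s
    show "s \<in> level_set d clo (gen (snd p)) \<longleftrightarrow> s \<in> {s \<in> vecs d. L \<le> s \<and> below s (fst p)}"
    proof (cases "s \<in> vecs d")
      case True
      then have "L \<le> s \<longleftrightarrow> (\<forall>p'\<in>set (closure_levels M D). \<not> below (fst p) (fst p') \<longrightarrow> \<not> below s (fst p'))"
        unfolding L_def using m(3) len p by (auto simp: vecs_def)
      then show ?thesis using clo_level[OF True p] True by (auto simp: level_set_def)
    qed (simp add: level_set_def)
  qed
qed

lemma is_min_level:
  assumes p: "p \<in> set (closure_levels M D)"
  shows "is_min (level_set d clo (gen (snd p))) m \<longleftrightarrow>
    m = level_min (replicate d 0) (closure_levels M D) (fst p)"
  using level_eq[OF p] unfolding is_min_def by (auto intro: antisym)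

text \<open>
  A vector is the maximum of the vectors below it, whereas an infinite weight bounds arbitrarily
  large vectors.
\<close>

lemma is_max_level:
  assumes p: "p \<in> set (closure_levels M D)"
  shows "is_max (level_set d clo (gen (snd p))) m \<longleftrightarrow> length (fst p) = d \<and> m = fst p"
proof -
  let ?L = "level_min (replicate d 0) (closure_levels M D) (fst p)"
  note l = level_eq[OF p]
  have len: "length (fst p) \<le> d" using sound_closure_levels p unfolding sound_def by blast
  show ?thesis
  proof (cases "length (fst p) = d")
    case True
    then have v: "fst p \<in> vecs d" by (simp add: vecs_def)
    have "below s (fst p) \<longleftrightarrow> s \<le> fst p" if "s \<in> vecs d" for s
      using that True by (intro below_eq_le) (simp add: vecs_def)
    then show ?thesis using l v True unfolding is_max_def by (auto intro: antisym)
  next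
    case False
    have "\<not> is_max (level_set d clo (gen (snd p))) m"
    proof
      assume m: "is_max (level_set d clo (gen (snd p))) m"
      then have "m \<in> vecs d" "?L \<le> m" "below m (fst p)" using l by (auto simp: is_max_def)
      moreover from this obtain t where "length t = length m" "m < t" "below t (fst p)"
        using below_short_unbounded[of m "fst p"] False len by (auto simp: vecs_def)
      ultimately have "t \<in> level_set d clo (gen (snd p))" using l by (auto simp: vecs_def)
      then show False using m \<open>m < t\<close> unfolding is_max_def by auto
    qed
    then show ?thesis using False by simp
  qed
qed

lemma image_clo: "{H \<in> clo ` vecs d. H \<noteq> {\<one>\<^bsub>G\<^esub>}} = (\<lambda>p. gen (snd p)) ` set (closure_levels M D)"
proof
  show "{H \<in> clo ` vecs d. H \<noteq> {\<one>\<^bsub>G\<^esub>}} \<subseteq> (\<lambda>p. gen (snd p)) ` set (closure_levels M D)"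
  proof
    fix H assume "H \<in> {H \<in> clo ` vecs d. H \<noteq> {\<one>\<^bsub>G\<^esub>}}"
    then obtain s where s: "s \<in> vecs d" "H = clo s" "clo s \<noteq> {\<one>\<^bsub>G\<^esub>}" by blast
    have "\<exists>p\<in>set (closure_levels M D). clo s = gen (snd p)"
    proof (cases "closure_levels M D")
      case Nil
      then have "clo s \<subseteq> {\<one>\<^bsub>G\<^esub>}"
        using partition_covered by (intro clo_least[OF trivial_normal]) (simp add: covers_def)
      then show ?thesis using s(3) subgroup.one_closed[OF normal_imp_subgroup[OF clo_normal]] by blast
    next
      case (Cons p ps)
      then show ?thesis using clo_cases[OF s(1), of p] s(3) by simp
    qed
    then show "H \<in> (\<lambda>p. gen (snd p)) ` set (closure_levels M D)" using s(2) by blast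
  qed
  show "(\<lambda>p. gen (snd p)) ` set (closure_levels M D) \<subseteq> {H \<in> clo ` vecs d. H \<noteq> {\<one>\<^bsub>G\<^esub>}}"
  proof
    fix H assume "H \<in> (\<lambda>p. gen (snd p)) ` set (closure_levels M D)"
    then obtain p where p: "p \<in> set (closure_levels M D)" "H = gen (snd p)" by blast
    let ?L = "level_min (replicate d 0) (closure_levels M D) (fst p)"
    have "?L \<in> level_set d clo (gen (snd p))" using level_eq[OF p(1)] by auto
    then show "H \<in> {H \<in> clo ` vecs d. H \<noteq> {\<one>\<^bsub>G\<^esub>}}"
      using closure_levels_nontrivial[OF p(1)] p(2) by (auto simp: level_set_def)
  qed
qed

lemma has_maxima_iff: "has_maxima G d clo \<longleftrightarrow> (\<forall>p\<in>set (closure_levels M D). length (fst p) = d)"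
proof -
  have "has_maxima G d clo \<longleftrightarrow> (\<forall>H\<in>{H \<in> clo ` vecs d. H \<noteq> {\<one>\<^bsub>G\<^esub>}}. \<exists>m. is_max (level_set d clo H) m)"
    by (auto simp: has_maxima_def)
  also have "\<dots> \<longleftrightarrow> (\<forall>p\<in>set (closure_levels M D). \<exists>m. is_max (level_set d clo (gen (snd p))) m)"
    unfolding image_clo by blast
  also have "\<dots> \<longleftrightarrow> (\<forall>p\<in>set (closure_levels M D). length (fst p) = d)"
    using is_max_level by blast
  finally show ?thesis .
qed

lemma zero_vec: "closure_levels M D \<noteq> [] \<Longrightarrow> zero_vec D = replicate d 0"
proof (cases D)
  case Nil
  then show "closure_levels M D \<noteq> [] \<Longrightarrow> ?thesis" by (simp add: closure_levels_def rounds_Nil)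
next
  case (Cons p ps)
  then have "length (fst p) = d" using input[of p] by simp
  then show ?thesis using Cons by (simp add: zero_vec_def map_replicate_const)
qed

lemma stored_levels_correct: "stores G d clo (stored_levels M D (closure_levels M D))"
proof -
  let ?F = "closure_levels M D"
  let ?L = "level_min (zero_vec D) ?F"
  have z: "zero_vec D = replicate d 0" if "p \<in> set ?F" for p
  proof (rule zero_vec)
    show "?F \<noteq> []" using that by auto
  qed
  have len: "(\<forall>p\<in>set ?F. length (fst p) = length (zero_vec D)) \<longleftrightarrow> (\<forall>p\<in>set ?F. length (fst p) = d)"
    by (rule ball_cong[OF refl]) (simp add: z)
  have ok: "\<forall>p\<in>set ?F. ok (snd p)" using sound_ok[OF sound_closure_levels] .
  have img: "H \<in> clo ` vecs d \<and> H \<noteq> {\<one>\<^bsub>G\<^esub>} \<longleftrightarrow> (\<exists>p\<in>set ?F. H = gen (snd p))" for H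
  proof -
    have "H \<in> {H \<in> clo ` vecs d. H \<noteq> {\<one>\<^bsub>G\<^esub>}} \<longleftrightarrow> H \<in> (\<lambda>p. gen (snd p)) ` set ?F"
      by (simp only: image_clo)
    then show ?thesis unfolding image_iff mem_Collect_eq .
  qed
  have dist: "distinct (map (\<lambda>p. (f p, gen (snd p))) ?F)" for f :: "_ \<Rightarrow> nat list"
  proof -
    have "distinct (map snd (map (\<lambda>p. (f p, gen (snd p))) ?F))"
      using closure_levels_distinct by (simp add: o_def)
    then show ?thesis by (rule conjunct1[OF distinct_map[THEN iffD1]])
  qed
  have set_pairs: "set (map (\<lambda>p. (f p, gen (snd p))) ?F) =
      {(m, H). H \<in> clo ` vecs d \<and> H \<noteq> {\<one>\<^bsub>G\<^esub>} \<and> Q H m}"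
    if Q: "\<And>p m. p \<in> set ?F \<Longrightarrow> Q (gen (snd p)) m \<longleftrightarrow> m = f p" for f :: "_ \<Rightarrow> nat list" and Q
  proof (rule Set.set_eqI)
    fix x :: "nat list \<times> 'g set"
    obtain m H where x: "x = (m, H)" by (cases x)
    have "x \<in> set (map (\<lambda>p. (f p, gen (snd p))) ?F) \<longleftrightarrow> (\<exists>p\<in>set ?F. m = f p \<and> H = gen (snd p))"
      unfolding x set_map image_iff by simp
    also have "\<dots> \<longleftrightarrow> (\<exists>p\<in>set ?F. H = gen (snd p) \<and> Q H m)" using Q by blast
    also have "\<dots> \<longleftrightarrow> x \<in> {(m, H). H \<in> clo ` vecs d \<and> H \<noteq> {\<one>\<^bsub>G\<^esub>} \<and> Q H m}"
      unfolding x mem_Collect_eq prod.case using img[of H] by (meson)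
    finally show "x \<in> set (map (\<lambda>p. (f p, gen (snd p))) ?F) \<longleftrightarrow>
      x \<in> {(m, H). H \<in> clo ` vecs d \<and> H \<noteq> {\<one>\<^bsub>G\<^esub>} \<and> Q H m}" .
  qed
  show ?thesis
  proof (cases "\<forall>p\<in>set ?F. length (fst p) = d")
    case True
    have e: "stored_levels M D ?F = (1, ?F)" using True len by (simp add: stored_levels_def)
    have m: "map (\<lambda>(m, S). (m, generate G (set S))) ?F = map (\<lambda>p. (fst p, gen (snd p))) ?F"
      by (simp add: case_prod_beta)
    have s: "set (map (\<lambda>p. (fst p, gen (snd p))) ?F) =
      {(m, H). H \<in> clo ` vecs d \<and> H \<noteq> {\<one>\<^bsub>G\<^esub>} \<and> is_max (level_set d clo H) m}"
      by (rule set_pairs) (use is_max_level True in blast)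
    show ?thesis unfolding stores_def e Let_def fst_conv snd_conv m
    proof (intro conjI)
      show "(1::int) = (if has_maxima G d clo then 1 else - 1)" using True has_maxima_iff by simp
      show "\<forall>(m, S)\<in>set ?F. set S \<subseteq> carrier G" using ok by (simp add: case_prod_beta)
      show "distinct (map (\<lambda>p. (fst p, gen (snd p))) ?F)" by (rule dist)
    qed (unfold s, simp)
  next
    case False
    have e: "stored_levels M D ?F = (-1, map (\<lambda>p. (?L (fst p), snd p)) ?F)"
      unfolding stored_levels_def len using False by simp
    have m: "map (\<lambda>(m, S). (m, generate G (set S))) (map (\<lambda>p. (?L (fst p), snd p)) ?F) =
        map (\<lambda>p. (?L (fst p), gen (snd p))) ?F"
      by simp
    have s: "set (map (\<lambda>p. (?L (fst p), gen (snd p))) ?F) =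
      {(m, H). H \<in> clo ` vecs d \<and> H \<noteq> {\<one>\<^bsub>G\<^esub>} \<and> is_min (level_set d clo H) m}"
      by (rule set_pairs) (simp add: is_min_level z)
    show ?thesis unfolding stores_def e Let_def fst_conv snd_conv m
    proof (intro conjI)
      show "(-1::int) = (if has_maxima G d clo then 1 else - 1)" using False has_maxima_iff by simp
      show "\<forall>(m, S)\<in>set (map (\<lambda>p. (?L (fst p), snd p)) ?F). set S \<subseteq> carrier G" using ok by simp
      show "distinct (map (\<lambda>p. (?L (fst p), gen (snd p))) ?F)" by (rule dist)
    qed (unfold s, simp)
  qed
qed

end

section \<open>Total correctness with a time bound\<close>

text \<open>
  Weakest preconditions for the time-bounded semantics. All step counts below are rough upper
  bounds.
\<close>

definition reaches :: "'g group_model \<Rightarrow> prog \<Rightarrow> 'g regs \<Rightarrow> nat \<Rightarrow> ('g regs \<Rightarrow> bool) \<Rightarrow> bool" where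
  "reaches M c r T Q \<longleftrightarrow> (\<exists>t r'. exec M c r t r' \<and> t \<le> T \<and> Q r')"

lemma reaches_Assign: "1 + eval_time M a r \<le> T \<Longrightarrow> Q (r(i := eval M a r)) \<Longrightarrow> reaches M (Assign i a) r T Q"
  unfolding reaches_def by (blast intro: exec.Assign)

lemma reaches_Seq:
  assumes "reaches M c1 r T1 Q1" "\<And>r'. Q1 r' \<Longrightarrow> reaches M c2 r' T2 Q" "T1 + T2 \<le> T"
  shows "reaches M (Seq c1 c2) r T Q"
proof -
  obtain t1 r1 where 1: "exec M c1 r t1 r1" "t1 \<le> T1" "Q1 r1" using assms(1) unfolding reaches_def by blast
  obtain t2 r2 where 2: "exec M c2 r1 t2 r2" "t2 \<le> T2" "Q r2" using assms(2)[OF 1(3)] unfolding reaches_def by blast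
  have "exec M (Seq c1 c2) r (t1 + t2) r2" by (rule exec.Seq[OF 1(1) 2(1)])
  moreover have "t1 + t2 \<le> T" using 1(2) 2(2) assms(3) by linarith
  ultimately show ?thesis using 2(3) unfolding reaches_def by blast
qed

lemma reaches_Seq_Assign:
  assumes "reaches M c (r(i := eval M a r)) T' Q" "1 + eval_time M a r + T' \<le> T"
  shows "reaches M (Seq (Assign i a) c) r T Q"
  by (rule reaches_Seq[OF reaches_Assign[OF order_refl, where Q = "\<lambda>r'. r' = r(i := eval M a r)"]])
    (use assms in simp_all)

lemma reaches_Cond:
  assumes "eval M b r \<noteq> VNil \<Longrightarrow> reaches M c1 r T1 Q" "eval M b r = VNil \<Longrightarrow> reaches M c2 r T1 Q"
    "1 + eval_time M b r + T1 \<le> T"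
  shows "reaches M (Cond b c1 c2) r T Q"
proof (cases "eval M b r = VNil")
  case True
  then obtain t r' where 1: "exec M c2 r t r'" "t \<le> T1" "Q r'" using assms(2) unfolding reaches_def by blast
  have "exec M (Cond b c1 c2) r (1 + eval_time M b r + t) r'" by (rule exec.Cond_False[OF True 1(1)])
  moreover have "1 + eval_time M b r + t \<le> T" using 1(2) assms(3) by linarith
  ultimately show ?thesis using 1(3) unfolding reaches_def by blast
next
  case False
  then obtain t r' where 1: "exec M c1 r t r'" "t \<le> T1" "Q r'" using assms(1) unfolding reaches_def by blast
  have "exec M (Cond b c1 c2) r (1 + eval_time M b r + t) r'" by (rule exec.Cond_True[OF False 1(1)])
  moreover have "1 + eval_time M b r + t \<le> T" using 1(2) assms(3) by linarith
  ultimately show ?thesis using 1(3) unfolding reaches_def by blast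
qed

lemma reaches_While_False:
  assumes "eval M b r = VNil" "1 + eval_time M b r \<le> T" "Q r"
  shows "reaches M (While b c) r T Q"
  using assms exec.While_False[OF assms(1)] unfolding reaches_def by blast

lemma reaches_While_True:
  assumes "eval M b r \<noteq> VNil" "reaches M c r T1 Q1" "\<And>r'. Q1 r' \<Longrightarrow> reaches M (While b c) r' T2 Q"
    "1 + eval_time M b r + T1 + T2 \<le> T"
  shows "reaches M (While b c) r T Q"
proof -
  obtain t1 r1 where 1: "exec M c r t1 r1" "t1 \<le> T1" "Q1 r1" using assms(2) unfolding reaches_def by blast
  obtain t2 r2 where 2: "exec M (While b c) r1 t2 r2" "t2 \<le> T2" "Q r2" using assms(3)[OF 1(3)] unfolding reaches_def by blast
  have "exec M (While b c) r (1 + eval_time M b r + t1 + t2) r2"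
    by (rule exec.While_True[OF assms(1) 1(1) 2(1)])
  moreover have "1 + eval_time M b r + t1 + t2 \<le> T" using 1(2) 2(2) assms(4) by linarith
  ultimately show ?thesis using 2(3) unfolding reaches_def by blast
qed

lemma reaches_weaken:
  assumes "reaches M c r T Q" "\<And>r'. Q r' \<Longrightarrow> Q' r'" "T \<le> T'"
  shows "reaches M c r T' Q'"
  using assms unfolding reaches_def by (meson order_trans)

lemma poly_nat_mono: "m \<le> n \<Longrightarrow> poly p m \<le> poly p n" for p :: "nat poly"
  by (induction p) (auto intro!: add_mono mult_mono)

section \<open>Polynomial-time functions on encoded data\<close>

fun val_size :: "'g val \<Rightarrow> nat" where
  "val_size (VPair v w) = 1 + val_size v + val_size w"
| "val_size _ = 1"

text \<open>
  The model promises nothing about codes outside the carrier, so polynomial time is only required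
  on values all of whose group elements belong to it.
\<close>

fun in_carrier :: "'g group_model \<Rightarrow> 'g val \<Rightarrow> bool" where
  "in_carrier M (VPair v w) = (in_carrier M v \<and> in_carrier M w)"
| "in_carrier M (VElem x) = (x \<in> carrier (grp M))"
| "in_carrier M _ = True"

definition enc_nat :: "nat \<Rightarrow> 'g val" where "enc_nat k = VInt (int k)"
definition enc_unit :: "unit \<Rightarrow> 'g val" where "enc_unit u = VNil"
definition enc_pair :: "('a \<Rightarrow> 'g val) \<Rightarrow> ('b \<Rightarrow> 'g val) \<Rightarrow> 'a \<times> 'b \<Rightarrow> 'g val" where
  "enc_pair ea eb p = VPair (ea (fst p)) (eb (snd p))"
definition enc_list :: "('a \<Rightarrow> 'g val) \<Rightarrow> 'a list \<Rightarrow> 'g val" where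
  "enc_list ea xs = list_val (map ea xs)"

abbreviation input_size :: "'g group_model \<Rightarrow> 'g val \<Rightarrow> nat" where
  "input_size M v \<equiv> elem_len M + val_size v"

text \<open>
  Argument and result are passed in register \<open>0\<close>. The program may destroy the registers below \<open>n\<close>
  but no others, which lets several programs be combined: the registers from \<open>n\<close> on can save values
  during a call. Running time and size of the result are bounded together, as needed for composition.
\<close>

definition polytime_within :: "nat poly \<Rightarrow> nat poly \<Rightarrow> prog \<Rightarrow> nat \<Rightarrow> ('a \<Rightarrow> 'g val) \<Rightarrow> ('b \<Rightarrow> 'g val) \<Rightarrow>
    ('g group_model \<Rightarrow> 'a \<Rightarrow> 'b) \<Rightarrow> bool" where
  "polytime_within q p c n ea eb f \<longleftrightarrow> (\<forall>M x. efficient_model q M \<longrightarrow> in_carrier M (ea x) \<longrightarrow>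
     in_carrier M (eb (f M x)) \<and> val_size (eb (f M x)) \<le> poly p (input_size M (ea x)) \<and>
     (\<forall>r. r 0 = ea x \<longrightarrow> reaches M c r (poly p (input_size M (ea x)))
        (\<lambda>r'. r' 0 = eb (f M x) \<and> (\<forall>i\<ge>n. r' i = r i))))"

text \<open>
  One program has to serve all models; only the bound may depend on \<open>q\<close>.
\<close>

definition polytime :: "('a \<Rightarrow> 'g val) \<Rightarrow> ('b \<Rightarrow> 'g val) \<Rightarrow>
    ('g group_model \<Rightarrow> 'a \<Rightarrow> 'b) \<Rightarrow> bool" where
  "polytime ea eb f \<longleftrightarrow> (\<exists>c n. \<forall>q. \<exists>p. polytime_within q p c n ea eb f)"

lemma polytime_withinI:
  assumes "\<And>M x. efficient_model q M \<Longrightarrow> in_carrier M (ea x) \<Longrightarrow> in_carrier M (eb (f M x))"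
    "\<And>M x. efficient_model q M \<Longrightarrow> in_carrier M (ea x) \<Longrightarrow> val_size (eb (f M x)) \<le> poly p (input_size M (ea x))"
    "\<And>M x r. efficient_model q M \<Longrightarrow> in_carrier M (ea x) \<Longrightarrow> r 0 = ea x \<Longrightarrow>
       reaches M c r (poly p (input_size M (ea x))) (\<lambda>r'. r' 0 = eb (f M x) \<and> (\<forall>i\<ge>n. r' i = r i))"
  shows "polytime_within q p c n ea eb f"
  using assms unfolding polytime_within_def by auto

lemma polytime_withinD:
  assumes "polytime_within q p c n ea eb f" "efficient_model q M" "in_carrier M (ea x)"
  shows "in_carrier M (eb (f M x))" "val_size (eb (f M x)) \<le> poly p (input_size M (ea x))"
    "r 0 = ea x \<Longrightarrow>
       reaches M c r (poly p (input_size M (ea x))) (\<lambda>r'. r' 0 = eb (f M x) \<and> (\<forall>i\<ge>n. r' i = r i))"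
  using assms unfolding polytime_within_def by auto

lemma polytimeI:
  assumes "\<And>q. \<exists>p. polytime_within q p c n ea eb f"
  shows "polytime ea eb f"
  using assms unfolding polytime_def by blast

lemma polytimeE:
  assumes "polytime ea eb f"
  obtains c n where "\<forall>q. \<exists>p. polytime_within q p c n ea eb f"
  using assms unfolding polytime_def by blast

definition poly_bounded :: "('a \<Rightarrow> 'g val) \<Rightarrow> ('g group_model \<Rightarrow> 'a \<Rightarrow> nat) \<Rightarrow> bool" where
  "poly_bounded ea B \<longleftrightarrow> (\<forall>q. \<exists>p. \<forall>M x. efficient_model q M \<longrightarrow> in_carrier M (ea x) \<longrightarrow>
     B M x \<le> poly p (input_size M (ea x)))"

lemma poly_bounded_const: "poly_bounded ea (\<lambda>M x. k)"
  unfolding poly_bounded_def by (auto intro: exI[of _ "[:k:]"])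

lemma poly_bounded_input_size: "poly_bounded ea (\<lambda>M x. input_size M (ea x))"
  unfolding poly_bounded_def by (auto intro: exI[of _ "[:0, 1:]"])

lemma poly_bounded_add:
  assumes "poly_bounded ea B" "poly_bounded ea C" shows "poly_bounded ea (\<lambda>M x. B M x + C M x)"
  unfolding poly_bounded_def
proof
  fix q
  obtain p1 p2 where "\<forall>M x. efficient_model q M \<longrightarrow> in_carrier M (ea x) \<longrightarrow> B M x \<le> poly p1 (input_size M (ea x))"
    "\<forall>M x. efficient_model q M \<longrightarrow> in_carrier M (ea x) \<longrightarrow> C M x \<le> poly p2 (input_size M (ea x))"
    using assms unfolding poly_bounded_def by meson
  then show "\<exists>p. \<forall>M x. efficient_model q M \<longrightarrow> in_carrier M (ea x) \<longrightarrow> B M x + C M x \<le> poly p (input_size M (ea x))"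
    by (intro exI[of _ "p1 + p2"]) (simp add: add_mono)
qed

lemma poly_bounded_mult:
  assumes "poly_bounded ea B" "poly_bounded ea C" shows "poly_bounded ea (\<lambda>M x. B M x * C M x)"
  unfolding poly_bounded_def
proof
  fix q
  obtain p1 p2 where "\<forall>M x. efficient_model q M \<longrightarrow> in_carrier M (ea x) \<longrightarrow> B M x \<le> poly p1 (input_size M (ea x))"
    "\<forall>M x. efficient_model q M \<longrightarrow> in_carrier M (ea x) \<longrightarrow> C M x \<le> poly p2 (input_size M (ea x))"
    using assms unfolding poly_bounded_def by meson
  then show "\<exists>p. \<forall>M x. efficient_model q M \<longrightarrow> in_carrier M (ea x) \<longrightarrow> B M x * C M x \<le> poly p (input_size M (ea x))"
    by (intro exI[of _ "p1 * p2"]) (simp add: mult_mono)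
qed

lemmas poly_bounded_intros = poly_bounded_const poly_bounded_input_size poly_bounded_add poly_bounded_mult

lemma polytime_size:
  assumes "polytime ea eb f"
  shows "poly_bounded ea (\<lambda>M x. val_size (eb (f M x)))"
proof -
  obtain c n where "\<forall>q. \<exists>p. polytime_within q p c n ea eb f" using polytimeE[OF assms] .
  then show ?thesis unfolding poly_bounded_def polytime_within_def by meson
qed

lemma polytime_in_carrier:
  assumes "polytime ea eb f" "efficient_model q M" "in_carrier M (ea x)"
  shows "in_carrier M (eb (f M x))"
proof -
  obtain c n where "\<forall>q. \<exists>p. polytime_within q p c n ea eb f" using polytimeE[OF assms(1)] .
  then obtain p where "polytime_within q p c n ea eb f" by blast
  from polytime_withinD(1)[OF this assms(2,3)] show ?thesis .
qed

lemma polytime_expr: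
  assumes "\<And>q M x. efficient_model q M \<Longrightarrow> in_carrier M (ea x) \<Longrightarrow> in_carrier M (eb (f M x))"
    and "\<And>q. \<exists>p. \<forall>M x. efficient_model q M \<longrightarrow> in_carrier M (ea x) \<longrightarrow> val_size (eb (f M x)) \<le> poly p (input_size M (ea x))"
    and "\<And>q. \<exists>p. \<forall>M x r. efficient_model q M \<longrightarrow> in_carrier M (ea x) \<longrightarrow> r 0 = ea x \<longrightarrow>
           eval_time M a r \<le> poly p (input_size M (ea x))"
    and "\<And>q M x r. efficient_model q M \<Longrightarrow> in_carrier M (ea x) \<Longrightarrow> r 0 = ea x \<Longrightarrow> eval M a r = eb (f M x)"
  shows "polytime ea eb f"
proof (rule polytimeI[where c = "Assign 0 a" and n = 1])
  fix q
  obtain p1 p2 where p: "\<forall>M x. efficient_model q M \<longrightarrow> in_carrier M (ea x) \<longrightarrow> val_size (eb (f M x)) \<le> poly p1 (input_size M (ea x))"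
     "\<forall>M x r. efficient_model q M \<longrightarrow> in_carrier M (ea x) \<longrightarrow> r 0 = ea x \<longrightarrow>
           eval_time M a r \<le> poly p2 (input_size M (ea x))" using assms(2,3) by meson
  have "polytime_within q (p1 + p2 + 1) (Assign 0 a) 1 ea eb f"
    by (rule polytime_withinI)
      (use p assms(1,4) in \<open>auto intro!: reaches_Assign simp: trans_le_add1 trans_le_add2 le_SucI\<close>)
  then show "\<exists>p. polytime_within q p (Assign 0 a) 1 ea eb f" by blast
qed

text \<open>
  The second function runs on an argument of polynomial size, so its bound is composed with the size
  bound of the first.
\<close>

lemma polytime_comp:
  assumes "polytime ea eb f" "polytime eb ec g"
  shows "polytime ea ec (\<lambda>M x. g M (f M x))"
proof -
  obtain c1 n1 where f: "\<forall>q. \<exists>p. polytime_within q p c1 n1 ea eb f" using polytimeE[OF assms(1)] .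
  obtain c2 n2 where g: "\<forall>q. \<exists>p. polytime_within q p c2 n2 eb ec g" using polytimeE[OF assms(2)] .
  show ?thesis
  proof (rule polytimeI[where c = "Seq c1 c2" and n = "max n1 n2"])
    fix q
    obtain p1 where p1: "polytime_within q p1 c1 n1 ea eb f" using f by blast
    note p1 = polytime_withinD[OF p1]
    obtain p2 where p2: "polytime_within q p2 c2 n2 eb ec g" using g by blast
    note p2 = polytime_withinD[OF p2]
    define p where "p = p1 + pcompose p2 ([:0, 1:] + p1)"
    have "in_carrier M (ec (g M (f M x))) \<and> val_size (ec (g M (f M x))) \<le> poly p (input_size M (ea x)) \<and>
     (\<forall>r. r 0 = ea x \<longrightarrow> reaches M (Seq c1 c2) r (poly p (input_size M (ea x)))
        (\<lambda>r'. r' 0 = ec (g M (f M x)) \<and> (\<forall>i\<ge>max n1 n2. r' i = r i)))"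
      if M: "efficient_model q M" and x: "in_carrier M (ea x)" for M x
    proof -
      let ?N = "input_size M (ea x)"
      have le: "poly p2 (input_size M (eb (f M x))) \<le> poly p2 (?N + poly p1 ?N)"
        using p1(2)[OF M x] by (intro poly_nat_mono) auto
      have pN: "poly p ?N = poly p1 ?N + poly p2 (?N + poly p1 ?N)"
        by (simp add: p_def poly_pcompose)
      have "reaches M (Seq c1 c2) r (poly p ?N)
        (\<lambda>r'. r' 0 = ec (g M (f M x)) \<and> (\<forall>i\<ge>max n1 n2. r' i = r i))" if r: "r 0 = ea x" for r
        apply (rule reaches_Seq[OF p1(3)[where r = r, OF M x r], where ?T2.0 = "poly p2 (input_size M (eb (f M x)))"])
        subgoal for r'
          by (rule reaches_weaken[OF p2(3)[OF M p1(1)[OF M x]]]) auto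
        using le pN by auto
      then show ?thesis using p1(1)[OF M x] p2(1)[OF M p1(1)[OF M x]] p2(2)[OF M p1(1)[OF M x]] le pN
        by auto
    qed
    then have "polytime_within q p (Seq c1 c2) (max n1 n2) ea ec (\<lambda>M x. g M (f M x))"
      unfolding polytime_within_def by (simp add: enc_pair_def)
    then show "\<exists>p. polytime_within q p (Seq c1 c2) (max n1 n2) ea ec (\<lambda>M x. g M (f M x))" by blast
  qed
qed

text \<open>
  The argument is saved in register \<open>n\<close> and the first result in \<open>Suc n\<close>.
\<close>

lemma polytime_pair:
  assumes "polytime ea eb f" "polytime ea ec g"
  shows "polytime ea (enc_pair eb ec) (\<lambda>M x. (f M x, g M x))"
proof -
  obtain c1 n1 where f: "\<forall>q. \<exists>p. polytime_within q p c1 n1 ea eb f" using polytimeE[OF assms(1)] .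
  obtain c2 n2 where g: "\<forall>q. \<exists>p. polytime_within q p c2 n2 ea ec g" using polytimeE[OF assms(2)] .
  define n where "n = Suc (max n1 n2)"
  define c where "c = Seq (Assign n (Reg 0)) (Seq c1 (Seq (Assign (Suc n) (Reg 0))
    (Seq (Assign 0 (Reg n)) (Seq c2 (Assign 0 (PairE (Reg (Suc n)) (Reg 0)))))))"
  show ?thesis
  proof (rule polytimeI[where c = c and n = "Suc (Suc n)"])
    fix q
    obtain p1 where p1: "polytime_within q p1 c1 n1 ea eb f" using f by blast
    note p1 = polytime_withinD[OF p1]
    obtain p2 where p2: "polytime_within q p2 c2 n2 ea ec g" using g by blast
    note p2 = polytime_withinD[OF p2]
    define p where "p = p1 + p2 + [:20:]"
    have "in_carrier M (enc_pair eb ec (f M x, g M x)) \<and> val_size (enc_pair eb ec (f M x, g M x)) \<le> poly p (input_size M (ea x)) \<and>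
     (\<forall>r. r 0 = ea x \<longrightarrow> reaches M c r (poly p (input_size M (ea x)))
        (\<lambda>r'. r' 0 = enc_pair eb ec (f M x, g M x) \<and> (\<forall>i\<ge>Suc (Suc n). r' i = r i)))"
      if M: "efficient_model q M" and x: "in_carrier M (ea x)" for M x
    proof -
      let ?N = "input_size M (ea x)"
      have "reaches M c r (poly p ?N)
        (\<lambda>r'. r' 0 = enc_pair eb ec (f M x, g M x) \<and> (\<forall>i\<ge>Suc (Suc n). r' i = r i))" if r: "r 0 = ea x" for r
        unfolding c_def
        apply (rule reaches_Seq_Assign[where T' = "poly p1 ?N + poly p2 ?N + 15"])
         apply (rule reaches_Seq[where ?T1.0 = "poly p1 ?N" and ?T2.0 = "poly p2 ?N + 15", OF p1(3)[OF M x]])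
        subgoal using r by (simp add: n_def)
        subgoal for r1
          apply (rule reaches_Seq_Assign[where T' = "poly p2 ?N + 13"])
           apply (rule reaches_Seq_Assign[where T' = "poly p2 ?N + 10"])
            apply (rule reaches_Seq[where ?T1.0 = "poly p2 ?N" and ?T2.0 = 10, OF p2(3)[OF M x]])
          subgoal using r by (simp add: n_def)
          subgoal by (rule reaches_Assign) (auto simp: n_def enc_pair_def)
          by simp_all
        by (simp_all add: p_def)
      then show ?thesis using p1(1,2)[OF M x] p2(1,2)[OF M x] by (auto simp: enc_pair_def p_def)
    qed
    then have "polytime_within q p c (Suc (Suc n)) ea (enc_pair eb ec) (\<lambda>M x. (f M x, g M x))"
      unfolding polytime_within_def by (simp add: enc_pair_def)
    then show "\<exists>p. polytime_within q p c (Suc (Suc n)) ea (enc_pair eb ec) (\<lambda>M x. (f M x, g M x))" by blast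
  qed
qed

lemma bool_val_eq_VNil [simp]: "bool_val b = VNil \<longleftrightarrow> \<not> b"
  by (simp add: bool_val_def)

text \<open>
  The value in register \<open>0\<close> is tested and then rearranged into the argument of one of the two
  functions by an expression.
\<close>

lemma polytime_branch:
  fixes ea :: "'a \<Rightarrow> 'g val" and e1 :: "'b \<Rightarrow> 'g val" and e2 :: "'c \<Rightarrow> 'g val"
  assumes f: "polytime e1 ed f" and g: "polytime e2 ed g"
    and yes: "\<And>M x r. P x \<Longrightarrow> r 0 = ea x \<Longrightarrow> eval M b r \<noteq> VNil \<and> eval M a1 r = e1 (h1 x)"
    and no: "\<And>M x r. \<not> P x \<Longrightarrow> r 0 = ea x \<Longrightarrow> eval M b r = VNil \<and> eval M a2 r = e2 (h2 x)"
    and sub1: "\<And>M x. P x \<Longrightarrow> in_carrier M (ea x) \<Longrightarrow> in_carrier M (e1 (h1 x)) \<and> val_size (e1 (h1 x)) \<le> val_size (ea x)"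
    and sub2: "\<And>M x. \<not> P x \<Longrightarrow> in_carrier M (ea x) \<Longrightarrow> in_carrier M (e2 (h2 x)) \<and> val_size (e2 (h2 x)) \<le> val_size (ea x)"
    and time: "\<And>(M :: 'g group_model) r. eval_time M b r + eval_time M a1 r + eval_time M a2 r \<le> k"
  shows "polytime ea ed (\<lambda>M x. if P x then f M (h1 x) else g M (h2 x))"
proof -
  obtain c1 n1 where 1: "\<forall>q. \<exists>p. polytime_within q p c1 n1 e1 ed f" using polytimeE[OF f] .
  obtain c2 n2 where 2: "\<forall>q. \<exists>p. polytime_within q p c2 n2 e2 ed g" using polytimeE[OF g] .
  define n where "n = Suc (max n1 n2)"
  define c where "c = Cond b (Seq (Assign 0 a1) c1) (Seq (Assign 0 a2) c2)"
  show ?thesis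
  proof (rule polytimeI[where c = c and n = n])
    fix q
    obtain p1 p2 where "polytime_within q p1 c1 n1 e1 ed f" "polytime_within q p2 c2 n2 e2 ed g"
      using 1 2 by blast
    note p1 = polytime_withinD[OF this(1)] and p2 = polytime_withinD[OF this(2)]
    define p where "p = p1 + p2 + [:k + 2:]"
    have "polytime_within q p c n ea ed (\<lambda>M x. if P x then f M (h1 x) else g M (h2 x))"
    proof (rule polytime_withinI)
      fix M x r assume M: "efficient_model q M" and x: "in_carrier M (ea x)"
      let ?N = "input_size M (ea x)" and ?h = "if P x then f M (h1 x) else g M (h2 x)"
      have "in_carrier M (ed ?h) \<and> val_size (ed ?h) \<le> poly p ?N \<and> (r 0 = ea x \<longrightarrow>
        reaches M c r (poly p ?N) (\<lambda>r'. r' 0 = ed ?h \<and> (\<forall>i\<ge>n. r' i = r i)))"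
      proof (cases "P x")
        case True
        note s = sub1[OF True x]
        note D = p1[OF M conjunct1[OF s]]
        have le: "poly p1 (input_size M (e1 (h1 x))) + k + 2 \<le> poly p ?N"
          using poly_nat_mono[of "input_size M (e1 (h1 x))" ?N p1] s by (simp add: p_def)
        have "reaches M c r (poly p ?N) (\<lambda>r'. r' 0 = ed (f M (h1 x)) \<and> (\<forall>i\<ge>n. r' i = r i))" if r: "r 0 = ea x"
          unfolding c_def
          apply (rule reaches_Cond[where ?T1.0 = "poly p ?N - (1 + eval_time M b r)"])
          subgoal
            by (rule reaches_Seq_Assign[OF reaches_weaken[OF D(3)]])
              (use yes[where r = r, OF True r] le time[of M r] in \<open>auto simp: n_def\<close>)
          using yes[where r = r, OF True r] le time[of M r] by auto
        then show ?thesis using True D(1,2) le by auto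
      next
        case False
        note s = sub2[OF False x]
        note D = p2[OF M conjunct1[OF s]]
        have le: "poly p2 (input_size M (e2 (h2 x))) + k + 2 \<le> poly p ?N"
          using poly_nat_mono[of "input_size M (e2 (h2 x))" ?N p2] s by (simp add: p_def)
        have "reaches M c r (poly p ?N) (\<lambda>r'. r' 0 = ed (g M (h2 x)) \<and> (\<forall>i\<ge>n. r' i = r i))" if r: "r 0 = ea x"
          unfolding c_def
          apply (rule reaches_Cond[where ?T1.0 = "poly p ?N - (1 + eval_time M b r)"])
          subgoal using no[where r = r, OF False r] by simp
          subgoal
            by (rule reaches_Seq_Assign[OF reaches_weaken[OF D(3)]])
              (use no[where r = r, OF False r] le time[of M r] in \<open>auto simp: n_def\<close>)
          using le time[of M r] by auto
        then show ?thesis using False D(1,2) le by auto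
      qed
      then show "in_carrier M (ed ?h)" "val_size (ed ?h) \<le> poly p ?N"
        "r 0 = ea x \<Longrightarrow> reaches M c r (poly p ?N) (\<lambda>r'. r' 0 = ed ?h \<and> (\<forall>i\<ge>n. r' i = r i))" by auto
    qed
    then show "\<exists>p. polytime_within q p c n ea ed (\<lambda>M x. if P x then f M (h1 x) else g M (h2 x))" by blast
  qed
qed

lemma polytime_id: "polytime ea ea (\<lambda>M x. x)"
  by (rule polytime_expr[where a = "Reg 0"]) (auto intro: exI[of _ "[:0,1:]"] exI[of _ "1"])

lemma polytime_if:
  assumes "polytime ea bool_val b" "polytime ea eb f" "polytime ea eb g"
  shows "polytime ea eb (\<lambda>M x. if b M x then f M x else g M x)"
proof -
  have "polytime (enc_pair bool_val ea) eb (\<lambda>M y. if fst y then f M (snd y) else g M (snd y))"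
    by (rule polytime_branch[OF assms(2,3), where b = "Fst (Reg 0)" and ?a1.0 = "Snd (Reg 0)" and ?a2.0 = "Snd (Reg 0)" and k = 6])
      (auto simp: enc_pair_def)
  from polytime_comp[OF polytime_pair[OF assms(1) polytime_id] this] show ?thesis unfolding fst_conv snd_conv .
qed

section \<open>Loops over lists\<close>

lemma enc_list_simps [simp]: "enc_list ea [] = VNil" "enc_list ea (x # xs) = VPair (ea x) (enc_list ea xs)"
  by (simp_all add: enc_list_def)

lemma enc_pair_simp [simp]: "enc_pair ea eb (x, y) = VPair (ea x) (eb y)"
  by (simp add: enc_pair_def)

lemma enc_list_eq_VNil [simp]: "enc_list ea xs = VNil \<longleftrightarrow> xs = []"
  by (cases xs) auto

lemma in_carrier_list [simp]: "in_carrier M (enc_list ea xs) \<longleftrightarrow> (\<forall>x\<in>set xs. in_carrier M (ea x))"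
  by (induction xs) auto

lemma in_carrier_pair: "in_carrier M (enc_pair ea eb y) \<longleftrightarrow> in_carrier M (ea (fst y)) \<and> in_carrier M (eb (snd y))"
  by (simp add: enc_pair_def)

lemma val_size_pair: "val_size (enc_pair ea eb y) = Suc (val_size (ea (fst y)) + val_size (eb (snd y)))"
  by (simp add: enc_pair_def)

lemma val_size_list: "val_size (enc_list ea xs) = Suc (\<Sum>x\<leftarrow>xs. Suc (val_size (ea x)))"
  by (induction xs) auto

lemma val_size_append: "Suc (val_size (enc_list ea (xs @ ys))) = val_size (enc_list ea xs) + val_size (enc_list ea ys)"
  by (simp add: val_size_list)

lemma length_less_val_size: "length xs < val_size (enc_list ea xs)"
  by (induction xs) auto

lemma val_size_elem_le: "x \<in> set xs \<Longrightarrow> val_size (ea x) \<le> val_size (enc_list ea xs)"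
  by (induction xs) auto

lemma val_size_list_le:
  assumes "length xs \<le> m" "\<And>x. x \<in> set xs \<Longrightarrow> val_size (ea x) \<le> k"
  shows "val_size (enc_list ea xs) \<le> Suc (m * Suc k)"
proof -
  have "(\<Sum>x\<leftarrow>xs. Suc (val_size (ea x))) \<le> (\<Sum>x\<leftarrow>xs. Suc k)"
    using assms(2) by (intro sum_list_mono) auto
  also have "\<dots> = length xs * Suc k" by (simp add: sum_list_triv)
  also have "\<dots> \<le> m * Suc k" using assms(1) by (rule mult_right_mono) simp
  finally show ?thesis by (simp add: val_size_list)
qed

lemma val_size_pos [simp]: "0 < val_size v" "Suc 0 \<le> val_size v"
  by (cases v; simp)+

text \<open>
  Register \<open>n\<close> holds the unchanging context, \<open>Suc n\<close> the accumulator and \<open>Suc (Suc n)\<close> the rest of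
  the list.
\<close>

lemma reaches_loop:
  fixes es :: "'s \<Rightarrow> 'g val" and eb :: "'b \<Rightarrow> 'g val"
  assumes n: "n2 \<le> n" "0 < n"
    and c: "\<And>ys b zs r. xs = ys @ b # zs \<Longrightarrow>
        r 0 = VPair vx (VPair (es (foldl f s ys)) (eb b)) \<Longrightarrow>
        reaches M c r K (\<lambda>r'. r' 0 = es (f (foldl f s ys) b) \<and> (\<forall>i\<ge>n2. r' i = r i))"
  shows "xs = ys @ zs \<Longrightarrow> r n = vx \<Longrightarrow> r (Suc n) = es (foldl f s ys) \<Longrightarrow> r (Suc (Suc n)) = enc_list eb zs \<Longrightarrow>
    reaches M (While (Reg (Suc (Suc n)))
      (Seq (Assign 0 (PairE (Reg n) (PairE (Reg (Suc n)) (Fst (Reg (Suc (Suc n))))))) (Seq c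
      (Seq (Assign (Suc n) (Reg 0)) (Assign (Suc (Suc n)) (Snd (Reg (Suc (Suc n))))))))) r
      (length zs * (K + 20) + 2)
      (\<lambda>r'. r' (Suc n) = es (foldl f s xs) \<and> (\<forall>i\<ge>n+3. r' i = r i))"
proof (induction zs arbitrary: ys r)
  case Nil
  then show ?case by (auto intro!: reaches_While_False)
next
  case (Cons b zs)
  show ?case
    apply (rule reaches_While_True[where ?T1.0 = "K + 15" and ?T2.0 = "length zs * (K + 20) + 2" and
      ?Q1.0 = "\<lambda>r'. r' n = vx \<and> r' (Suc n) = es (foldl f s (ys @ [b])) \<and> r' (Suc (Suc n)) = enc_list eb zs
         \<and> (\<forall>i\<ge>n+3. r' i = r i)"])
    subgoal using Cons.prems by simp
    subgoal
      apply (rule reaches_Seq_Assign[where T' = "K + 7"])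
       apply (rule reaches_Seq[where ?T1.0 = K and ?T2.0 = 7, OF c[OF Cons.prems(1)]])
      subgoal using Cons.prems n by simp
      subgoal for r1
        apply (rule reaches_Seq_Assign[where T' = 5])
         apply (rule reaches_Assign)
        using Cons.prems n by auto
      by simp_all
    subgoal for r1
      by (rule reaches_weaken[OF Cons.IH[of "ys @ [b]"]]) (use Cons.prems in auto)
    by simp
qed

text \<open>
  Iterating a polynomial-time function may produce results of exponential size. This is excluded by
  a common polynomial bound for the accumulators of all initial segments. The argument \<open>x\<close> itself is
  passed to the iterated function as context.
\<close>

lemma polytime_foldl:
  fixes ea :: "'a \<Rightarrow> 'g val" and es :: "'s \<Rightarrow> 'g val" and eb :: "'b \<Rightarrow> 'g val"
  assumes xs: "polytime ea (enc_list eb) xs" and s: "polytime ea es s"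
    and f: "polytime (enc_pair ea (enc_pair es eb)) es (\<lambda>M y. f M (fst y) (fst (snd y)) (snd (snd y)))"
    and bound: "poly_bounded ea B"
    and size: "\<And>q M x ys zs. efficient_model q M \<Longrightarrow> in_carrier M (ea x) \<Longrightarrow> xs M x = ys @ zs \<Longrightarrow>
        val_size (es (foldl (f M x) (s M x) ys)) \<le> B M x"
  shows "polytime ea es (\<lambda>M x. foldl (\<lambda>a b. f M x a b) (s M x) (xs M x))"
proof -
  obtain c1 n1 where 1: "\<forall>q. \<exists>p. polytime_within q p c1 n1 ea (enc_pair ea (enc_pair es (enc_list eb)))
      (\<lambda>M x. (x, (s M x, xs M x)))"
    using polytimeE[OF polytime_pair[OF polytime_id polytime_pair[OF s xs]]] .
  obtain c2 n2 where 2: "\<forall>q. \<exists>p. polytime_within q p c2 n2 (enc_pair ea (enc_pair es eb)) es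
      (\<lambda>M y. f M (fst y) (fst (snd y)) (snd (snd y)))"
    using polytimeE[OF f] .
  define n where "n = Suc (max n1 n2)"
  define w where "w = While (Reg (Suc (Suc n)))
      (Seq (Assign 0 (PairE (Reg n) (PairE (Reg (Suc n)) (Fst (Reg (Suc (Suc n))))))) (Seq c2
      (Seq (Assign (Suc n) (Reg 0)) (Assign (Suc (Suc n)) (Snd (Reg (Suc (Suc n))))))))"
  define c where "c = Seq c1 (Seq (Assign n (Fst (Reg 0))) (Seq (Assign (Suc n) (Fst (Snd (Reg 0))))
    (Seq (Assign (Suc (Suc n)) (Snd (Snd (Reg 0)))) (Seq w (Assign 0 (Reg (Suc n)))))))"
  show ?thesis
  proof (rule polytimeI[where c = c and n = "n + 3"])
    fix q
    obtain p1 where "polytime_within q p1 c1 n1 ea (enc_pair ea (enc_pair es (enc_list eb))) (\<lambda>M x. (x, (s M x, xs M x)))"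
      using 1 by blast
    note p1 = polytime_withinD[OF this]
    obtain p2 where "polytime_within q p2 c2 n2 (enc_pair ea (enc_pair es eb)) es
      (\<lambda>M y. f M (fst y) (fst (snd y)) (snd (snd y)))"
      using 2 by blast
    note p2 = polytime_withinD[OF this]
    obtain p3 where p3: "\<forall>M x. efficient_model q M \<longrightarrow> in_carrier M (ea x) \<longrightarrow> B M x \<le> poly p3 (input_size M (ea x))"
      using bound unfolding poly_bounded_def by blast
    define k where "k = pcompose p2 ([:2, 1:] + p1 + p3)"
    define p where "p = p1 + p1 * (k + 20) + 30 + p3"
    have "polytime_within q p c (n + 3) ea es (\<lambda>M x. foldl (\<lambda>a b. f M x a b) (s M x) (xs M x))"
    proof (rule polytime_withinI)
      fix M x
      assume M: "efficient_model q M" and x: "in_carrier M (ea x)"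
      let ?N = "input_size M (ea x)"
      have gxs: "in_carrier M (enc_list eb (xs M x))" and gs: "in_carrier M (es (s M x))"
        using polytime_in_carrier[OF xs M x] polytime_in_carrier[OF s M x] by auto
      have g: "in_carrier M (es (foldl (f M x) (s M x) ys))" if "set ys \<subseteq> set (xs M x)" for ys
        using that
      proof (induction ys rule: rev_induct)
        case Nil then show ?case using gs by simp
      next
        case (snoc b ys)
        then have "in_carrier M (enc_pair ea (enc_pair es eb) (x, foldl (f M x) (s M x) ys, b))" using x gxs by auto
        from p2(1)[OF M this] show ?case by simp
      qed
      from g[of "xs M x"] show "in_carrier M (es (foldl (\<lambda>a b. f M x a b) (s M x) (xs M x)))" by simp
      have sz: "val_size (es (foldl (f M x) (s M x) ys)) \<le> poly p3 ?N" if "xs M x = ys @ zs" for ys zs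
        using p3 M x size[OF M x that] by (meson order_trans)
      from sz[of "xs M x" "[]"]
      show "val_size (es (foldl (\<lambda>a b. f M x a b) (s M x) (xs M x))) \<le> poly p ?N"
        by (simp add: p_def)
      have szx: "val_size (enc_list eb (xs M x)) \<le> poly p1 ?N" using p1(2)[OF M x] by simp
      have body: "reaches M c2 r (poly k ?N) (\<lambda>r'. r' 0 = es (f M x (foldl (f M x) (s M x) ys) b)
          \<and> (\<forall>i\<ge>n2. r' i = r i))"
        if eq: "xs M x = ys @ b # zs" and r: "r 0 = VPair (ea x) (VPair (es (foldl (f M x) (s M x) ys)) (eb b))"
        for ys b zs r
      proof -
        let ?y = "(x, foldl (f M x) (s M x) ys, b)"
        have gy: "in_carrier M (enc_pair ea (enc_pair es eb) ?y)" using x gxs g[of ys] eq by auto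
        have ry: "r 0 = enc_pair ea (enc_pair es eb) ?y" using r by simp
        have "val_size (eb b) \<le> poly p1 ?N"
          using val_size_elem_le[of b "xs M x" eb] eq szx by auto
        then have "input_size M (enc_pair ea (enc_pair es eb) ?y) \<le> poly ([:2, 1:] + p1 + p3) ?N"
          using sz[OF eq] by simp
        from poly_nat_mono[OF this, of p2]
        have "poly p2 (input_size M (enc_pair ea (enc_pair es eb) ?y)) \<le> poly k ?N"
          by (simp add: k_def poly_pcompose)
        with p2(3)[where r = r and x = ?y, OF M gy ry] show ?thesis
          by (auto elim: reaches_weaken)
      qed
      have len: "length (xs M x) * (poly k ?N + 20) \<le> poly p1 ?N * (poly k ?N + 20)"
        using length_less_val_size[of "xs M x" eb] szx by (intro mult_right_mono) auto
      show "reaches M c r (poly p ?N)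
          (\<lambda>r'. r' 0 = es (foldl (\<lambda>a b. f M x a b) (s M x) (xs M x)) \<and> (\<forall>i\<ge>n + 3. r' i = r i))"
        if r: "r 0 = ea x" for r
        unfolding c_def
        apply (rule reaches_Seq[where ?T1.0 = "poly p1 ?N" and ?T2.0 = "poly p1 ?N * (poly k ?N + 20) + 30",
            OF p1(3)[where r = r, OF M x r]])
        subgoal for r1
          apply (rule reaches_Seq_Assign[where T' = "poly p1 ?N * (poly k ?N + 20) + 26"])
           apply (rule reaches_Seq_Assign[where T' = "poly p1 ?N * (poly k ?N + 20) + 22"])
            apply (rule reaches_Seq_Assign[where T' = "poly p1 ?N * (poly k ?N + 20) + 18"])
             apply (rule reaches_Seq[where ?T1.0 = "length (xs M x) * (poly k ?N + 20) + 2" and ?T2.0 = "5" and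
               ?Q1.0 = "\<lambda>r'. (\<forall>i\<ge>n + 3. r' i = r i) \<and> r' (Suc n) = es (foldl (f M x) (s M x) (xs M x))"])
          subgoal
            unfolding w_def
            by (rule reaches_weaken[OF reaches_loop[where vx = "ea x" and ys = "[]" and s = "s M x" and f = "f M x"
                and xs = "xs M x" and n = n and ?n2.0 = n2 and es = es and eb = eb and M = M and c = c2
                and K = "poly k ?N", OF _ _ body]])
              (auto simp: n_def)
          subgoal by (rule reaches_Assign) auto
          subgoal using len by linarith
          by simp_all
        by (simp add: p_def)
    qed
    then show "\<exists>p. polytime_within q p c (n + 3) ea es (\<lambda>M x. foldl (\<lambda>a b. f M x a b) (s M x) (xs M x))"
      by blast
  qed
qed

section \<open>Elementary operations and group operations\<close>

lemma polytime_fst_snd: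
  "polytime (enc_pair ea eb) ea (\<lambda>M. fst)" "polytime (enc_pair ea eb) eb (\<lambda>M. snd)"
  subgoal by (rule polytime_expr[where a = "Fst (Reg 0)"])
    (auto simp: enc_pair_def intro: exI[of _ "[:0,1:]"] exI[of _ "2"])
  subgoal by (rule polytime_expr[where a = "Snd (Reg 0)"])
    (auto simp: enc_pair_def intro: exI[of _ "[:0,1:]"] exI[of _ "2"])
  done

lemmas polytime_fst = polytime_comp[OF _ polytime_fst_snd(1)]
lemmas polytime_snd = polytime_comp[OF _ polytime_fst_snd(2)]

lemma polytime_const_nat: "polytime ea enc_nat (\<lambda>M x. k)"
  by (rule polytime_expr[where a = "Const (int k)"])
    (auto simp: enc_nat_def intro: exI[of _ "1"])

lemma polytime_True: "polytime ea bool_val (\<lambda>M x. True)"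
  by (rule polytime_expr[where a = "Const 1"])
    (auto simp: bool_val_def intro: exI[of _ "1"])

lemma polytime_False: "polytime ea bool_val (\<lambda>M x. False)"
  by (rule polytime_expr[where a = "NilE"])
    (auto simp: bool_val_def intro: exI[of _ "1"])

lemma polytime_unit: "polytime ea enc_unit (\<lambda>M x. ())"
  by (rule polytime_expr[where a = "NilE"])
    (auto simp: enc_unit_def intro: exI[of _ "1"])

lemma polytime_Nil: "polytime ea (enc_list eb) (\<lambda>M x. [])"
  by (rule polytime_expr[where a = "NilE"])
    (auto intro: exI[of _ "1"])

lemma polytime_Cons:
  assumes "polytime ea eb f" "polytime ea (enc_list eb) g"
  shows "polytime ea (enc_list eb) (\<lambda>M x. f M x # g M x)"
proof -
  have *: "polytime (enc_pair eb (enc_list eb)) (enc_list eb) (\<lambda>M y. fst y # snd y)"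
    by (rule polytime_expr[where a = "Reg 0"])
      (auto simp: enc_pair_def intro: exI[of _ "[:0,1:]"] exI[of _ "1"])
  show ?thesis using polytime_comp[OF polytime_pair[OF assms] *] unfolding fst_conv snd_conv .
qed

text \<open>
  \<open>Snd\<close> yields \<open>VNil\<close> on the empty list, in accordance with \<open>tl [] = []\<close>.
\<close>

lemma polytime_tl:
  assumes "polytime ea (enc_list eb) f"
  shows "polytime ea (enc_list eb) (\<lambda>M x. tl (f M x))"
proof -
  have *: "polytime (enc_list eb) (enc_list eb) (\<lambda>M. tl)"
  proof (rule polytime_expr[where a = "Snd (Reg 0)"])
    show "\<exists>p. \<forall>M x. efficient_model q M \<longrightarrow> in_carrier M (enc_list eb x) \<longrightarrow>
        val_size (enc_list eb (tl x)) \<le> poly p (input_size M (enc_list eb x))" for q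
    proof (rule exI[of _ "[:0,1:]"], intro allI impI)
      fix M x show "val_size (enc_list eb (tl x)) \<le> poly [:0,1:] (input_size M (enc_list eb x))" by (cases x) auto
    qed
    show "in_carrier M (enc_list eb (tl x))" if "in_carrier M (enc_list eb x)" for M x
      using that by (cases x) auto
    show "eval M (Snd (Reg 0)) r = enc_list eb (tl x)" if "r 0 = enc_list eb x" for M x r
      using that by (cases x) auto
  qed (auto intro: exI[of _ "2"])
  show ?thesis by (rule polytime_comp[OF assms *])
qed

lemma polytime_less:
  assumes "polytime ea enc_nat f" "polytime ea enc_nat g"
  shows "polytime ea bool_val (\<lambda>M x. f M x < g M x)"
proof -
  have *: "polytime (enc_pair enc_nat enc_nat) bool_val (\<lambda>M y. fst y < snd y)"
    by (rule polytime_expr[where a = "Less (Fst (Reg 0)) (Snd (Reg 0))"])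
      (auto simp: enc_pair_def enc_nat_def bool_val_def intro: exI[of _ "1"] exI[of _ "5"])
  show ?thesis using polytime_comp[OF polytime_pair[OF assms] *] unfolding fst_conv snd_conv .
qed

lemma polytime_add:
  assumes "polytime ea enc_nat f" "polytime ea enc_nat g"
  shows "polytime ea enc_nat (\<lambda>M x. f M x + g M x)"
proof -
  have *: "polytime (enc_pair enc_nat enc_nat) enc_nat (\<lambda>M y. fst y + snd y)"
    by (rule polytime_expr[where a = "Add (Fst (Reg 0)) (Snd (Reg 0))"])
      (auto simp: enc_pair_def enc_nat_def intro: exI[of _ "1"] exI[of _ "5"])
  show ?thesis using polytime_comp[OF polytime_pair[OF assms] *] unfolding fst_conv snd_conv .
qed

lemma polytime_not:
  assumes "polytime ea bool_val f"
  shows "polytime ea bool_val (\<lambda>M x. \<not> f M x)"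
  using polytime_if[OF assms polytime_False polytime_True] by (simp only: if_False if_True if_bool_eq_conj simp_thms)

lemma polytime_conj:
  assumes "polytime ea bool_val f" "polytime ea bool_val g"
  shows "polytime ea bool_val (\<lambda>M x. f M x \<and> g M x)"
proof -
  have "(if f M x then g M x else False) = (f M x \<and> g M x)" for M x by simp
  then show ?thesis using polytime_if[OF assms polytime_False] by simp
qed

lemma polytime_disj:
  assumes "polytime ea bool_val f" "polytime ea bool_val g"
  shows "polytime ea bool_val (\<lambda>M x. f M x \<or> g M x)"
proof -
  have "(if f M x then True else g M x) = (f M x \<or> g M x)" for M x by simp
  then show ?thesis using polytime_if[OF assms(1) polytime_True assms(2)] by simp
qed

lemma polytime_eq_nat:
  assumes "polytime ea enc_nat f" "polytime ea enc_nat g"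
  shows "polytime ea bool_val (\<lambda>M x. f M x = g M x)"
proof -
  have "(\<not> f M x < g M x \<and> \<not> g M x < f M x) = (f M x = g M x)" for M x by auto
  then show ?thesis
    using polytime_conj[OF polytime_not[OF polytime_less[OF assms]] polytime_not[OF polytime_less[OF assms(2,1)]]] by simp
qed

lemma val_elems_enc_list [simp]: "val_elems (enc_list VElem xs) = xs"
  by (induction xs) auto

lemma val_size_elem_list: "val_size (enc_list VElem xs) = Suc (2 * length xs)"
  by (induction xs) auto

lemma efficient_op_time:
  assumes "efficient_model q M" "set xs \<subseteq> carrier (grp M)" "length xs \<le> k"
  shows "op_time M f xs \<le> poly q (elem_len M * Suc k)"
proof -
  have "op_time M f xs \<le> poly q (elem_len M * Suc (length xs))"
    using assms(1,2) unfolding efficient_model_def by blast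
  also have "\<dots> \<le> poly q (elem_len M * Suc k)" using assms(3) by (intro poly_nat_mono) simp
  finally show ?thesis .
qed

text \<open>
  In terms of the total input size: the bit length of the arguments of a group operation is at most
  its square.
\<close>

definition op_bound :: "nat poly \<Rightarrow> nat poly" where
  "op_bound q = pcompose q ([:0,1:] * [:0, 1:]) + [:0,1:] + 20"

lemma op_time_le:
  assumes M: "efficient_model q M" and xs: "set xs \<subseteq> carrier (grp M)"
    and N: "elem_len M \<le> N" "Suc (length xs) \<le> N"
  shows "op_time M f xs + 20 \<le> poly (op_bound q) N"
proof -
  have "op_time M f xs \<le> poly q (elem_len M * Suc (length xs))"
    using efficient_op_time[OF M xs order_refl] .
  also have "\<dots> \<le> poly q (N * N)"
    by (intro poly_nat_mono mult_mono N) simp_all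
  finally show ?thesis
    by (simp add: poly_pcompose op_bound_def)
qed

lemma polytime_mult:
  assumes "polytime ea VElem f" "polytime ea VElem g"
  shows "polytime ea VElem (\<lambda>M x. f M x \<otimes>\<^bsub>grp M\<^esub> g M x)"
proof -
  have *: "polytime (enc_pair VElem VElem) VElem (\<lambda>M y. fst y \<otimes>\<^bsub>grp M\<^esub> snd y)"
  proof (rule polytime_expr[where a = "Group_Op Mult (PairE (Fst (Reg 0)) (PairE (Snd (Reg 0)) NilE))"])
    fix q :: "nat poly"
    have "eval_time M (Group_Op Mult (PairE (Fst (Reg 0)) (PairE (Snd (Reg 0)) NilE))) r
      \<le> poly (op_bound q) (input_size M (enc_pair VElem VElem x))"
      if "efficient_model q M" "in_carrier M (enc_pair VElem VElem x)" "r 0 = enc_pair VElem VElem x" for M x r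
      using op_time_le[of q M "[fst x, snd x]" "input_size M (enc_pair VElem VElem x)" Mult] that
      by (simp add: enc_pair_def)
    then show "\<exists>p. \<forall>M x r. efficient_model q M \<longrightarrow> in_carrier M (enc_pair VElem VElem x) \<longrightarrow> r 0 = enc_pair VElem VElem x \<longrightarrow>
           eval_time M (Group_Op Mult (PairE (Fst (Reg 0)) (PairE (Snd (Reg 0)) NilE))) r
             \<le> poly p (input_size M (enc_pair VElem VElem x))" by blast
    show "in_carrier M (VElem (fst x \<otimes>\<^bsub>grp M\<^esub> snd x))" if "efficient_model q M" "in_carrier M (enc_pair VElem VElem x)" for M x
      using efficient_group[OF that(1)] that(2) by (auto simp: enc_pair_def intro: monoid.m_closed group.is_monoid)
  qed (auto simp: enc_pair_def intro: exI[of _ "1"])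
  show ?thesis using polytime_comp[OF polytime_pair[OF assms] *] unfolding fst_conv snd_conv .
qed

lemma polytime_inv:
  assumes "polytime ea VElem f"
  shows "polytime ea VElem (\<lambda>M x. inv\<^bsub>grp M\<^esub> f M x)"
proof -
  have *: "polytime VElem VElem (\<lambda>M y. inv\<^bsub>grp M\<^esub> y)"
  proof (rule polytime_expr[where a = "Group_Op Inverse (PairE (Reg 0) NilE)"])
    fix q :: "nat poly"
    have "eval_time M (Group_Op Inverse (PairE (Reg 0) NilE)) r
      \<le> poly (pcompose (op_bound q) [:1,1:]) (input_size M (VElem x))"
      if "efficient_model q M" "in_carrier M (VElem x)" "r 0 = VElem x" for M x r
      using op_time_le[of q M "[x]" "Suc (input_size M (VElem x))" Inverse] that by (simp add: poly_pcompose)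
    then show "\<exists>p. \<forall>M x r. efficient_model q M \<longrightarrow> in_carrier M (VElem x) \<longrightarrow> r 0 = VElem x \<longrightarrow>
           eval_time M (Group_Op Inverse (PairE (Reg 0) NilE)) r
             \<le> poly p (input_size M (VElem x))" by blast
    show "in_carrier M (VElem (inv\<^bsub>grp M\<^esub> x))" if "efficient_model q M" "in_carrier M (VElem x)" for M x
      using efficient_group[OF that(1)] that(2) by (auto intro: group.inv_closed)
  qed (auto intro: exI[of _ "1"])
  show ?thesis by (rule polytime_comp[OF assms *])
qed

lemma in_carrier_enc_list: "in_carrier M (enc_list VElem xs) \<longleftrightarrow> set xs \<subseteq> carrier (grp M)"
  by auto

lemma polytime_order:
  assumes "polytime ea (enc_list VElem) f"
  shows "polytime ea enc_nat (\<lambda>M x. card (generate (grp M) (set (f M x))))"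
proof -
  have *: "polytime (enc_list VElem) enc_nat (\<lambda>M xs. card (generate (grp M) (set xs)))"
  proof (rule polytime_expr[where a = "Group_Op Order (Reg 0)"])
    fix q :: "nat poly"
    have "eval_time M (Group_Op Order (Reg 0)) r \<le> poly (op_bound q) (input_size M (enc_list VElem x))"
      if "efficient_model q M" "in_carrier M (enc_list VElem x)" "r 0 = enc_list VElem x" for M x r
      using op_time_le[of q M x "input_size M (enc_list VElem x)" Order] that
      by (simp add: val_size_elem_list in_carrier_enc_list del: in_carrier_list)
    then show "\<exists>p. \<forall>M x r. efficient_model q M \<longrightarrow> in_carrier M (enc_list VElem x) \<longrightarrow> r 0 = enc_list VElem x \<longrightarrow>
           eval_time M (Group_Op Order (Reg 0)) r \<le> poly p (input_size M (enc_list VElem x))" by blast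
  qed (auto simp: enc_nat_def intro: exI[of _ "1"])
  show ?thesis by (rule polytime_comp[OF assms *])
qed

lemma polytime_closure_gens:
  assumes "polytime ea (enc_list VElem) f"
  shows "polytime ea (enc_list VElem) (\<lambda>M x. closure_gens M (f M x))"
proof -
  have *: "polytime (enc_list VElem) (enc_list VElem) closure_gens"
  proof (rule polytime_expr[where a = "Group_Op Normal_Closure (Reg 0)"])
    fix q :: "nat poly"
    have "eval_time M (Group_Op Normal_Closure (Reg 0)) r \<le> poly (op_bound q) (input_size M (enc_list VElem x))"
      if "efficient_model q M" "in_carrier M (enc_list VElem x)" "r 0 = enc_list VElem x" for M x r
      using op_time_le[of q M x "input_size M (enc_list VElem x)" Normal_Closure] that
      by (simp add: val_size_elem_list in_carrier_enc_list del: in_carrier_list)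
    then show "\<exists>p. \<forall>M x r. efficient_model q M \<longrightarrow> in_carrier M (enc_list VElem x) \<longrightarrow> r 0 = enc_list VElem x \<longrightarrow>
           eval_time M (Group_Op Normal_Closure (Reg 0)) r \<le> poly p (input_size M (enc_list VElem x))" by blast
    have "val_size (enc_list VElem (closure_gens M x)) \<le> poly (2 * op_bound q) (input_size M (enc_list VElem x))"
      if "efficient_model q M" "in_carrier M (enc_list VElem x)" for M x
    proof -
      have "length (closure_gens M x) \<le> op_time M Normal_Closure x"
        using that unfolding efficient_model_def in_carrier_enc_list by blast
      then show ?thesis
        using op_time_le[of q M x "input_size M (enc_list VElem x)" Normal_Closure] that
        by (simp add: val_size_elem_list in_carrier_enc_list del: in_carrier_list)
    qed
    then show "\<exists>p. \<forall>M x. efficient_model q M \<longrightarrow> in_carrier M (enc_list VElem x) \<longrightarrow>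
        val_size (enc_list VElem (closure_gens M x)) \<le> poly p (input_size M (enc_list VElem x))" by blast
    show "in_carrier M (enc_list VElem (closure_gens M x))" if "efficient_model q M" "in_carrier M (enc_list VElem x)" for M x
      using that unfolding efficient_model_def in_carrier_enc_list by blast
    show "eval M (Group_Op Normal_Closure (Reg 0)) r = enc_list VElem (closure_gens M x)"
      if "r 0 = enc_list VElem x" for M x r
      using that by (simp add: enc_list_def[symmetric])
  qed
  show ?thesis by (rule polytime_comp[OF assms *])
qed

lemmas polytime_intros = polytime_id polytime_fst polytime_snd polytime_pair polytime_True polytime_False
  polytime_unit polytime_Nil polytime_Cons polytime_tl polytime_less polytime_add polytime_not polytime_conj
  polytime_disj polytime_eq_nat polytime_mult polytime_inv polytime_order polytime_closure_gens
  polytime_const_nat polytime_if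

section \<open>List functions\<close>

lemma polytime_rev:
  assumes "polytime ea (enc_list eb) f"
  shows "polytime ea (enc_list eb) (\<lambda>M x. rev (f M x))"
proof -
  have eq: "foldl (\<lambda>a b. b # a) s xs = rev xs @ s" for xs s :: "'c list"
    by (induction xs arbitrary: s) auto
  have "polytime ea (enc_list eb) (\<lambda>M x. foldl (\<lambda>a b. b # a) [] (f M x))"
  proof (rule polytime_foldl[OF assms polytime_Nil _ polytime_size[OF assms], where f = "\<lambda>M x a b. b # a"])
    show "polytime (enc_pair ea (enc_pair (enc_list eb) eb)) (enc_list eb) (\<lambda>M y. snd (snd y) # fst (snd y))"
      by (rule polytime_intros)+
    show "val_size (enc_list eb (foldl (\<lambda>a b. b # a) [] ys)) \<le> val_size (enc_list eb (f M x))"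
      if "f M x = ys @ zs" for M x ys zs
      unfolding that eq val_size_list by (simp add: sum_list_rev rev_map[symmetric])
  qed
  then show ?thesis by (simp add: eq)
qed

lemma polytime_foldr:
  fixes ea :: "'a \<Rightarrow> 'g val" and es :: "'s \<Rightarrow> 'g val" and eb :: "'b \<Rightarrow> 'g val"
  assumes xs: "polytime ea (enc_list eb) xs" and s: "polytime ea es s"
    and f: "polytime (enc_pair ea (enc_pair eb es)) es (\<lambda>M y. f M (fst y) (fst (snd y)) (snd (snd y)))"
    and bound: "poly_bounded ea B"
    and size: "\<And>q M x ys zs. efficient_model q M \<Longrightarrow> in_carrier M (ea x) \<Longrightarrow> xs M x = ys @ zs \<Longrightarrow>
        val_size (es (foldr (f M x) zs (s M x))) \<le> B M x"
  shows "polytime ea es (\<lambda>M x. foldr (\<lambda>b a. f M x b a) (xs M x) (s M x))"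
proof -
  have *: "foldr (\<lambda>b a. f M x b a) (xs M x) (s M x) = foldl (\<lambda>a b. f M x b a) (s M x) (rev (xs M x))" for M x
    by (simp add: foldr_conv_foldl)
  show ?thesis unfolding *
  proof (rule polytime_foldl[OF polytime_rev[OF xs] s _ bound, where f = "\<lambda>M x a b. f M x b a"])
    have swap: "polytime (enc_pair ea (enc_pair es eb)) (enc_pair ea (enc_pair eb es)) (\<lambda>M y. (fst y, (snd (snd y), fst (snd y))))"
      by (rule polytime_intros)+
    show "polytime (enc_pair ea (enc_pair es eb)) es (\<lambda>M y. f M (fst y) (snd (snd y)) (fst (snd y)))"
      using polytime_comp[OF swap f] unfolding fst_conv snd_conv .
    show "val_size (es (foldl (\<lambda>a b. f M x b a) (s M x) ys)) \<le> B M x"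
      if "efficient_model q M" "in_carrier M (ea x)" "rev (xs M x) = ys @ zs" for q M x ys zs
    proof -
      have "xs M x = rev zs @ rev ys" using that(3) by (metis rev_append rev_rev_ident)
      from size[OF that(1,2) this] show ?thesis by (simp add: foldr_conv_foldl)
    qed
  qed
qed

lemma polytime_append:
  assumes f: "polytime ea (enc_list eb) f" and g: "polytime ea (enc_list eb) g"
  shows "polytime ea (enc_list eb) (\<lambda>M x. f M x @ g M x)"
proof -
  have eq: "foldr (\<lambda>b a. b # a) xs ys = xs @ ys" for xs ys :: "'c list"
    by (induction xs) auto
  have "polytime ea (enc_list eb) (\<lambda>M x. foldr (\<lambda>b a. b # a) (f M x) (g M x))"
  proof (rule polytime_foldr[OF f g _ poly_bounded_add[OF polytime_size[OF f] polytime_size[OF g]], where f = "\<lambda>M x b a. b # a"])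
    show "polytime (enc_pair ea (enc_pair eb (enc_list eb))) (enc_list eb) (\<lambda>M y. fst (snd y) # snd (snd y))"
      by (rule polytime_intros)+
    show "val_size (enc_list eb (foldr (\<lambda>b a. b # a) zs (g M x))) \<le> val_size (enc_list eb (f M x)) + val_size (enc_list eb (g M x))"
      if "f M x = ys @ zs" for M x ys zs
      unfolding that eq val_size_list by simp
  qed
  then show ?thesis by (simp add: eq)
qed

lemma polytime_concat:
  assumes f: "polytime ea (enc_list (enc_list eb)) f"
  shows "polytime ea (enc_list eb) (\<lambda>M x. concat (f M x))"
proof -
  have eq: "foldr (\<lambda>b a. b @ a) xs [] = concat xs" for xs :: "'c list list"
    by (induction xs) auto
  have le: "val_size (enc_list eb (concat xs)) \<le> val_size (enc_list (enc_list eb) xs)" for xs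
    by (induction xs) (use val_size_append[of eb] in \<open>auto simp: val_size_list\<close>)
  have "polytime ea (enc_list eb) (\<lambda>M x. foldr (\<lambda>b a. b @ a) (f M x) [])"
  proof (rule polytime_foldr[OF f polytime_Nil _ polytime_size[OF f], where f = "\<lambda>M x b a. b @ a"])
    show "polytime (enc_pair ea (enc_pair (enc_list eb) (enc_list eb))) (enc_list eb) (\<lambda>M y. fst (snd y) @ snd (snd y))"
      by (rule polytime_append polytime_intros)+
    show "val_size (enc_list eb (foldr (\<lambda>b a. b @ a) zs [])) \<le> val_size (enc_list (enc_list eb) (f M x))"
      if "f M x = ys @ zs" for M x ys zs
    proof -
      have "val_size (enc_list eb (foldr (\<lambda>b a. b @ a) zs [])) \<le> val_size (enc_list (enc_list eb) zs)"
        unfolding eq by (rule le)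
      also have "\<dots> \<le> val_size (enc_list (enc_list eb) (f M x))" unfolding that val_size_list by simp
      finally show ?thesis .
    qed
  qed
  then show ?thesis by (simp add: eq)
qed

text \<open>
  The size of the result is bounded by the number of elements times the size bound of \<open>f\<close> on an
  element together with its context.
\<close>

lemma polytime_map:
  fixes ea :: "'a \<Rightarrow> 'g val" and eb :: "'b \<Rightarrow> 'g val" and ec :: "'c \<Rightarrow> 'g val"
  assumes xs: "polytime ea (enc_list eb) xs"
    and f: "polytime (enc_pair ea eb) ec (\<lambda>M y. f M (fst y) (snd y))"
  shows "polytime ea (enc_list ec) (\<lambda>M x. map (f M x) (xs M x))"
proof -
  have eq: "foldr (\<lambda>b a. h b # a) xs [] = map h xs" for xs :: "'b list" and h :: "'b \<Rightarrow> 'c"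
    by (induction xs) auto
  have "polytime ea (enc_list ec) (\<lambda>M x. foldr (\<lambda>b a. f M x b # a) (xs M x) [])"
  proof (rule polytime_foldr[OF xs polytime_Nil, where f = "\<lambda>M x b a. f M x b # a"])
    have "polytime (enc_pair ea (enc_pair eb (enc_list ec))) (enc_pair ea eb) (\<lambda>M y. (fst y, fst (snd y)))"
      by (rule polytime_intros)+
    from polytime_comp[OF this f]
    have "polytime (enc_pair ea (enc_pair eb (enc_list ec))) ec (\<lambda>M y. f M (fst y) (fst (snd y)))"
      unfolding fst_conv snd_conv .
    from polytime_Cons[OF this]
    show "polytime (enc_pair ea (enc_pair eb (enc_list ec))) (enc_list ec) (\<lambda>M y. f M (fst y) (fst (snd y)) # snd (snd y))"
      by this (rule polytime_intros)+
    let ?B = "\<lambda>M x. Suc (\<Sum>b\<leftarrow>xs M x. Suc (val_size (ec (f M x b))))"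
    show "val_size (enc_list ec (foldr (\<lambda>b a. f M x b # a) zs [])) \<le> ?B M x"
      if "xs M x = ys @ zs" for M x ys zs
      unfolding that eq val_size_list by (simp add: o_def)
    show "poly_bounded ea ?B"
      unfolding poly_bounded_def
    proof
      fix q
      obtain p1 where p1: "\<forall>M x. efficient_model q M \<longrightarrow> in_carrier M (ea x) \<longrightarrow> val_size (enc_list eb (xs M x)) \<le> poly p1 (input_size M (ea x))"
        using polytime_size[OF xs] unfolding poly_bounded_def by blast
      obtain p2 where p2: "\<forall>M y. efficient_model q M \<longrightarrow> in_carrier M (enc_pair ea eb y) \<longrightarrow>
          val_size (ec (f M (fst y) (snd y))) \<le> poly p2 (input_size M (enc_pair ea eb y))"
        using polytime_size[OF f] unfolding poly_bounded_def by blast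
      define p where "p = 1 + p1 * (1 + pcompose p2 ([:1, 1:] + p1))"
      have "?B M x \<le> poly p (input_size M (ea x))" if M: "efficient_model q M" "in_carrier M (ea x)" for M x
      proof -
        let ?N = "input_size M (ea x)"
        have l: "val_size (enc_list eb (xs M x)) \<le> poly p1 ?N" using p1 M by blast
        have "val_size (enc_list ec (map (f M x) (xs M x))) \<le> Suc (poly p1 ?N * Suc (poly (pcompose p2 ([:1, 1:] + p1)) ?N))"
        proof (rule val_size_list_le)
          show "length (map (f M x) (xs M x)) \<le> poly p1 ?N"
            using l length_less_val_size[of "xs M x" eb] by simp
          fix c assume "c \<in> set (map (f M x) (xs M x))"
          then obtain b where b: "b \<in> set (xs M x)" "c = f M x b" by auto
          have "in_carrier M (enc_list eb (xs M x))" using polytime_in_carrier[OF xs M] .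
          then have g: "in_carrier M (enc_pair ea eb (x, b))" using M b(1) by simp
          have "val_size (ec c) \<le> poly p2 (input_size M (enc_pair ea eb (x, b)))" using p2 M(1) g b(2) by fastforce
          also have "\<dots> \<le> poly p2 (Suc (?N + poly p1 ?N))"
            using val_size_elem_le[OF b(1), of eb] l by (intro poly_nat_mono) simp
          finally show "val_size (ec c) \<le> poly (pcompose p2 ([:1, 1:] + p1)) ?N" by (simp add: poly_pcompose)
        qed
        then show ?thesis by (simp add: p_def val_size_list o_def)
      qed
      then show "\<exists>p. \<forall>M x. efficient_model q M \<longrightarrow> in_carrier M (ea x) \<longrightarrow> ?B M x \<le> poly p (input_size M (ea x))" by blast
    qed
  qed
  then show ?thesis by (simp add: eq)
qed

lemma polytime_list_ex:
  fixes ea :: "'a \<Rightarrow> 'g val" and eb :: "'b \<Rightarrow> 'g val"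
  assumes xs: "polytime ea (enc_list eb) xs"
    and f: "polytime (enc_pair ea eb) bool_val (\<lambda>M y. f M (fst y) (snd y))"
  shows "polytime ea bool_val (\<lambda>M x. \<exists>y\<in>set (xs M x). f M x y)"
proof -
  have eq: "foldr (\<lambda>b a. h b \<or> a) xs False = (\<exists>y\<in>set xs. h y)" for xs :: "'b list" and h :: "'b \<Rightarrow> bool"
    by (induction xs) auto
  have "polytime ea bool_val (\<lambda>M x. foldr (\<lambda>b a. f M x b \<or> a) (xs M x) False)"
  proof (rule polytime_foldr[OF xs polytime_False _ poly_bounded_const[of ea 1], where f = "\<lambda>M x b a. f M x b \<or> a"])
    have "polytime (enc_pair ea (enc_pair eb bool_val)) bool_val (\<lambda>M y. f M (fst y) (fst (snd y)))"
    proof -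
      have "polytime (enc_pair ea (enc_pair eb bool_val)) (enc_pair ea eb) (\<lambda>M y. (fst y, fst (snd y)))"
        by (rule polytime_intros)+
      from polytime_comp[OF this f] show ?thesis unfolding fst_conv snd_conv .
    qed
    from polytime_disj[OF this]
    show "polytime (enc_pair ea (enc_pair eb bool_val)) bool_val (\<lambda>M y. f M (fst y) (fst (snd y)) \<or> snd (snd y))"
      by this (rule polytime_intros)+
  qed (simp add: bool_val_def)
  then show ?thesis by (simp add: eq)
qed

lemma polytime_list_all:
  fixes ea :: "'a \<Rightarrow> 'g val" and eb :: "'b \<Rightarrow> 'g val"
  assumes xs: "polytime ea (enc_list eb) xs"
    and f: "polytime (enc_pair ea eb) bool_val (\<lambda>M y. f M (fst y) (snd y))"
  shows "polytime ea bool_val (\<lambda>M x. \<forall>y\<in>set (xs M x). f M x y)"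
  using polytime_not[OF polytime_list_ex[where f = "\<lambda>M x y. \<not> f M x y", OF xs polytime_not[OF f]]] by simp

text \<open>
  The accumulator is always a sublist of the given list.
\<close>

lemma polytime_select:
  fixes ea :: "'a \<Rightarrow> 'g val" and eb :: "'b \<Rightarrow> 'g val"
  assumes xs: "polytime ea (enc_list eb) xs"
    and f: "polytime (enc_pair ea (enc_pair eb (enc_list eb))) bool_val (\<lambda>M y. f M (fst y) (fst (snd y)) (snd (snd y)))"
  shows "polytime ea (enc_list eb) (\<lambda>M x. foldr (\<lambda>b a. if f M x b a then b # a else a) (xs M x) [])"
proof (rule polytime_foldr[OF xs polytime_Nil _ polytime_size[OF xs], where f = "\<lambda>M x b a. if f M x b a then b # a else a"])
  show "polytime (enc_pair ea (enc_pair eb (enc_list eb))) (enc_list eb)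
      (\<lambda>M y. if f M (fst y) (fst (snd y)) (snd (snd y)) then fst (snd y) # snd (snd y) else snd (snd y))"
    by (rule polytime_if[OF f]; (rule polytime_intros)+)
  show "val_size (enc_list eb (foldr (\<lambda>b a. if f M x b a then b # a else a) zs [])) \<le> val_size (enc_list eb (xs M x))"
    if "xs M x = ys @ zs" for M x ys zs
  proof -
    have "val_size (enc_list eb (foldr (\<lambda>b a. if f M x b a then b # a else a) zs [])) \<le> val_size (enc_list eb zs)"
      by (induction zs) auto
    also have "\<dots> \<le> val_size (enc_list eb (xs M x))" unfolding that val_size_list by simp
    finally show ?thesis .
  qed
qed

lemma polytime_filter:
  fixes ea :: "'a \<Rightarrow> 'g val" and eb :: "'b \<Rightarrow> 'g val"
  assumes xs: "polytime ea (enc_list eb) xs"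
    and f: "polytime (enc_pair ea eb) bool_val (\<lambda>M y. f M (fst y) (snd y))"
  shows "polytime ea (enc_list eb) (\<lambda>M x. filter (f M x) (xs M x))"
proof -
  have eq: "foldr (\<lambda>b a. if h b then b # a else a) xs [] = filter h xs" for xs :: "'b list" and h
    by (induction xs) auto
  have "polytime (enc_pair ea (enc_pair eb (enc_list eb))) (enc_pair ea eb) (\<lambda>M y. (fst y, fst (snd y)))"
    by (rule polytime_intros)+
  from polytime_comp[OF this f]
  have "polytime (enc_pair ea (enc_pair eb (enc_list eb))) bool_val (\<lambda>M y. f M (fst y) (fst (snd y)))"
    unfolding fst_conv snd_conv .
  from polytime_select[OF xs, where f = "\<lambda>M x b a. f M x b", OF this] show ?thesis by (simp add: eq)
qed


lemma enc_list_hd_tl: "xs \<noteq> [] \<Longrightarrow> enc_list ea xs = VPair (ea (hd xs)) (enc_list ea (tl xs))"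
  by (cases xs) auto

lemma polytime_case_list:
  fixes ea :: "'a \<Rightarrow> 'g val" and eb :: "'b \<Rightarrow> 'g val" and ec :: "'c \<Rightarrow> 'g val"
  assumes xs: "polytime ea (enc_list eb) xs" and f: "polytime ea ec f"
    and g: "polytime (enc_pair ea (enc_pair eb (enc_list eb))) ec (\<lambda>M y. g M (fst y) (fst (snd y)) (snd (snd y)))"
  shows "polytime ea ec (\<lambda>M x. case xs M x of [] \<Rightarrow> f M x | b # bs \<Rightarrow> g M x b bs)"
proof -
  let ?h = "\<lambda>y. (fst y, hd (snd y), tl (snd y))"
  have "polytime (enc_pair ea (enc_list eb)) ec (\<lambda>M y. if snd y \<noteq> [] then g M (fst (?h y)) (fst (snd (?h y))) (snd (snd (?h y)))
      else f M (fst y))"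
    by (rule polytime_branch[OF g f, where b = "Snd (Reg 0)" and ?a1.0 = "Reg 0" and ?a2.0 = "Fst (Reg 0)" and k = 5])
      (auto simp: enc_pair_def enc_list_hd_tl dest: list.set_sel(2))
  moreover have "(if ys \<noteq> [] then g M x (hd ys) (tl ys) else f M x) = (case ys of [] \<Rightarrow> f M x | b # bs \<Rightarrow> g M x b bs)"
    for M x ys by (cases ys) auto
  ultimately have "polytime (enc_pair ea (enc_list eb)) ec
      (\<lambda>M y. case snd y of [] \<Rightarrow> f M (fst y) | b # bs \<Rightarrow> g M (fst y) b bs)"
    by (simp only: fst_conv snd_conv)
  from polytime_comp[OF polytime_pair[OF polytime_id xs] this] show ?thesis unfolding fst_conv snd_conv .
qed

lemma polytime_is_Nil:
  assumes "polytime ea (enc_list eb) f"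
  shows "polytime ea bool_val (\<lambda>M x. f M x = [])"
proof -
  have "(case f M x of [] \<Rightarrow> True | b # bs \<Rightarrow> False) = (f M x = [])" for M x by (cases "f M x") auto
  then show ?thesis
    using polytime_case_list[OF assms polytime_True polytime_False] by simp
qed

text \<open>
  One list is traversed by the loop, the other one is consumed as part of the accumulator.
\<close>

lemma polytime_zip:
  fixes ea :: "'a \<Rightarrow> 'g val" and eb :: "'b \<Rightarrow> 'g val" and ec :: "'c \<Rightarrow> 'g val"
  assumes f: "polytime ea (enc_list eb) f" and g: "polytime ea (enc_list ec) g"
  shows "polytime ea (enc_list (enc_pair eb ec)) (\<lambda>M x. zip (f M x) (g M x))"
proof -
  let ?step = "\<lambda>M x a b. case fst a of [] \<Rightarrow> a | c # cs \<Rightarrow> (cs, (b, c) # snd a)"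
  have eq: "foldl (?step M x) (ys, acc) xs = (drop (length xs) ys, rev (zip xs ys) @ acc)"
    for xs :: "'b list" and ys :: "'c list" and acc and M :: "'g group_model" and x :: 'a
  proof (induction xs arbitrary: ys acc)
    case (Cons a xs)
    then show ?case by (cases ys) auto
  qed simp
  have sz: "val_size (enc_list (enc_pair eb ec) (zip xs ys)) \<le> val_size (enc_list eb xs) + val_size (enc_list ec ys)" for xs ys
  proof (induction xs arbitrary: ys)
    case (Cons a xs)
    then show ?case by (cases ys) (auto simp: add_mono le_SucI)
  qed simp
  have "polytime ea (enc_pair (enc_list ec) (enc_list (enc_pair eb ec))) (\<lambda>M x. foldl (\<lambda>a b. ?step M x a b) (g M x, []) (f M x))"
  proof (rule polytime_foldl[OF f _ _ poly_bounded_add[OF poly_bounded_const[of ea 1] poly_bounded_add[OF polytime_size[OF f]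
        poly_bounded_add[OF polytime_size[OF g] polytime_size[OF g]]]], where f = ?step])
    show "polytime ea (enc_pair (enc_list ec) (enc_list (enc_pair eb ec))) (\<lambda>M x. (g M x, []))"
      by (rule g polytime_intros)+
    show "polytime (enc_pair ea (enc_pair (enc_pair (enc_list ec) (enc_list (enc_pair eb ec))) eb)) (enc_pair (enc_list ec) (enc_list (enc_pair eb ec)))
       (\<lambda>M y. case fst (fst (snd y)) of [] \<Rightarrow> fst (snd y)
           | c # cs \<Rightarrow> (cs, (snd (snd y), c) # snd (fst (snd y))))"
      by (rule polytime_case_list polytime_intros)+
    show "val_size (enc_pair (enc_list ec) (enc_list (enc_pair eb ec)) (foldl (\<lambda>a b. ?step M x a b) (g M x, []) ys)) \<le>
        1 + (val_size (enc_list eb (f M x)) + (val_size (enc_list ec (g M x)) + val_size (enc_list ec (g M x))))"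
      if e: "f M x = ys @ zs" for M x ys zs
    proof -
      have 1: "val_size (enc_list eb ys) \<le> val_size (enc_list eb (f M x))" unfolding e val_size_list by simp
      have 2: "val_size (enc_list ec (drop (length ys) (g M x))) \<le> val_size (enc_list ec (g M x))"
        using val_size_append[of ec "take (length ys) (g M x)" "drop (length ys) (g M x)"]
          val_size_pos(2)[of "enc_list ec (take (length ys) (g M x))"]
        unfolding append_take_drop_id by linarith
      have "val_size (enc_list (enc_pair eb ec) (rev (zip ys (g M x)))) = val_size (enc_list (enc_pair eb ec) (zip ys (g M x)))"
        unfolding val_size_list by (simp add: sum_list_rev rev_map[symmetric])
      then show ?thesis using sz[of ys "g M x"] 1 2 unfolding eq by simp
    qed
  qed
  from polytime_rev[OF polytime_snd[OF this]] show ?thesis unfolding eq by simp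
qed

lemma polytime_length:
  assumes f: "polytime ea (enc_list eb) f"
  shows "polytime ea enc_nat (\<lambda>M x. length (f M x))"
proof -
  have eq: "foldr (\<lambda>b a. a + 1) xs 0 = length xs" for xs :: "'c list" by (induction xs) auto
  have "polytime ea enc_nat (\<lambda>M x. foldr (\<lambda>b a. a + 1) (f M x) 0)"
    by (rule polytime_foldr[OF f polytime_const_nat _ poly_bounded_const[of ea 1], where f = "\<lambda>M x b a. a + 1"])
      ((rule polytime_intros)+, simp add: enc_nat_def)
  then show ?thesis by (simp only: eq)
qed

lemma polytime_takeWhile:
  fixes ea :: "'a \<Rightarrow> 'g val" and eb :: "'b \<Rightarrow> 'g val"
  assumes xs: "polytime ea (enc_list eb) xs"
    and f: "polytime (enc_pair ea eb) bool_val (\<lambda>M y. f M (fst y) (snd y))"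
  shows "polytime ea (enc_list eb) (\<lambda>M x. takeWhile (f M x) (xs M x))"
proof -
  have eq: "foldr (\<lambda>b a. if h b then b # a else []) xs [] = takeWhile h xs" for xs :: "'b list" and h
    by (induction xs) auto
  have "polytime ea (enc_list eb) (\<lambda>M x. foldr (\<lambda>b a. if f M x b then b # a else []) (xs M x) [])"
  proof (rule polytime_foldr[OF xs polytime_Nil _ polytime_size[OF xs], where f = "\<lambda>M x b a. if f M x b then b # a else []"])
    have "polytime (enc_pair ea (enc_pair eb (enc_list eb))) (enc_pair ea eb) (\<lambda>M y. (fst y, fst (snd y)))"
      by (rule polytime_intros)+
    from polytime_comp[OF this f]
    have "polytime (enc_pair ea (enc_pair eb (enc_list eb))) bool_val (\<lambda>M y. f M (fst y) (fst (snd y)))"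
      unfolding fst_conv snd_conv .
    from polytime_if[OF this]
    show "polytime (enc_pair ea (enc_pair eb (enc_list eb))) (enc_list eb)
        (\<lambda>M y. if f M (fst y) (fst (snd y)) then fst (snd y) # snd (snd y) else [])"
      by this (rule polytime_intros)+
    show "val_size (enc_list eb (foldr (\<lambda>b a. if f M x b then b # a else []) zs [])) \<le> val_size (enc_list eb (xs M x))"
      if "xs M x = ys @ zs" for M x ys zs
    proof -
      have "val_size (enc_list eb (foldr (\<lambda>b a. if f M x b then b # a else []) zs [])) \<le> val_size (enc_list eb zs)"
        by (induction zs) auto
      also have "\<dots> \<le> val_size (enc_list eb (xs M x))" unfolding that val_size_list by simp
      finally show ?thesis .
    qed
  qed
  then show ?thesis by (simp add: eq)
qed

section \<open>The logarithm of the order of a subgroup\<close>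

lemma val_size_unit_list: "val_size (enc_list enc_unit us) = Suc (2 * length us)"
  by (induction us) (auto simp: enc_unit_def)

text \<open>
  The powers of \<open>2\<close> are found by repeated addition in register \<open>2\<close> until they reach \<open>k\<close>.
\<close>

lemma reaches_log_loop:
  assumes n: "\<And>l. (k \<le> 2 ^ l) = (L \<le> l)"
  shows "i \<le> L \<Longrightarrow> r 1 = enc_nat k \<Longrightarrow> r 2 = enc_nat (2 ^ i) \<Longrightarrow> r 0 = enc_list enc_unit (replicate i ()) \<Longrightarrow>
    reaches M (While (Less (Reg 2) (Reg 1)) (Seq (Assign 0 (PairE NilE (Reg 0))) (Assign 2 (Add (Reg 2) (Reg 2))))) r
      ((L - i) * 20 + 4)
      (\<lambda>r'. r' 0 = enc_list enc_unit (replicate L ()) \<and> (\<forall>j\<ge>3. r' j = r j))"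
proof (induction "L - i" arbitrary: i r)
  case 0
  then have "i = L" by simp
  have "\<not> 2 ^ L < k" using n[of L] by simp
  then have "\<not> (2::int) ^ L < int k" by (metis of_nat_less_iff of_nat_numeral of_nat_power)
  then have "\<not> val_int (r 2) < val_int (r 1)" using 0 \<open>i = L\<close> by (simp add: enc_nat_def)
  then show ?case using 0 \<open>i = L\<close> by (intro reaches_While_False) simp_all
next
  case (Suc m)
  have lt: "2 ^ i < k" using n[of i] Suc.hyps(2) by linarith
  then have lt': "(2::int) ^ i < int k" by (metis of_nat_less_iff of_nat_numeral of_nat_power)
  show ?case
    apply (rule reaches_While_True[where ?T1.0 = 10 and ?T2.0 = "(L - Suc i) * 20 + 4" and
       ?Q1.0 = "\<lambda>r'. r' 1 = enc_nat k \<and> r' 2 = enc_nat (2 ^ Suc i) \<and> r' 0 = enc_list enc_unit (replicate (Suc i) ()) \<and> (\<forall>j\<ge>3. r' j = r j)"])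
    subgoal using Suc.prems lt' by (simp add: enc_nat_def)
    subgoal
      by (rule reaches_Seq_Assign[where T' = 6], rule reaches_Assign)
        (use Suc.prems in \<open>auto simp: enc_unit_def enc_nat_def\<close>)
    subgoal for r1
      by (rule reaches_weaken[OF Suc.hyps(1)[of "Suc i"]]) (use Suc in auto)
    using Suc.hyps(2) by auto
qed

text \<open>
  The order may be exponential in the input size; only its logarithm bounds the number of passes.
\<close>

lemma polytime_log_order:
  assumes "polytime ea (enc_list VElem) f"
  shows "polytime ea (enc_list enc_unit) (\<lambda>M x. replicate (log_order M (f M x)) ())"
proof -
  let ?h = "\<lambda>M xs. replicate (log_order M xs) ()"
  define w where "w = While (Less (Reg 2) (Reg 1)) (Seq (Assign 0 (PairE NilE (Reg 0))) (Assign 2 (Add (Reg 2) (Reg 2))))"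
  define c where "c = Seq (Assign 1 (Group_Op Order (Reg 0))) (Seq (Assign 2 (Const 1)) (Seq (Assign 0 NilE) w))"
  have "polytime (enc_list VElem) (enc_list enc_unit) ?h"
  proof (rule polytimeI[where c = c and n = 3])
    fix q
    define p where "p = op_bound q + [:0, 40:] + 20"
    have "polytime_within q p c 3 (enc_list VElem) (enc_list enc_unit) ?h"
    proof (rule polytime_withinI)
      fix M :: "_ group_model" and xs
      assume M: "efficient_model q M" and "in_carrier M (enc_list VElem xs)"
      then have xs: "set xs \<subseteq> carrier (grp M)" by auto
      let ?N = "input_size M (enc_list VElem xs)"
      let ?k = "card (generate (grp M) (set xs))" and ?L = "log_order M xs"
      have L: "?L \<le> elem_len M" by (rule log_order_le[OF M xs])
      show "in_carrier M (enc_list enc_unit (?h M xs))" by (simp add: enc_unit_def)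
      show "val_size (enc_list enc_unit (?h M xs)) \<le> poly p ?N" using L by (simp add: p_def val_size_unit_list)
      have least: "(?k \<le> 2 ^ l) = (?L \<le> l)" for l
      proof
        assume "?k \<le> 2 ^ l" then show "?L \<le> l" unfolding log_order_def by (rule Least_le)
      next
        assume "?L \<le> l"
        then have "2 ^ ?L \<le> (2::nat) ^ l" by (simp add: power_increasing)
        then show "?k \<le> 2 ^ l" using card_le_log_order[of M xs] by linarith
      qed
      have op: "op_time M Order xs + 20 \<le> poly (op_bound q) ?N"
        by (rule op_time_le[OF M xs]) (simp_all add: val_size_elem_list)
      show "reaches M c r (poly p ?N) (\<lambda>r'. r' 0 = enc_list enc_unit (?h M xs) \<and> (\<forall>i\<ge>3. r' i = r i))"
        if r: "r 0 = enc_list VElem xs" for r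
        unfolding c_def
        apply (rule reaches_Seq_Assign[where T' = "?L * 20 + 8"])
         apply (rule reaches_Seq_Assign[where T' = "?L * 20 + 6"])
          apply (rule reaches_Seq_Assign[where T' = "?L * 20 + 4"])
        subgoal
          unfolding w_def
          by (rule reaches_weaken[OF reaches_log_loop[where i = 0, OF least]])
            (use r in \<open>simp_all add: enc_nat_def\<close>)
        using op L r by (simp_all add: p_def)
    qed
    then show "\<exists>p. polytime_within q p c 3 (enc_list VElem) (enc_list enc_unit) ?h" by blast
  qed
  from polytime_comp[OF assms this] show ?thesis .
qed

section \<open>The running time of the algorithm\<close>

lemma polytime_comp2:
  assumes "polytime (enc_pair eb ec) ed (\<lambda>M y. h M (fst y) (snd y))" "polytime ea eb f" "polytime ea ec g"
  shows "polytime ea ed (\<lambda>M x. h M (f M x) (g M x))"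
  using polytime_comp[OF polytime_pair[OF assms(2,3)] assms(1)] unfolding fst_conv snd_conv .

lemma polytime_comp3:
  assumes "polytime (enc_pair eb (enc_pair ec ed)) ee (\<lambda>M y. h M (fst y) (fst (snd y)) (snd (snd y)))"
    "polytime ea eb f" "polytime ea ec g" "polytime ea ed k"
  shows "polytime ea ee (\<lambda>M x. h M (f M x) (g M x) (k M x))"
  using polytime_comp[OF polytime_pair[OF assms(2) polytime_pair[OF assms(3,4)]] assms(1)] unfolding fst_conv snd_conv .

lemma val_size_vec: "val_size (enc_list enc_nat w) = Suc (2 * length w)"
  by (induction w) (auto simp: enc_nat_def)

text \<open>
  A single loop over both lists decides the order; the lengths matter only if one list extends
  the other.
\<close>

lemma below_foldr: "below u v \<longleftrightarrow>
  foldr (\<lambda>p r. fst p < snd p \<or> fst p = snd p \<and> r) (zip u v) (\<not> length u < length v)"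
  by (induction u v rule: below.induct) auto

lemma polytime_below:
  assumes "polytime ea (enc_list enc_nat) f" "polytime ea (enc_list enc_nat) g"
  shows "polytime ea bool_val (\<lambda>M x. below (f M x) (g M x))"
  unfolding below_foldr
  by (rule polytime_foldr[OF _ _ _ poly_bounded_const[of ea 1], where f = "\<lambda>M x p r. fst p < snd p \<or> fst p = snd p \<and> r"])
    ((rule polytime_zip polytime_length polytime_intros assms)+, simp add: bool_val_def)

lemma polytime_plus_vec:
  assumes "polytime ea (enc_list enc_nat) f" "polytime ea (enc_list enc_nat) g"
  shows "polytime ea (enc_list enc_nat) (\<lambda>M x. f M x +\<^sub>v g M x)"
  unfolding case_prod_beta
  by (rule polytime_map polytime_zip polytime_intros assms)+

lemma trunc_eq: "trunc m w = map snd (takeWhile (\<lambda>p. fst p = 0) (zip m w))"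
proof (induction m arbitrary: w)
  case (Cons k m)
  then show ?case by (cases w) (auto simp: trunc_def)
qed (simp add: trunc_def)

lemma polytime_trunc:
  assumes "polytime ea (enc_list enc_nat) f" "polytime ea (enc_list enc_nat) g"
  shows "polytime ea (enc_list enc_nat) (\<lambda>M x. trunc (f M x) (g M x))"
  unfolding trunc_eq
  by (rule polytime_map polytime_takeWhile polytime_zip polytime_intros assms)+

text \<open>
  The kept generators are a sublist of the given ones, so the size of the accumulator is no issue.
\<close>

lemma polytime_trim:
  assumes "polytime ea (enc_list VElem) f"
  shows "polytime ea (enc_list VElem) (\<lambda>M x. trim M (f M x))"
  unfolding trim_def
  by (rule polytime_select polytime_intros assms)+

lemma polytime_normal_closure_gens:
  assumes "polytime ea (enc_list VElem) f"
  shows "polytime ea (enc_list VElem) (\<lambda>M x. normal_closure_gens M (f M x))"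
  unfolding normal_closure_gens_def by (rule polytime_trim polytime_intros assms)+

lemma polytime_commutator_gens:
  assumes "polytime ea (enc_list VElem) f" "polytime ea (enc_list VElem) g"
  shows "polytime ea (enc_list VElem) (\<lambda>M x. commutator_gens M (f M x) (g M x))"
proof (rule polytime_comp2[OF _ assms])
  show "polytime (enc_pair (enc_list VElem) (enc_list VElem)) (enc_list VElem) (\<lambda>M y. commutator_gens M (fst y) (snd y))"
    unfolding commutator_gens_def
    by (rule polytime_normal_closure_gens polytime_concat polytime_map polytime_intros)+
qed

text \<open>
  Without trimming, the generating lists could grow polynomially at each commutator.
\<close>

lemma polytime_iter_commutator_gens:
  assumes "polytime ea (enc_list enc_unit) us" "polytime ea (enc_list VElem) f" "polytime ea (enc_list VElem) g"
  shows "polytime ea (enc_list VElem) (\<lambda>M x. iter_commutator_gens M (us M x) (f M x) (g M x))"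
proof (rule polytime_comp3[OF _ assms])
  let ?ea = "enc_pair (enc_list enc_unit) (enc_pair (enc_list VElem) (enc_list VElem))"
  have "polytime ?ea (enc_list VElem) (\<lambda>M y. foldr (\<lambda>b a. commutator_gens M a (snd (snd y))) (fst y) (fst (snd y)))"
  proof (rule polytime_foldr[where f = "\<lambda>M y b a. commutator_gens M a (snd (snd y))" and B = "\<lambda>M x. 1 + 2 * input_size M (?ea x)"])
    show "val_size (enc_list VElem (foldr (\<lambda>b a. commutator_gens M a (snd (snd x))) zs (fst (snd x)))) \<le> 1 + 2 * input_size M (?ea x)"
      if M: "efficient_model q M" and x: "in_carrier M (?ea x)" for q M x and zs :: "unit list"
    proof -
      interpret model M q by (rule model.intro[OF M])
      have "ok (fst (snd x))" "ok (snd (snd x))" using x by (auto simp: enc_pair_def)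
      from iter_commutator_gens(2)[OF this, of zs]
      have "length (foldr (\<lambda>b a. commutator_gens M a (snd (snd x))) zs (fst (snd x))) \<le> elem_len M + length (fst (snd x))"
        by (simp add: iter_commutator_gens_def)
      then show ?thesis by (simp add: val_size_elem_list enc_pair_def)
    qed
  qed (rule polytime_commutator_gens polytime_intros poly_bounded_intros)+
  then show "polytime ?ea (enc_list VElem) (\<lambda>M y. iter_commutator_gens M (fst y) (fst (snd y)) (snd (snd y)))"
    by (simp only: iter_commutator_gens_def)
qed

abbreviation enc_levels :: "'g levels \<Rightarrow> 'g val" where
  "enc_levels \<equiv> enc_list (enc_pair (enc_list enc_nat) (enc_list VElem))"

lemma polytime_cumulate:
  assumes "polytime ea enc_levels f"
  shows "polytime ea enc_levels (\<lambda>M x. cumulate M (f M x))"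
proof (rule polytime_comp[OF assms])
  show "polytime enc_levels enc_levels cumulate"
    unfolding cumulate_def[abs_def]
    by (rule polytime_normal_closure_gens polytime_below polytime_concat polytime_filter polytime_map polytime_intros)+
qed

lemma polytime_dominated:
  assumes "polytime ea enc_levels f" "polytime ea (enc_pair (enc_list enc_nat) (enc_list VElem)) g"
  shows "polytime ea bool_val (\<lambda>M x. dominated M (f M x) (g M x))"
proof (rule polytime_comp2[OF _ assms])
  show "polytime (enc_pair enc_levels (enc_pair (enc_list enc_nat) (enc_list VElem))) bool_val (\<lambda>M y. dominated M (fst y) (snd y))"
    unfolding dominated_def
    by (rule polytime_list_ex polytime_below polytime_intros)+
qed

lemma polytime_canonical:
  assumes "polytime ea enc_levels f"
  shows "polytime ea enc_levels (\<lambda>M x. canonical M (f M x))"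
proof (rule polytime_comp[OF assms])
  show "polytime enc_levels enc_levels canonical"
    unfolding canonical_def[abs_def]
    by (rule polytime_select polytime_cumulate polytime_dominated polytime_list_ex polytime_intros)+
qed

lemma polytime_expand:
  assumes "polytime ea (enc_list enc_unit) us" "polytime ea enc_levels f" "polytime ea enc_levels g"
  shows "polytime ea enc_levels (\<lambda>M x. expand M (us M x) (f M x) (g M x))"
proof (rule polytime_comp3[OF _ assms])
  show "polytime (enc_pair (enc_list enc_unit) (enc_pair enc_levels enc_levels)) enc_levels
      (\<lambda>M y. expand M (fst y) (fst (snd y)) (snd (snd y)))"
    unfolding expand_def
    by (rule polytime_append polytime_concat polytime_map polytime_plus_vec polytime_commutator_gens
        polytime_trunc polytime_iter_commutator_gens polytime_intros)+
qed

lemma polytime_fuel: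
  assumes "polytime ea enc_levels f"
  shows "polytime ea (enc_list enc_unit) (\<lambda>M x. fuel M (f M x))"
  unfolding fuel_def by (rule polytime_log_order polytime_concat polytime_map polytime_intros assms)+

text \<open>
  The sizes do not accumulate over the rounds: the canonical form bounds them in terms of
  \<open>elem_len\<close> alone, and no operation lengthens a weight.
\<close>

lemma (in model) rounds_bounded:
  assumes D: "ok_levels D" "\<forall>p\<in>set D. length (fst p) \<le> k"
  shows "ok_levels (rounds M us D vs) \<and> (\<forall>p\<in>set (rounds M us D vs). length (fst p) \<le> k) \<and>
    (vs = [] \<or> length (rounds M us D vs) \<le> elem_len M + 2 \<and> (\<forall>p\<in>set (rounds M us D vs). length (snd p) \<le> elem_len M))"
proof (induction vs)
  case Nil
  then show ?case using D by (simp add: rounds_def)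
next
  case (Cons v vs)
  let ?F = "rounds M us D vs" and ?E = "expand M us D (rounds M us D vs)"
  have F: "ok_levels ?F" "\<forall>p\<in>set ?F. length (fst p) \<le> k" using Cons.IH by auto
  have E: "ok_levels ?E" by (rule expand_ok[OF D(1) F(1)])
  have e: "rounds M us D (v # vs) = canonical M ?E" by (simp add: rounds_def)
  have w: "length (fst p) \<le> k" if "p \<in> set ?E" for p
    using that
  proof (cases rule: in_expandE)
    case 1
    then show ?thesis using F(2) by blast
  next
    case (2 x y)
    then have "length (fst x) \<le> k" using F(2) by blast
    then show ?thesis using 2(3) by simp
  next
    case (3 x y)
    then have "length (fst x) \<le> k" using F(2) by blast
    then show ?thesis using 3(3) by (simp add: trunc_def)
  qed
  have c: "length (fst p) \<le> k \<and> length (snd p) \<le> elem_len M" if "p \<in> set (canonical M ?E)" for p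
  proof -
    have p: "p \<in> set (cumulate M ?E)" using that canonical(1)[OF E] by blast
    from cumulate_ok(5)[OF E p] obtain p' where "p' \<in> set ?E" "fst p' = fst p" by blast
    then show ?thesis using w[of p'] cumulate_ok(2)[OF E p] by simp
  qed
  show ?case unfolding e using c canonical_ok[OF E] length_canonical[OF E] by blast
qed

lemma polytime_rounds:
  assumes "polytime ea (enc_list enc_unit) us" "polytime ea enc_levels f" "polytime ea (enc_list enc_unit) vs"
  shows "polytime ea enc_levels (\<lambda>M x. rounds M (us M x) (f M x) (vs M x))"
proof (rule polytime_comp3[OF _ assms])
  let ?ea = "enc_pair (enc_list enc_unit) (enc_pair enc_levels (enc_list enc_unit))"
  have "polytime ?ea enc_levels (\<lambda>M y. foldr (\<lambda>b a. canonical M (expand M (fst y) (fst (snd y)) a)) (snd (snd y)) (fst (snd y)))"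
  proof (rule polytime_foldr[where f = "\<lambda>M y b a. canonical M (expand M (fst y) (fst (snd y)) a)" and
      B = "\<lambda>M x. (1 + (input_size M (?ea x) + 2) * (4 * input_size M (?ea x) + 4)) + input_size M (?ea x)"])
    show "val_size (enc_levels (foldr (\<lambda>b a. canonical M (expand M (fst x) (fst (snd x)) a)) zs (fst (snd x)))) \<le>
        (1 + (input_size M (?ea x) + 2) * (4 * input_size M (?ea x) + 4)) + input_size M (?ea x)"
      if M: "efficient_model q M" and x: "in_carrier M (?ea x)" for q M x and zs :: "unit list"
    proof -
      interpret model M q by (rule model.intro[OF M])
      let ?N = "input_size M (?ea x)" and ?D = "fst (snd x)"
      have ok: "ok_levels ?D" using x by (auto simp: enc_pair_def)
      have DN: "val_size (enc_levels ?D) \<le> ?N" by (simp add: enc_pair_def)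
      have wN: "\<forall>p\<in>set ?D. length (fst p) \<le> ?N"
      proof
        fix p assume p: "p \<in> set ?D"
        have "length (fst p) \<le> val_size (enc_pair (enc_list enc_nat) (enc_list VElem) p)" by (simp add: enc_pair_def val_size_vec)
        also have "\<dots> \<le> val_size (enc_levels ?D)" by (rule val_size_elem_le[OF p])
        finally show "length (fst p) \<le> ?N" using DN by linarith
      qed
      have e: "foldr (\<lambda>b a. canonical M (expand M (fst x) ?D a)) zs ?D = rounds M (fst x) ?D zs"
        by (simp add: rounds_def)
      show ?thesis
      proof (cases "zs = []")
        case True
        then show ?thesis using DN by (simp only: foldr.simps id_apply trans_le_add2)
      next
        case False
        then have b: "length (rounds M (fst x) ?D zs) \<le> elem_len M + 2"
          "\<forall>p\<in>set (rounds M (fst x) ?D zs). length (snd p) \<le> elem_len M"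
          "\<forall>p\<in>set (rounds M (fst x) ?D zs). length (fst p) \<le> ?N"
          using rounds_bounded[OF ok wN, of "fst x" zs] by auto
        have "val_size (enc_levels (rounds M (fst x) ?D zs)) \<le> Suc ((?N + 2) * Suc (4 * ?N + 3))"
        proof (rule val_size_list_le)
          show "length (rounds M (fst x) ?D zs) \<le> ?N + 2" using b(1) by simp
          fix p assume p: "p \<in> set (rounds M (fst x) ?D zs)"
          have "length (fst p) \<le> ?N" "length (snd p) \<le> ?N" using b(2,3) p by (auto simp: trans_le_add1)
          then show "val_size (enc_pair (enc_list enc_nat) (enc_list VElem) p) \<le> 4 * ?N + 3"
            by (simp add: enc_pair_def val_size_vec val_size_elem_list)
        qed
        also have "\<dots> = 1 + (?N + 2) * (4 * ?N + 4)" by simp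
        also have "\<dots> \<le> 1 + (?N + 2) * (4 * ?N + 4) + ?N" by (rule le_add1)
        finally show ?thesis unfolding e .
      qed
    qed
  qed (rule polytime_canonical polytime_expand polytime_intros poly_bounded_intros)+
  then show "polytime ?ea enc_levels (\<lambda>M y. rounds M (fst y) (fst (snd y)) (snd (snd y)))"
    by (simp only: rounds_def)
qed

lemma polytime_closure_levels:
  assumes "polytime ea enc_levels f"
  shows "polytime ea enc_levels (\<lambda>M x. closure_levels M (f M x))"
  unfolding closure_levels_def
  by (rule polytime_rounds polytime_fuel polytime_append polytime_intros assms)+

lemma polytime_zero_vec:
  assumes "polytime ea enc_levels f"
  shows "polytime ea (enc_list enc_nat) (\<lambda>M x. zero_vec (f M x))"
  unfolding zero_vec_def
  by (rule polytime_case_list polytime_map polytime_intros assms)+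

lemma polytime_succ_vec:
  fixes ea :: "'a \<Rightarrow> 'g val"
  assumes "polytime ea (enc_list enc_nat) f" "polytime ea (enc_list enc_nat) g"
  shows "polytime ea (enc_list enc_nat) (\<lambda>M x. succ_vec (f M x) (g M x))"
proof (rule polytime_comp2[OF _ assms])
  let ?ev = "enc_list enc_nat :: nat list \<Rightarrow> 'g val"
  let ?ea = "enc_pair ?ev ?ev"
  have len1: "length (foldr (\<lambda>x r. if r = [] then [x + 1] else x # r) w []) = length w" for w :: "nat list"
    by (induction w) auto
  have len2: "length (foldr (\<lambda>_ r. tl r) w z) = length z - length w" for w z :: "nat list"
    by (induction w) auto
  have 1: "polytime ?ea (enc_list enc_nat) (\<lambda>M y. foldr (\<lambda>x r. if r = [] then [x + 1] else x # r) (snd y) [])"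
  proof (rule polytime_foldr[where f = "\<lambda>M y x r. if r = [] then [x + 1] else x # r" and B = "\<lambda>M x. 1 + 2 * input_size M (?ea x)"])
    show "val_size (?ev (foldr (\<lambda>x r. if r = [] then [x + 1] else x # r) zs [])) \<le> 1 + 2 * input_size M (?ea x)"
      if "snd x = ys @ zs" for M :: "'g group_model" and x :: "nat list \<times> nat list" and ys zs
      using that len1[of zs] by (simp add: val_size_vec enc_pair_def)
  qed (rule polytime_is_Nil polytime_intros poly_bounded_intros)+
  have 2: "polytime ?ea (enc_list enc_nat) (\<lambda>M y. foldr (\<lambda>x r. tl r) (snd y) (fst y))"
  proof (rule polytime_foldr[where f = "\<lambda>M y x r. tl r" and B = "\<lambda>M x. 1 + 2 * input_size M (?ea x)"])
    show "val_size (?ev (foldr (\<lambda>x r. tl r) zs (fst x))) \<le> 1 + 2 * input_size M (?ea x)"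
      for M :: "'g group_model" and x :: "nat list \<times> nat list" and zs :: "nat list"
      using len2[of zs "fst x"] by (simp add: val_size_vec enc_pair_def)
  qed (rule polytime_intros poly_bounded_intros)+
  show "polytime ?ea (enc_list enc_nat) (\<lambda>M y. succ_vec (fst y) (snd y))"
    unfolding succ_vec_def by (rule polytime_append[OF 1 2])
qed

lemma length_succ_vec_le: "length (succ_vec z w) \<le> length z + length w"
proof (induction w arbitrary: z)
  case (Cons x w)
  show ?case using Cons[of "tl z"] by (auto simp: succ_vec_simps)
qed (simp add: succ_vec_simps)

lemma polytime_level_min:
  fixes ea :: "'a \<Rightarrow> 'g val"
  assumes "polytime ea (enc_list enc_nat) z" "polytime ea enc_levels f" "polytime ea (enc_list enc_nat) w"
  shows "polytime ea (enc_list enc_nat) (\<lambda>M x. level_min (z M x) (f M x) (w M x))"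
proof (rule polytime_comp3[OF _ assms])
  let ?ev = "enc_list enc_nat :: nat list \<Rightarrow> 'g val"
  let ?ea = "enc_pair ?ev (enc_pair enc_levels ?ev)"
  let ?f = "\<lambda>M y p r. if below (snd (snd y)) (fst p) \<or> below (succ_vec (fst y) (fst p)) r then r else succ_vec (fst y) (fst p)"
  have "polytime ?ea (enc_list enc_nat) (\<lambda>M y. foldr (\<lambda>p r. ?f M y p r) (fst (snd y)) (fst y))"
  proof (rule polytime_foldr[where f = ?f and B = "\<lambda>M x. 1 + 4 * input_size M (?ea x)"])
    show "val_size (?ev (foldr (?f M x) zs (fst x))) \<le> 1 + 4 * input_size M (?ea x)"
      if "fst (snd x) = ys @ zs" for M :: "'g group_model" and x ys zs
    proof -
      let ?N = "input_size M (?ea x)"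
      have wN: "length (fst p) \<le> ?N" if p: "p \<in> set (fst (snd x))" for p
      proof -
        have "length (fst p) \<le> val_size (enc_pair (enc_list enc_nat) (enc_list VElem) p)" by (simp add: enc_pair_def val_size_vec)
        also have "\<dots> \<le> val_size (enc_levels (fst (snd x)))" by (rule val_size_elem_le[OF p])
        also have "\<dots> \<le> ?N" by (simp add: enc_pair_def)
        finally show ?thesis .
      qed
      have "length (foldr (?f M x) zs (fst x)) \<le> length (fst x) + ?N"
        if "set zs \<subseteq> set (fst (snd x))" for zs
        using that
      proof (induction zs)
        case (Cons p zs)
        then show ?case using length_succ_vec_le[of "fst x" "fst p"] wN[of p] by auto
      qed simp
      from this[of zs] have "length (foldr (?f M x) zs (fst x)) \<le> length (fst x) + ?N"
        using that by simp
      moreover have "length (fst x) \<le> ?N" by (simp add: enc_pair_def val_size_vec)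
      ultimately show ?thesis by (simp add: val_size_vec)
    qed
  qed (rule polytime_below polytime_succ_vec polytime_intros poly_bounded_intros)+
  then show "polytime ?ea (enc_list enc_nat) (\<lambda>M y. level_min (fst y) (fst (snd y)) (snd (snd y)))"
    by (simp only: level_min_def)
qed

lemma polytime_const_int: "polytime ea VInt (\<lambda>M x. k)"
  by (rule polytime_expr[where a = "Const k"]) (auto intro: exI[of _ "1"])

lemma polytime_stored_levels:
  assumes "polytime ea enc_levels f" "polytime ea enc_levels g"
  shows "polytime ea (enc_pair VInt enc_levels) (\<lambda>M x. stored_levels M (f M x) (g M x))"
proof (rule polytime_comp2[OF _ assms])
  show "polytime (enc_pair enc_levels enc_levels) (enc_pair VInt enc_levels) (\<lambda>M y. stored_levels M (fst y) (snd y))"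
    unfolding stored_levels_def
    by (rule polytime_list_all polytime_map polytime_level_min polytime_zero_vec polytime_length
        polytime_const_int polytime_intros)+
qed

section \<open>Stored prefilters as input\<close>

lemma encode_eq: "encode D = enc_pair VInt enc_levels D"
  unfolding encode_def enc_list_def enc_nat_def enc_pair_def by (simp add: case_prod_beta')

text \<open>
  Besides the properties used by the algorithm, nontriviality of the stored subgroups shows that
  \<open>elem_len\<close> and the number of generators are positive.
\<close>

lemma stores_generate_input:
  assumes M: "efficient_model q M" and pre: "prefilter (grp M) d \<pi>" and maxima: "has_maxima (grp M) d \<pi>"
    and D: "stores (grp M) d \<pi> D"
  shows "generate_input M q d \<pi> (snd D)"
    "\<And>p. p \<in> set (snd D) \<Longrightarrow> snd p \<noteq> [] \<and> set (snd p) \<subseteq> carrier (grp M) \<and> 0 < elem_len M"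
proof -
  interpret model M q by (rule model.intro[OF M])
  have sign: "fst D = 1" using D maxima by (simp add: stores_def Let_def)
  have ok: "ok (snd p)" if "p \<in> set (snd D)" for p
    using D that unfolding stores_def Let_def by (auto simp: case_prod_beta)
  have pairs: "(m, H) \<in> (\<lambda>p. (fst p, gen (snd p))) ` set (snd D) \<longleftrightarrow>
      H \<in> \<pi> ` vecs d \<and> H \<noteq> {\<one>\<^bsub>G\<^esub>} \<and> is_max (level_set d \<pi> H) m" for m H
  proof -
    have S: "(\<lambda>p. (fst p, gen (snd p))) ` set (snd D) =
      {(m, H). H \<in> \<pi> ` vecs d \<and> H \<noteq> {\<one>\<^bsub>G\<^esub>} \<and> is_max (level_set d \<pi> H) m}"
      using D sign by (simp add: stores_def Let_def case_prod_beta')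
    show ?thesis unfolding S by simp
  qed
  have pp: "gen (snd p) \<in> \<pi> ` vecs d \<and> gen (snd p) \<noteq> {\<one>\<^bsub>G\<^esub>} \<and>
      is_max (level_set d \<pi> (gen (snd p))) (fst p)" if "p \<in> set (snd D)" for p
    using imageI[OF that, of "\<lambda>p. (fst p, gen (snd p))"] unfolding pairs .
  have p: "gen (snd p) \<noteq> {\<one>\<^bsub>G\<^esub>}" "is_max (level_set d \<pi> (gen (snd p))) (fst p)" if "p \<in> set (snd D)" for p
    using pp[OF that] by simp_all
  show "generate_input M q d \<pi> (snd D)"
  proof (intro generate_input.intro model.intro M generate_input_axioms.intro finite_prefilter.intro
      finite_prefilter_axioms.intro group_axioms finite_carrier pre)
    fix p assume "p \<in> set (snd D)"
    then have "fst p \<in> level_set d \<pi> (gen (snd p))" "ok (snd p)" using p(2) ok by (simp_all add: is_max_def)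
    then show "length (fst p) = d \<and> set (snd p) \<subseteq> carrier G \<and> gen (snd p) = \<pi> (fst p)"
      by (simp add: level_set_def vecs_def)
  next
    fix s assume s: "s \<in> vecs d" "\<pi> s \<noteq> {\<one>\<^bsub>G\<^esub>}"
    from maxima[unfolded has_maxima_def, rule_format, OF imageI[OF s(1)] s(2)]
    obtain m where m: "is_max (level_set d \<pi> (\<pi> s)) m" by (rule exE)
    have "(m, \<pi> s) \<in> (\<lambda>p. (fst p, gen (snd p))) ` set (snd D)"
      unfolding pairs by (intro conjI imageI s m)
    then obtain p where p: "p \<in> set (snd D)" "(m, \<pi> s) = (fst p, gen (snd p))" by (rule imageE)
    have "s \<le> m" using m s by (simp add: is_max_def level_set_def)
    then show "\<exists>p\<in>set (snd D). s \<le> fst p \<and> gen (snd p) = \<pi> s"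
      using p by (intro bexI[OF _ p(1)]) simp
  qed
  show "snd p \<noteq> [] \<and> set (snd p) \<subseteq> carrier (grp M) \<and> 0 < elem_len M" if "p \<in> set (snd D)" for p
  proof (intro conjI ok[OF that])
    show "snd p \<noteq> []"
    proof
      assume "snd p = []"
      then show False using p(1)[OF that] generate_empty by simp
    qed
    show "0 < elem_len M"
    proof (rule ccontr)
      assume "\<not> 0 < elem_len M"
      then have "gen_order M (snd p) \<le> 1" using card_generate_le[OF M ok[OF that]] by simp
      then have "gen (snd p) \<subseteq> {\<one>\<^bsub>G\<^esub>}" using gen_trivial_iff[OF ok[OF that]] by simp
      moreover have "{\<one>\<^bsub>G\<^esub>} \<subseteq> gen (snd p)" by (simp add: generate.one)
      ultimately show False using p(1)[OF that] by (simp add: subset_antisym)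
    qed
  qed
qed

text \<open>
  Every coordinate and every generator contributes at least one bit to the input length, and every pair contains
  a generator. This pays for the inner nodes of the encoded input.
\<close>

lemma input_size_le_input_length:
  assumes "snd D \<noteq> []" "\<And>p. p \<in> set (snd D) \<Longrightarrow> snd p \<noteq> [] \<and> 0 < elem_len M"
  shows "input_size M (encode D) \<le> 10 * input_length M D"
proof -
  let ?w = "\<lambda>p. (\<Sum>k\<leftarrow>fst p. Suc (floorlog 2 k)) + elem_len M * length (snd p)"
  have il: "input_length M D = 1 + (\<Sum>p\<leftarrow>snd D. ?w p)"
    by (simp add: input_length_def case_prod_beta')
  have len: "length m \<le> (\<Sum>k\<leftarrow>m. Suc (floorlog 2 k))" for m by (induction m) auto
  have pos: "0 < length (snd p)" "0 < elem_len M" if "p \<in> set (snd D)" for p using assms(2)[OF that] by auto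
  have w: "length (fst p) + length (snd p) \<le> ?w p" if "p \<in> set (snd D)" for p
  proof -
    have "length (snd p) \<le> elem_len M * length (snd p)"
      using pos(2)[OF that] by (cases "elem_len M") auto
    then show ?thesis by (rule add_mono[OF len])
  qed
  obtain p0 where p0: "p0 \<in> set (snd D)" using assms(1) by (cases "snd D") auto
  have "elem_len M * 1 \<le> elem_len M * length (snd p0)"
    using pos(1)[OF p0] by (cases "snd p0") auto
  also have "\<dots> \<le> ?w p0" by simp
  also have "\<dots> \<le> (\<Sum>p\<leftarrow>snd D. ?w p)" using p0 by (intro member_le_sum_list) auto
  finally have e: "elem_len M \<le> (\<Sum>p\<leftarrow>snd D. ?w p)" by simp
  have "(\<Sum>p\<leftarrow>snd D. Suc (val_size (enc_pair (enc_list enc_nat) (enc_list VElem) p))) \<le> (\<Sum>p\<leftarrow>snd D. 6 * ?w p)"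
  proof (rule sum_list_mono)
    have arith: "a + b \<le> c \<Longrightarrow> 0 < b \<Longrightarrow> 4 + 2 * a + 2 * b \<le> 6 * c" for a b c :: nat by linarith
    fix p assume p: "p \<in> set (snd D)"
    have v: "Suc (val_size (enc_pair (enc_list enc_nat) (enc_list VElem) p)) = 4 + 2 * length (fst p) + 2 * length (snd p)"
      by (simp add: enc_pair_def val_size_vec val_size_elem_list)
    show "Suc (val_size (enc_pair (enc_list enc_nat) (enc_list VElem) p)) \<le> 6 * ?w p"
      unfolding v by (rule arith[OF w[OF p] pos(1)[OF p]])
  qed
  also have "\<dots> = 6 * (\<Sum>p\<leftarrow>snd D. ?w p)" by (rule sum_list_const_mult)
  finally have "val_size (encode D) \<le> 3 + 6 * (\<Sum>p\<leftarrow>snd D. ?w p)"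
    by (simp add: encode_eq enc_pair_def val_size_list)
  then show ?thesis using e il by simp
qed

theorem theorem4:
  shows "\<exists>generate_prog :: prog. \<forall>q :: nat poly. \<exists>p :: nat poly.
    \<forall>(M :: 'g group_model) (d :: nat) (\<pi> :: nat list \<Rightarrow> 'g set) (D :: 'g stored).
      efficient_model q M \<and> prefilter (grp M) d \<pi> \<and> has_maxima (grp M) d \<pi> \<and>
      stores (grp M) d \<pi> D \<longrightarrow>
      (\<exists>t D'. runs M generate_prog D t D' \<and> t \<le> poly p (input_length M D) \<and>
              stores (grp M) d (filter_closure (grp M) d \<pi>) D')"
proof -
  let ?e = "enc_pair VInt enc_levels :: int \<times> 'g levels \<Rightarrow> 'g val"
  let ?f = "\<lambda>M y. stored_levels M (snd y) (closure_levels M (snd y))"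
  have "polytime ?e ?e ?f"
    by (rule polytime_stored_levels polytime_closure_levels polytime_intros)+
  from polytimeE[OF this] obtain c n where c: "\<forall>q. \<exists>p. polytime_within q p c n ?e ?e ?f" .
  \<comment> \<open>The empty input has length \<open>1\<close>, but the running time on it would still depend on \<open>elem_len\<close>.
    A trivial prefilter is therefore answered separately.\<close>
  define prog where "prog = Cond (Snd (Reg 0)) c (Assign 0 (PairE (Const 1) NilE))"
  show ?thesis
  proof (intro exI[of _ prog] allI)
    fix q :: "nat poly"
    obtain p where p: "polytime_within q p c n ?e ?e ?f" using c by blast
    define p' where "p' = pcompose p [:0, 10:] + [:20:]"
    have main: "\<exists>t D'. runs M prog D t D' \<and> t \<le> poly p' (input_length M D) \<and>
              stores (grp M) d (filter_closure (grp M) d \<pi>) D'"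
      if M: "efficient_model q M" and pre: "prefilter (grp M) d \<pi>" and mx: "has_maxima (grp M) d \<pi>"
        and D: "stores (grp M) d \<pi> D" for M :: "'g group_model" and d \<pi> D
    proof -
      interpret generate_input M q d \<pi> "snd D" by (rule stores_generate_input[OF M pre mx D])
      note ok = stores_generate_input(2)[OF M pre mx D]
      let ?r = "(\<lambda>_. VNil)(0 := encode D) :: 'g regs"
      have "reaches M prog ?r (poly p' (input_length M D)) (\<lambda>r'. r' 0 = encode (?f M D))"
      proof (cases "snd D = []")
        case True
        have e: "?f M D = (1, [])"
          using True by (simp add: stored_levels_def closure_levels_def rounds_Nil)
        show ?thesis
          unfolding prog_def
        proof (rule reaches_Cond[where ?T1.0 = 4])
          show "reaches M c ?r 4 (\<lambda>r'. r' 0 = encode (?f M D))" if "eval M (Snd (Reg 0)) ?r \<noteq> VNil"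
            using that True by (simp add: encode_def)
          show "reaches M (Assign 0 (PairE (Const 1) NilE)) ?r 4 (\<lambda>r'. r' 0 = encode (?f M D))"
            by (rule reaches_Assign) (simp_all add: e encode_def)
        qed (simp add: p'_def)
      next
        case False
        have g: "in_carrier M (?e D)" using ok by (auto simp: in_carrier_pair enc_nat_def)
        have sz: "input_size M (?e D) \<le> 10 * input_length M D"
          using input_size_le_input_length[OF False] ok by (simp add: encode_eq)
        have le: "poly p (input_size M (?e D)) + 20 \<le> poly p' (input_length M D)"
          using poly_nat_mono[OF sz, of p] by (simp add: p'_def poly_pcompose mult.commute)
        show ?thesis
          unfolding prog_def
        proof (rule reaches_Cond[where ?T1.0 = "poly p (input_size M (?e D))"])
          show "reaches M c ?r (poly p (input_size M (?e D))) (\<lambda>r'. r' 0 = encode (?f M D))"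
            by (rule reaches_weaken[OF polytime_withinD(3)[OF p M g]]) (simp_all add: encode_eq)
          show "reaches M (Assign 0 (PairE (Const 1) NilE)) ?r (poly p (input_size M (?e D))) (\<lambda>r'. r' 0 = encode (?f M D))"
            if "eval M (Snd (Reg 0)) ?r = VNil"
            using that False by (simp add: encode_eq enc_pair_def)
        qed (use le in simp)
      qed
      then obtain t where "runs M prog D t (?f M D)" "t \<le> poly p' (input_length M D)"
        unfolding reaches_def runs_def by blast
      then show ?thesis using stored_levels_correct by blast
    qed
    show "\<exists>p. \<forall>(M :: 'g group_model) d \<pi> D. efficient_model q M \<and> prefilter (grp M) d \<pi> \<and> has_maxima (grp M) d \<pi> \<and>
      stores (grp M) d \<pi> D \<longrightarrow>
      (\<exists>t D'. runs M prog D t D' \<and> t \<le> poly p (input_length M D) \<and>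
              stores (grp M) d (filter_closure (grp M) d \<pi>) D')" by (rule exI[of _ p'], intro allI impI, elim conjE) (rule main)
  qed
qed

end
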